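(* Let $\mathcal{P}$ be a set of exchange types. Assume that, for every non-isolated exchange type $\mathcal{T}\in\mathcal{P}$, there is a skew-symmetric matrix $\mathsf{A}\in\mathcal{T}$ and indices $i,j$ such that (1) $\mathsf{A}_{ij}\neq0$ and $i$ is either a source or a sink in $\mathsf{A}$, and (2) the exchange types of the freezings $\mathsf{A}^{(i)}$ and $\mathsf{A}^{(j)}$ are both in $\mathcal{P}$. Then $\mathcal{A}_q=\mathcal{U}_q$ for every quantum cluster algebra $\mathcal{A}_q$ with exchange type in $\mathcal{P}$.
   Context: Let $\mathbb{Z}_q=\mathbb{Z}[q^{\pm1/2}]$. A quantum seed in a skew-field $\mathcal{F}$ is a triple $(\mathbf{B},\Lambda,M)$: for a subset $\mathbf{ex}\subseteq\{1,\dots,N\}$, $\mathbf{B}$ is an $N\times\mathbf{ex}$ integer matrix whose $\mathbf{ex}\times\mathbf{ex}$ part $\pi\mathbf{B}$ is skew-symmetric; $\Lambda$ is an $N\times N$ skew-symmetric integer matrix with $\Lambda\mathbf{B}=D\iota$, where $\iota:\mathbb{Z}^{\mathbf{ex}}\to\mathbb{Z}^N$ is the inclusion and $D$ is diagonal with positive entries; $M:\mathbb{Z}^N\to\mathcal{F}\setminus\{0\}$ satisfies $M(\alpha)M(\beta)=q^{\frac12\Lambda(\alpha,\beta)}M(\alpha+\beta)$ (with $\Lambda(\alpha,\beta)=\sum\Lambda_{ij}\alpha_i\beta_j$), and the $\mathbb{Z}_q$-span of $M(\mathbb{Z}^N)$ is a quantum torus (with the $M(\alpha)$ a free $\mathbb{Z}_q$-basis)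 whose skew-field of fractions is $\mathcal{F}$. The mutation at $i\in\mathbf{ex}$ is the unique quantum seed $(\mathbf{B}',\Lambda',M')$ in $\mathcal{F}$ with the exchange relation: $\mathbf{B}'_{jk}=-\mathbf{B}_{jk}$ if $i\in\{j,k\}$ and $\mathbf{B}'_{jk}=\mathbf{B}_{jk}+\frac12(|\mathbf{B}_{ji}|\mathbf{B}_{ik}+\mathbf{B}_{ji}|\mathbf{B}_{ik}|)$ otherwise; $M'(\alpha)=M(\alpha)$ when $\alpha_i=0$; and $M'(e_i)=M(-e_i+\sum_{\mathbf{B}_{ji}>0}\mathbf{B}_{ji}e_j)+M(-e_i-\sum_{\mathbf{B}_{ji}<0}\mathbf{B}_{ji}e_j)$. Seeds are mutation equivalent if related by mutations and reordering of indices. The quantum cluster algebra $\mathcal{A}_q=\mathcal{A}_q(\mathbf{B},\Lambda,M)$ is the $\mathbb{Z}_q$-subalgebra of $\mathcal{F}$ generated by all $M'(\alpha)$ with $(\mathbf{B}',\Lambda',M')$ mutation equivalent to $(\mathbf{B},\Lambda,M)$, $\alpha_i\geq0$ for $i\in\mathbf{ex}$ and $\alpha_i\in\mathbb{Z}$ for $i\notin\mathbf{ex}$. The quantum upper cluster algebra $\mathcal{U}_q$ is the intersection in $\mathcal{F}$ of the quantum tori $\mathbb{Z}_q\cdot M'(\mathbb{Z}^N)$ over all mutation equivalent seeds. An integral skew-symmetric $n\times n$ matrix $\mathsf{A}$ is mutated at an index $i$ by the same exchange relation. An exchange type is an equivalence class of integral skew-symmetric matrices under mutation and conjugation by permutation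 matrices. The exchange type of a quantum cluster algebra is the exchange type of $\pi\mathbf{B}$ for any of its quantum seeds. An exchange type is isolated if it is that of a zero matrix. An index $i$ of $\mathsf{A}$ is a sink if $\mathsf{A}_{ji}\geq0$ for all $j$, and a source if $\mathsf{A}_{ji}\leq0$ for all $j$. The freezing $\mathsf{A}^{(i)}$ is the matrix obtained by deleting the $i$-th row and column of $\mathsf{A}$. *)

theory Defs
  imports
    "Jordan_Normal_Form.Determinant"
    "Jordan_Normal_Form.DL_Submatrix"
    "HOL-Library.Poly_Mapping"
begin

section \<open>Integral skew-symmetric matrices and exchange types\<close>

text \<open>Indices are $0, \dots, n-1$ (as for all matrices of this library) instead of $1, \dots, n$.\<close>

definition skew_symmetric :: "int mat \<Rightarrow> bool" where
  "skew_symmetric A \<longleftrightarrow> square_mat A \<and> transpose_mat A = - A"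

text \<open>The numerator below is always even, so the integer division is exact.\<close>

definition mutate_mat :: "nat \<Rightarrow> int mat \<Rightarrow> int mat" where
  "mutate_mat i A = mat (dim_row A) (dim_col A) (\<lambda>(j, k).
     if i = j \<or> i = k then - A $$ (j, k)
     else A $$ (j, k) +
       (\<bar>A $$ (j, i)\<bar> * A $$ (i, k) + A $$ (j, i) * \<bar>A $$ (i, k)\<bar>) div 2)"

text \<open>Simultaneous permutation of rows and columns, that is, conjugation by the permutation
  matrix of \<^term>\<open>p\<close>.\<close>

definition permute_mat :: "(nat \<Rightarrow> nat) \<Rightarrow> int mat \<Rightarrow> int mat" where
  "permute_mat p A = mat (dim_row A) (dim_col A) (\<lambda>(j, k). A $$ (p j, p k))"

definition exchange_step :: "int mat \<Rightarrow> int mat \<Rightarrow> bool" where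
  "exchange_step A A' \<longleftrightarrow> skew_symmetric A \<and>
     ((\<exists>i < dim_row A. A' = mutate_mat i A) \<or>
      (\<exists>p. p permutes {..<dim_row A} \<and> A' = permute_mat p A))"

definition exchange_type :: "int mat \<Rightarrow> int mat set" where
  "exchange_type A = {A'. equivclp exchange_step A A'}"

definition exchange_types :: "int mat set set" where
  "exchange_types = exchange_type ` {A. skew_symmetric A}"

definition isolated :: "int mat set \<Rightarrow> bool" where
  "isolated T \<longleftrightarrow> (\<exists>n. T = exchange_type (0\<^sub>m n n))"

definition is_sink :: "int mat \<Rightarrow> nat \<Rightarrow> bool" where
  "is_sink A i \<longleftrightarrow> (\<forall>j < dim_row A. A $$ (j, i) \<ge> 0)"

definition is_source :: "int mat \<Rightarrow> nat \<Rightarrow> bool" where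
  "is_source A i \<longleftrightarrow> (\<forall>j < dim_row A. A $$ (j, i) \<le> 0)"

definition freezing :: "int mat \<Rightarrow> nat \<Rightarrow> int mat" where
  "freezing A i = mat_delete A i i"


section \<open>Skew-fields over $\mathbb{Z}[q^{\pm 1/2}]$\<close>

text \<open>Laurent polynomials over the integers in one variable $q^{1/2}$: finitely supported functions
  from exponents to coefficients, multiplied by convolution.\<close>

type_synonym Zq = "int \<Rightarrow>\<^sub>0 int"

text \<open>A $\mathbb{Z}_q$-algebra structure on a skew-field is the choice of a nonzero central
  element \<^term>\<open>v\<close>, the image of $q^{1/2}$.\<close>

definition central_unit :: "'f::division_ring \<Rightarrow> bool" where
  "central_unit v \<longleftrightarrow> v \<noteq> 0 \<and> (\<forall>x. v * x = x * v)"

definition Zq_eval :: "'f::division_ring \<Rightarrow> Zq \<Rightarrow> 'f" where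
  "Zq_eval v c = (\<Sum>k \<in> Poly_Mapping.keys c. of_int (Poly_Mapping.lookup c k) * v powi k)"

definition Zq_scale :: "'f::division_ring \<Rightarrow> Zq \<Rightarrow> 'f \<Rightarrow> 'f" where
  "Zq_scale v c x = Zq_eval v c * x"

abbreviation Zq_span :: "'f::division_ring \<Rightarrow> 'f set \<Rightarrow> 'f set" where
  "Zq_span v \<equiv> Modules.module.span (Zq_scale v)"

definition Zq_subalgebra :: "'f::division_ring \<Rightarrow> 'f set \<Rightarrow> bool" where
  "Zq_subalgebra v R \<longleftrightarrow>
     Modules.module.subspace (Zq_scale v) R \<and> 1 \<in> R \<and> (\<forall>x \<in> R. \<forall>y \<in> R. x * y \<in> R)"


section \<open>Quantum seeds\<close>

text \<open>The $N \times \mathbf{ex}$ matrix \<open>exmat\<close> is stored as an $N \times N$ matrix whose columns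
  outside \<open>ex\<close> vanish; mutation in directions from \<open>ex\<close> preserves this. Only the values of
  \<open>tmap\<close> on \<^term>\<open>carrier_vec N\<close>, the lattice $\mathbb{Z}^N$, are relevant.\<close>

record 'f seed =
  ex :: "nat set"
  exmat :: "int mat"
  cmat :: "int mat"
  tmap :: "int vec \<Rightarrow> 'f"

definition principal_part :: "'f seed \<Rightarrow> int mat" where
  "principal_part S = submatrix (exmat S) (ex S) (ex S)"

definition quantum_torus :: "'f::division_ring \<Rightarrow> nat \<Rightarrow> 'f seed \<Rightarrow> 'f set" where
  "quantum_torus v N S = Zq_span v (tmap S ` carrier_vec N)"

definition incl_mat :: "nat \<Rightarrow> nat set \<Rightarrow> int mat" where
  "incl_mat N E = mat N N (\<lambda>(j, k). if j = k \<and> k \<in> E then 1 else 0)"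

text \<open>Since \<^term>\<open>v\<close> is $q^{1/2}$, the factor $q^{\frac12\Lambda(\alpha,\beta)}$ is the
  $\Lambda(\alpha,\beta)$-th power of \<^term>\<open>v\<close>. Quantum tori are (two-sided) Ore domains,
  so right fractions are enough to express that the skew-field of fractions is the whole type.\<close>

definition quantum_seed :: "'f::division_ring \<Rightarrow> nat \<Rightarrow> 'f seed \<Rightarrow> bool" where
  "quantum_seed v N S \<longleftrightarrow>
     ex S \<subseteq> {..<N} \<and>
     exmat S \<in> carrier_mat N N \<and>
     (\<forall>j < N. \<forall>k < N. k \<notin> ex S \<longrightarrow> exmat S $$ (j, k) = 0) \<and>
     skew_symmetric (principal_part S) \<and>
     cmat S \<in> carrier_mat N N \<and> skew_symmetric (cmat S) \<and>
     (\<exists>D \<in> carrier_mat N N. diagonal_mat D \<and> (\<forall>j < N. D $$ (j, j) > 0) \<and>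
        cmat S * exmat S = D * incl_mat N (ex S)) \<and>
     (\<forall>\<alpha> \<in> carrier_vec N. tmap S \<alpha> \<noteq> 0) \<and>
     (\<forall>\<alpha> \<in> carrier_vec N. \<forall>\<beta> \<in> carrier_vec N.
        tmap S \<alpha> * tmap S \<beta> = v powi (\<alpha> \<bullet> (cmat S *\<^sub>v \<beta>)) * tmap S (\<alpha> + \<beta>)) \<and>
     inj_on (tmap S) (carrier_vec N) \<and>
     \<not> Modules.module.dependent (Zq_scale v) (tmap S ` carrier_vec N) \<and>
     (\<forall>x. \<exists>a \<in> quantum_torus v N S. \<exists>b \<in> quantum_torus v N S. b \<noteq> 0 \<and> x = a / b)"

text \<open>The mutated seed is uniquely determined, up to irrelevant values of \<open>tmap\<close>, by the
  following relation.\<close>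

definition seed_mutation ::
    "'f::division_ring \<Rightarrow> nat \<Rightarrow> nat \<Rightarrow> 'f seed \<Rightarrow> 'f seed \<Rightarrow> bool" where
  "seed_mutation v N i S S' \<longleftrightarrow>
     quantum_seed v N S \<and> quantum_seed v N S' \<and> i \<in> ex S \<and>
     ex S' = ex S \<and>
     exmat S' = mutate_mat i (exmat S) \<and>
     (\<forall>\<alpha> \<in> carrier_vec N. \<alpha> $ i = 0 \<longrightarrow> tmap S' \<alpha> = tmap S \<alpha>) \<and>
     tmap S' (unit_vec N i) =
       tmap S (- unit_vec N i +
         vec N (\<lambda>j. if exmat S $$ (j, i) > 0 then exmat S $$ (j, i) else 0)) +
       tmap S (- unit_vec N i -
         vec N (\<lambda>j. if exmat S $$ (j, i) < 0 then exmat S $$ (j, i) else 0))"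

definition seed_reordering ::
    "'f::division_ring \<Rightarrow> nat \<Rightarrow> (nat \<Rightarrow> nat) \<Rightarrow> 'f seed \<Rightarrow> 'f seed \<Rightarrow> bool" where
  "seed_reordering v N p S S' \<longleftrightarrow>
     quantum_seed v N S \<and> quantum_seed v N S' \<and> p permutes {..<N} \<and>
     ex S = p ` ex S' \<and>
     exmat S' = permute_mat p (exmat S) \<and>
     cmat S' = permute_mat p (cmat S) \<and>
     (\<forall>\<alpha> \<in> carrier_vec N. tmap S' (vec N (\<lambda>j. \<alpha> $ p j)) = tmap S \<alpha>)"

definition mutation_equivalent ::
    "'f::division_ring \<Rightarrow> nat \<Rightarrow> 'f seed \<Rightarrow> 'f seed \<Rightarrow> bool" where
  "mutation_equivalent v N =
     equivclp (\<lambda>S S'. (\<exists>i. seed_mutation v N i S S') \<or> (\<exists>p. seed_reordering v N p S S'))"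


section \<open>Quantum cluster algebras and quantum upper cluster algebras\<close>

definition quantum_cluster_algebra :: "'f::division_ring \<Rightarrow> nat \<Rightarrow> 'f seed \<Rightarrow> 'f set" where
  "quantum_cluster_algebra v N S = Zq_subalgebra v hull
     {tmap S' \<alpha> | S' \<alpha>. mutation_equivalent v N S S' \<and> \<alpha> \<in> carrier_vec N \<and>
                       (\<forall>i \<in> ex S'. \<alpha> $ i \<ge> 0)}"

definition quantum_upper_cluster_algebra :: "'f::division_ring \<Rightarrow> nat \<Rightarrow> 'f seed \<Rightarrow> 'f set" where
  "quantum_upper_cluster_algebra v N S =
     (\<Inter>S' \<in> {S'. mutation_equivalent v N S S'}. quantum_torus v N S')"

end

theory Submission
  imports Defs
begin

text \<open>
  The inclusion of the cluster algebra in the upper cluster algebra is the quantum Laurent phenomenon: the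
  intersection of the torus of a seed with the tori of its neighbours does not change under mutation, which
  is a statement about seeds of rank two.

  The converse is an induction on the number of mutable indices. If $i$ is a source or a sink with
  $\mathsf{A}_{ij} \neq 0$, then one term of the exchange relation for $x_i$ is invertible and the other one is a multiple of
  $x_j$, so $x_i$ and $x_j$ generate the unit ideal. By induction an element $u$ of the upper cluster algebra lies in
  the cluster algebras of the freezings at $i$ and at $j$, so $x_i^m u$ and $x_j^m u$ are in the cluster algebra for large
  $m$, hence so is $u$. If the principal part vanishes, all seeds obtained by mutation induce the same grading by
  $\mathbb{Z}^{\mathbf{ex}}$, and each homogeneous component of $u$ is a combination of cluster monomials in a suitable one of them.
\<close>

section \<open>The coefficient ring\<close>

text \<open>Everything rests on reading exponents off by conjugation. The equation \<Lambda>B =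
  D\<iota> says that conjugation by M(b), with b the i-th column of B, multiplies M(\<alpha>) by
  \<open>v\<close> to the power -2 d \<alpha>_i, where d > 0 is the i-th entry of D. As b_i = 0,
  M(b) is also a monomial of the seed mutated at i, and there it reads off the exponent with the
  opposite sign. So the tori of adjacent seeds can be compared degree by degree, provided that
  \<open>v\<close> is not a root of unity, which follows from the freeness of the monomials. This
  shows that mutated monomials are again free, computes the intersection of adjacent tori and
  settles the isolated case. The obstacle is noncommutativity. Coprimality of two variables in a
  torus is replaced by an explicit division in a graded algebra, and powers of x_i are moved past a
  product only when its factors are homogeneous for conjugation by x_i. A source or sink is only
  promised for one matrix of the exchange type, so each matrix of the type has to be realized as the
  principal part of an equivalent seed.\<close>

lemma central_powi:
  assumes "central_unit (v::'f::division_ring)"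
  shows "v powi k * x = x * v powi k"
proof -
  have v: "v \<noteq> 0" "v * x = x * v" using assms by (auto simp: central_unit_def)
  have p: "v ^ n * x = x * v ^ n" for n
    by (rule power_commuting_commutes) (rule v(2))
  have i: "inverse v * x = x * inverse v"
  proof -
    have "inverse v * (v * x) * inverse v = inverse v * (x * v) * inverse v" by (simp add: v(2))
    then have "(inverse v * v) * x * inverse v = inverse v * x * (v * inverse v)" by (simp only: mult.assoc)
    with v(1) show ?thesis by simp
  qed
  have q: "inverse v ^ n * x = x * inverse v ^ n" for n
    by (rule power_commuting_commutes) (rule i)
  show ?thesis
    by (cases "k \<ge> 0") (auto simp: power_int_def p q)
qed

locale Zq_algebra =
  fixes v :: "'f::division_ring"
  assumes central: "central_unit v"
begin

definition sc :: "int \<Rightarrow> 'f \<Rightarrow> 'f" where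
  "sc k x = v powi k * x"

lemma v_nonzero: "v \<noteq> 0"
  using central by (simp add: central_unit_def)

lemma sc_0 [simp]: "sc 0 x = x"
  by (simp add: sc_def)

lemma sc_sc [simp]: "sc a (sc b x) = sc (a + b) x"
  using v_nonzero by (simp add: sc_def power_int_add mult.assoc)

lemma sc_mult_left [simp]: "sc a x * y = sc a (x * y)"
  by (simp add: sc_def mult.assoc)

lemma sc_mult_right [simp]: "x * sc a y = sc a (x * y)"
  using central_powi[OF central, of a x] by (simp add: sc_def flip: mult.assoc)

lemma sc_add: "sc a (x + y) = sc a x + sc a y"
  by (simp add: sc_def distrib_left)

lemma sc_diff: "sc a (x - y) = sc a x - sc a y"
  by (simp add: sc_def algebra_simps)

lemma sc_minus: "sc a (- x) = - sc a x"
  by (simp add: sc_def)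

lemma sc_zero [simp]: "sc a 0 = 0"
  by (simp add: sc_def)

lemma sc_eq_0_iff [simp]: "sc a x = 0 \<longleftrightarrow> x = 0"
  using v_nonzero by (simp add: sc_def)

lemma sc_sum: "sc a (sum f A) = (\<Sum>x\<in>A. sc a (f x))"
  by (simp add: sc_def sum_distrib_left)

lemma sc_cancel [simp]: "sc a x = sc a y \<longleftrightarrow> x = y"
  using v_nonzero by (simp add: sc_def)

lemma Zq_eval_superset:
  assumes "finite K" "Poly_Mapping.keys c \<subseteq> K"
  shows "Zq_eval v c = (\<Sum>k\<in>K. of_int (Poly_Mapping.lookup c k) * v powi k)"
  unfolding Zq_eval_def
  by (rule sum.mono_neutral_left) (use assms in \<open>auto simp: in_keys_iff\<close>)

lemma Zq_eval_add: "Zq_eval v (c + d) = Zq_eval v c + Zq_eval v d"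
proof -
  let ?K = "Poly_Mapping.keys c \<union> Poly_Mapping.keys d"
  have "Zq_eval v (c + d) = (\<Sum>k\<in>?K. of_int (Poly_Mapping.lookup (c + d) k) * v powi k)"
    by (rule Zq_eval_superset) (use Poly_Mapping.keys_add[of c d] in auto)
  also have "\<dots> = (\<Sum>k\<in>?K. of_int (Poly_Mapping.lookup c k) * v powi k)
      + (\<Sum>k\<in>?K. of_int (Poly_Mapping.lookup d k) * v powi k)"
    by (simp add: lookup_add distrib_right sum.distrib)
  finally show ?thesis
    by (simp add: Zq_eval_superset[of ?K])
qed

lemma Zq_eval_zero [simp]: "Zq_eval v 0 = 0"
  by (simp add: Zq_eval_def)

lemma Zq_eval_single [simp]: "Zq_eval v (Poly_Mapping.single k a) = of_int a * v powi k"
  by (cases "a = 0") (auto simp: Zq_eval_def)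

lemma Zq_eval_one [simp]: "Zq_eval v 1 = 1"
  by (simp flip: single_one)

lemma Zq_eval_sum: "Zq_eval v (sum f A) = (\<Sum>a\<in>A. Zq_eval v (f a))"
  by (induction A rule: infinite_finite_induct) (auto simp: Zq_eval_add)

lemma Zq_sum_single: "c = (\<Sum>k\<in>Poly_Mapping.keys c. Poly_Mapping.single k (Poly_Mapping.lookup c k))"
proof (rule poly_mapping_eqI)
  fix l
  have "(\<Sum>k\<in>Poly_Mapping.keys c. Poly_Mapping.lookup (Poly_Mapping.single k (Poly_Mapping.lookup c k)) l)
      = (\<Sum>k\<in>Poly_Mapping.keys c. if k = l then Poly_Mapping.lookup c k else 0)"
    by (rule sum.cong) (auto simp: lookup_single)
  then show "Poly_Mapping.lookup c l = Poly_Mapping.lookup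
      (\<Sum>k\<in>Poly_Mapping.keys c. Poly_Mapping.single k (Poly_Mapping.lookup c k)) l"
    by (simp add: lookup_sum in_keys_iff)
qed

lemma Zq_eval_mult: "Zq_eval v (c * d) = Zq_eval v c * Zq_eval v d"
proof -
  have s: "Zq_eval v (Poly_Mapping.single k a * Poly_Mapping.single l b) =
      (of_int a * v powi k) * (of_int b * v powi l)" for k l a b
  proof -
    have "(of_int a * v powi k) * (of_int b * v powi l) = (of_int a * of_int b) * (v powi k * v powi l)"
      using central_powi[OF central, of k "of_int b"] by (simp only: mult.assoc) (simp only: flip: mult.assoc)
    then show ?thesis
      using v_nonzero by (simp add: mult_single power_int_add)
  qed
  have "c * d = (\<Sum>k\<in>Poly_Mapping.keys c. \<Sum>l\<in>Poly_Mapping.keys d.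
      Poly_Mapping.single k (Poly_Mapping.lookup c k) * Poly_Mapping.single l (Poly_Mapping.lookup d l))"
    by (subst Zq_sum_single[of c], subst Zq_sum_single[of d]) (rule sum_product)
  then show ?thesis
    by (simp add: Zq_eval_sum s) (simp add: Zq_eval_def sum_product)
qed

sublocale Modules.module "Zq_scale v"
  by unfold_locales
    (auto simp: Zq_scale_def distrib_left distrib_right Zq_eval_add Zq_eval_mult mult.assoc)

section \<open>Submodules and subalgebras over Z_q\<close>

definition qclosed :: "'f set \<Rightarrow> bool" where
  "qclosed R \<longleftrightarrow> 0 \<in> R \<and> (\<forall>x\<in>R. \<forall>y\<in>R. x - y \<in> R) \<and> (\<forall>x\<in>R. \<forall>k. sc k x \<in> R)"

lemma qclosedD:
  assumes "qclosed R"
  shows "0 \<in> R" "x \<in> R \<Longrightarrow> y \<in> R \<Longrightarrow> x - y \<in> R" "x \<in> R \<Longrightarrow> sc k x \<in> R"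
    "x \<in> R \<Longrightarrow> - x \<in> R" "x \<in> R \<Longrightarrow> y \<in> R \<Longrightarrow> x + y \<in> R"
proof -
  show *: "0 \<in> R" "\<And>x y. x \<in> R \<Longrightarrow> y \<in> R \<Longrightarrow> x - y \<in> R" "x \<in> R \<Longrightarrow> sc k x \<in> R"
    using assms by (auto simp: qclosed_def)
  show m: "- x \<in> R" if "x \<in> R" for x using *(2)[OF *(1) that] by simp
  show "x \<in> R \<Longrightarrow> y \<in> R \<Longrightarrow> x + y \<in> R" using *(2)[OF _ m] by fastforce
qed

lemma qclosed_sum: "qclosed R \<Longrightarrow> (\<And>a. a \<in> A \<Longrightarrow> f a \<in> R) \<Longrightarrow> sum f A \<in> R"
  by (induction A rule: infinite_finite_induct) (auto intro: qclosedD)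

lemma qclosed_of_int:
  assumes "qclosed R" "x \<in> R" shows "of_int n * x \<in> R"
proof -
  have nat: "of_nat m * x \<in> R" for m
    by (induction m) (use assms in \<open>auto simp: distrib_right intro: qclosedD\<close>)
  show ?thesis
    by (cases n) (auto simp del: of_nat_Suc intro!: nat qclosedD(4)[OF assms(1)])
qed

lemma qclosed_Zq_scale:
  assumes "qclosed R" "x \<in> R" shows "Zq_scale v c x \<in> R"
  unfolding Zq_scale_def Zq_eval_def sum_distrib_right mult.assoc sc_def[symmetric]
  by (intro qclosed_sum qclosed_of_int qclosedD(3) assms)

text \<open>Integers act by repeated addition and powers of q^(1/2) by \<open>sc\<close>, so closure
  under differences and under powers of \<open>v\<close> is closure under all of Z_q. Membership
  proofs can thus avoid Laurent polynomial coefficients.\<close>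

lemma subspace_iff_qclosed: "subspace R \<longleftrightarrow> qclosed R"
proof
  assume R: "subspace R"
  have "sc k x = Zq_scale v (Poly_Mapping.single k 1) x" for k x
    by (simp add: sc_def Zq_scale_def)
  with R show "qclosed R"
    by (auto simp: qclosed_def subspace_0 subspace_diff subspace_scale)
next
  assume "qclosed R"
  then show "subspace R"
    by (auto simp: subspace_def intro: qclosedD qclosed_Zq_scale)
qed

lemma qclosed_span [simp, intro]: "qclosed (Zq_span v X)"
  using subspace_iff_qclosed by blast

lemmas span_qclosed = qclosedD[OF qclosed_span]

lemma span_least: "X \<subseteq> R \<Longrightarrow> qclosed R \<Longrightarrow> Zq_span v X \<subseteq> R"
  by (simp add: span_minimal subspace_iff_qclosed)

lemma span_mult:
  assumes "x \<in> Zq_span v X" "y \<in> Zq_span v Y" "qclosed Z"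
    and XY: "\<And>x y. x \<in> X \<Longrightarrow> y \<in> Y \<Longrightarrow> x * y \<in> Z"
  shows "x * y \<in> Z"
proof -
  have *: "x * y \<in> Z" if "x \<in> X" for x
  proof -
    have "Zq_span v Y \<subseteq> {y. x * y \<in> Z}"
      by (rule span_least)
         (use that XY assms(3) in \<open>auto simp: qclosed_def right_diff_distrib\<close>)
    with assms(2) show ?thesis by auto
  qed
  have "Zq_span v X \<subseteq> {x. x * y \<in> Z}"
    by (rule span_least)
       (use * assms(3) in \<open>auto simp: qclosed_def left_diff_distrib\<close>)
  with assms(1) show ?thesis by auto
qed

text \<open>Serves to clear denominators, with \<open>f m\<close> the multiplication by an m-th
  power. Demanding membership for all large m, not for one m, makes the set closed under
  differences: two thresholds have a common bound.\<close>

lemma qclosed_eventually: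
  assumes q: "qclosed T"
    and f: "\<And>m s t. f m (s - t) = f m s - f m t" "\<And>m k s. f m (sc k s) = sc k (f m s)"
  shows "qclosed {t. \<exists>n::nat. \<forall>m\<ge>n. f m t \<in> T}" (is "qclosed ?R")
proof -
  have 0: "f m 0 = 0" for m using f(1)[of m 0 0] by simp
  have "s - t \<in> ?R" if "s \<in> ?R" "t \<in> ?R" for s t
  proof -
    from that obtain n n' where "\<forall>m\<ge>n. f m s \<in> T" "\<forall>m\<ge>n'. f m t \<in> T" by blast
    then have "\<forall>m\<ge>max n n'. f m (s - t) \<in> T"
      by (auto simp: f intro!: qclosedD(2)[OF q])
    then show ?thesis by blast
  qed
  moreover have "sc k s \<in> ?R" if "s \<in> ?R" for s k
    using that qclosedD(3)[OF q] by (fastforce simp: f)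
  ultimately show ?thesis
    unfolding qclosed_def using qclosedD(1)[OF q] by (simp add: 0)
qed

definition qalg :: "'f set \<Rightarrow> bool" where
  "qalg R \<longleftrightarrow> qclosed R \<and> 1 \<in> R \<and> (\<forall>x\<in>R. \<forall>y\<in>R. x * y \<in> R)"

lemma Zq_subalgebra_iff: "Zq_subalgebra v R \<longleftrightarrow> qalg R"
  by (simp add: Zq_subalgebra_def qalg_def subspace_iff_qclosed)

lemma qalgD:
  assumes "qalg R"
  shows "qclosed R" "1 \<in> R" "x \<in> R \<Longrightarrow> y \<in> R \<Longrightarrow> x * y \<in> R"
    "x \<in> R \<Longrightarrow> x ^ n \<in> R"
proof -
  show *: "qclosed R" "1 \<in> R" "\<And>x y. x \<in> R \<Longrightarrow> y \<in> R \<Longrightarrow> x * y \<in> R"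
    using assms by (auto simp: qalg_def)
  show "x ^ n \<in> R" if "x \<in> R" for x
    by (induction n) (auto intro: * that)
qed

lemma qalg_Inter: "(\<And>R. R \<in> \<R> \<Longrightarrow> qalg R) \<Longrightarrow> qalg (\<Inter>\<R>)"
  by (auto simp: qalg_def qclosed_def)

lemma qalg_hull: "qalg (Zq_subalgebra v hull G)"
  unfolding Zq_subalgebra_iff[symmetric]
  by (rule hull_in) (metis Zq_subalgebra_iff qalg_Inter)

end

section \<open>Gradings of quantum tori\<close>

definition pos_part :: "int vec \<Rightarrow> int vec" where
  "pos_part b = vec (dim_vec b) (\<lambda>j. max (b $ j) 0)"

lemma dim_pos_part [simp]: "dim_vec (pos_part b) = dim_vec b"
  by (simp add: pos_part_def)

lemma pos_part_carrier [simp, intro]: "b \<in> carrier_vec n \<Longrightarrow> pos_part b \<in> carrier_vec n"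
  by (intro carrier_vecI) auto

lemma pos_part_index [simp]: "j < dim_vec b \<Longrightarrow> pos_part b $ j = max (b $ j) 0"
  by (simp add: pos_part_def)

lemma pos_part_diff: "pos_part b - pos_part (- b) = b"
  by (rule eq_vecI) (auto simp: max_def)

text \<open>The assumption keeps the eigenvalues of conjugation apart. Every quantum seed implies
  it, so it does not become a hypothesis of the theorem.\<close>

locale quantum_base = Zq_algebra v for v :: "'f::division_ring" +
  fixes N :: nat
  assumes not_root_of_unity: "v powi k = 1 \<Longrightarrow> k = 0"
begin

abbreviation (input) "V \<equiv> carrier_vec N :: int vec set"
abbreviation (input) "torus \<equiv> quantum_torus v N"
abbreviation (input) "cluster_alg \<equiv> quantum_cluster_algebra v N"
abbreviation (input) "upper_alg \<equiv> quantum_upper_cluster_algebra v N"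
abbreviation (input) "qseed \<equiv> quantum_seed v N"
abbreviation (input) "mut_equiv \<equiv> mutation_equivalent v N"
abbreviation (input) "pinv \<equiv> inv_into UNIV :: (nat \<Rightarrow> nat) \<Rightarrow> nat \<Rightarrow> nat"
abbreviation (input) "e \<equiv> unit_vec N :: nat \<Rightarrow> int vec"

lemma sc_eq_sc_iff: "x \<noteq> 0 \<Longrightarrow> sc a x = sc b x \<longleftrightarrow> a = b"
proof
  assume x: "x \<noteq> 0" and "sc a x = sc b x"
  then have "sc (- b) (sc a x) = sc (-b) (sc b x)" by simp
  then have "v powi (a - b) * x = 1 * x" by (simp add: sc_def[symmetric])
  with x show "a = b" using not_root_of_unity[of "a - b"] by (simp only: mult_cancel_right) simp
qed simp

text \<open>Conjugation by \<open>y\<close> acts on a quantum torus by powers of \<open>v\<close>; its eigenspaces grade the torus,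
  and the gradings of different seeds can be compared inside the skew-field.\<close>

definition hom :: "'f \<Rightarrow> int \<Rightarrow> 'f set" where
  "hom y d = {w. y * w = sc d (w * y)}"

lemma hom_zero [simp]: "0 \<in> hom y d"
  by (simp add: hom_def)

lemma hom_add: "w \<in> hom y d \<Longrightarrow> w' \<in> hom y d \<Longrightarrow> w + w' \<in> hom y d"
  by (simp add: hom_def distrib_left distrib_right sc_add)

lemma hom_minus: "w \<in> hom y d \<Longrightarrow> - w \<in> hom y d"
  by (simp add: hom_def sc_minus)

lemma hom_sc: "w \<in> hom y d \<Longrightarrow> sc k w \<in> hom y d"
  by (simp add: hom_def ac_simps)

lemma qclosed_hom: "qclosed (hom y d)"
  unfolding qclosed_def using hom_add hom_minus hom_sc
  by (auto simp: diff_conv_add_uminus simp del: add_uminus_conv_diff)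

lemma hom_mult: "w \<in> hom y d \<Longrightarrow> w' \<in> hom y d' \<Longrightarrow> w * w' \<in> hom y (d + d')"
proof -
  assume w: "w \<in> hom y d" "w' \<in> hom y d'"
  have "y * (w * w') = (y * w) * w'" by (simp add: mult.assoc)
  also have "\<dots> = sc d (w * (y * w'))" using w by (simp add: hom_def mult.assoc)
  also have "\<dots> = sc (d + d') (w * w' * y)" using w by (simp add: hom_def mult.assoc)
  finally show ?thesis by (simp add: hom_def)
qed

lemma hom_one: "1 \<in> hom y 0"
  by (simp add: hom_def)

lemma hom_power: "w \<in> hom y d \<Longrightarrow> w ^ n \<in> hom y (int n * d)"
  by (induction n) (auto simp: hom_one distrib_right dest: hom_mult)

lemma hom_inverse: 
  assumes "w \<in> hom y d" shows "inverse w \<in> hom y (- d)"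
proof (cases "w = 0")
  case False
  have "inverse w * (y * w) * inverse w = sc d (inverse w * (w * y) * inverse w)"
    using assms by (simp add: hom_def)
  then have "inverse w * y * (w * inverse w) = sc d ((inverse w * w) * y * inverse w)"
    by (simp only: mult.assoc)
  with False show ?thesis by (simp add: hom_def)
qed simp

lemma hom_powi: "w \<in> hom y d \<Longrightarrow> w powi n \<in> hom y (n * d)"
  using hom_power[of w y d "nat n"] hom_power[OF hom_inverse, of w y d "nat (- n)"]
  by (cases "n \<ge> 0") (auto simp: power_int_def)

lemma hom_unique: "w \<in> hom y d \<Longrightarrow> w \<in> hom y d' \<Longrightarrow> w \<noteq> 0 \<Longrightarrow> y \<noteq> 0 \<Longrightarrow> d = d'"
  using sc_eq_sc_iff[of "w * y" d d'] by (auto simp: hom_def)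

lemma hom_swap: "w \<in> hom y d \<Longrightarrow> y \<in> hom w (- d)"
  by (simp add: hom_def)

lemma hom_inverse_left:
  assumes "w \<in> hom y d" shows "w \<in> hom (inverse y) (- d)"
  using hom_swap[OF hom_inverse[OF hom_swap[OF assms]]] by simp

lemma hom_powi_swap: "w \<in> hom y d \<Longrightarrow> y powi n * w = sc (n * d) (w * y powi n)"
  using hom_powi[OF hom_swap, of w y d n] by (simp add: hom_def)

text \<open>Simultaneous eigenvectors with different eigenvalues are independent. To remove the term
  of c, conjugate the relation by a \<open>y j\<close> that separates b from c and subtract the
  multiple of the relation by the eigenvalue of c; the term of b is multiplied by a difference of
  two distinct powers of \<open>v\<close>, which is nonzero.\<close>

lemma hom_independent:
  fixes y :: "'j \<Rightarrow> 'f"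
  assumes "finite I" "\<And>j. j \<in> J \<Longrightarrow> y j \<noteq> 0"
    and "\<And>a j. a \<in> I \<Longrightarrow> j \<in> J \<Longrightarrow> g a \<in> hom (y j) (\<chi> j a)"
    and "\<And>a b. a \<in> I \<Longrightarrow> b \<in> I \<Longrightarrow> a \<noteq> b \<Longrightarrow> \<exists>j\<in>J. \<chi> j a \<noteq> \<chi> j b"
    and "(\<Sum>a\<in>I. g a) = 0"
    and "a \<in> I"
  shows "g a = 0"
  using assms(1,3,4,5,6)
proof (induction I arbitrary: g a rule: finite_induct)
  case (insert c I)
  have zero: "g b = 0" if b: "b \<in> I" for b
  proof -
    from b insert.hyps have "b \<noteq> c" by auto
    then obtain j where j: "j \<in> J" "\<chi> j b \<noteq> \<chi> j c"
      using insert.prems(2)[of b c] b by auto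
    define h where "h b = sc (\<chi> j b) (g b) - sc (\<chi> j c) (g b)" for b
    have "y j * (\<Sum>a\<in>insert c I. g a) = (\<Sum>a\<in>insert c I. sc (\<chi> j a) (g a) * y j)"
      unfolding sum_distrib_left
      by (rule sum.cong) (use insert.prems(1) j in \<open>auto simp: hom_def\<close>)
    then have "(\<Sum>a\<in>insert c I. sc (\<chi> j a) (g a)) * y j = 0"
      using insert.prems(3) by (simp only: sum_distrib_right mult_zero_right)
    then have 1: "(\<Sum>a\<in>insert c I. sc (\<chi> j a) (g a)) = 0"
      using assms(2)[OF j(1)] by simp
    have "(\<Sum>a\<in>insert c I. h a) = 0"
      unfolding h_def sum_subtractf 1 sc_sum[symmetric] insert.prems(3) by simp
    then have s: "(\<Sum>a\<in>I. h a) = 0"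
      using insert.hyps by (simp add: h_def)
    have "h b = 0"
    proof (rule insert.IH)
      show "h a \<in> hom (y k) (\<chi> k a)" if "a \<in> I" "k \<in> J" for a k
        unfolding h_def using insert.prems(1)[of a k] that
        by (intro qclosedD(2)[OF qclosed_hom] hom_sc) auto
    qed (use insert.prems(2) s b in auto)
    then show ?thesis
      using j sc_eq_sc_iff by (auto simp: h_def)
  qed
  with insert.prems(3) insert.hyps have "g c = 0" by simp
  with zero insert.prems(4) show ?case by auto
qed simp

lemma hom_independent_int:
  assumes "finite D" "y \<noteq> 0" "\<And>d. d \<in> D \<Longrightarrow> g d \<in> hom y (k * d)" "k \<noteq> 0"
    and "(\<Sum>d\<in>D. g d) = 0" "d \<in> D"
  shows "g d = 0"
  using hom_independent[of D "{()}" "\<lambda>_. y" g "\<lambda>_ d. k * d" d] assms by auto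

section \<open>Toric frames and spans of their monomials\<close>

definition lam :: "'f seed \<Rightarrow> int vec \<Rightarrow> int vec \<Rightarrow> int" where
  "lam S \<alpha> \<beta> = \<alpha> \<bullet> (cmat S *\<^sub>v \<beta>)"

text \<open>The part of a quantum seed that concerns only products of monomials. Mutation is first
  studied at this level, before freeness and compatibility of the mutated object are known.\<close>

definition frame :: "'f seed \<Rightarrow> bool" where
  "frame S \<longleftrightarrow> cmat S \<in> carrier_mat N N \<and> skew_symmetric (cmat S) \<and>
     (\<forall>\<alpha>\<in>V. tmap S \<alpha> \<noteq> 0) \<and>
     (\<forall>\<alpha>\<in>V. \<forall>\<beta>\<in>V. tmap S \<alpha> * tmap S \<beta> = sc (lam S \<alpha> \<beta>) (tmap S (\<alpha> + \<beta>)))"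

definition mspan :: "'f seed \<Rightarrow> (int vec \<Rightarrow> bool) \<Rightarrow> 'f set" where
  "mspan S I = Zq_span v (tmap S ` {\<alpha>\<in>V. I \<alpha>})"

lemma mspan_base: "\<alpha> \<in> V \<Longrightarrow> I \<alpha> \<Longrightarrow> tmap S \<alpha> \<in> mspan S I"
  unfolding mspan_def by (intro span_base) auto

lemma qclosed_mspan [simp, intro]: "qclosed (mspan S I)"
  by (simp add: mspan_def)

lemmas mspan_qclosed = qclosedD[OF qclosed_mspan]

lemma mspan_least: "(\<And>\<alpha>. \<alpha> \<in> V \<Longrightarrow> I \<alpha> \<Longrightarrow> tmap S \<alpha> \<in> R) \<Longrightarrow> qclosed R \<Longrightarrow> mspan S I \<subseteq> R"
  unfolding mspan_def by (intro span_least) auto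

lemma mspan_mono: "(\<And>\<alpha>. \<alpha> \<in> V \<Longrightarrow> I \<alpha> \<Longrightarrow> J \<alpha>) \<Longrightarrow> mspan S I \<subseteq> mspan S J"
  by (rule mspan_least) (auto intro: mspan_base)

lemma quantum_torus_eq: "torus S = mspan S (\<lambda>_. True)"
  by (simp add: quantum_torus_def mspan_def)

lemma frame_cmat: "frame S \<Longrightarrow> cmat S \<in> carrier_mat N N"
  by (simp add: frame_def)

lemma cmat_mult_carrier: "frame S \<Longrightarrow> \<beta> \<in> V \<Longrightarrow> cmat S *\<^sub>v \<beta> \<in> V"
  by (rule mult_mat_vec_carrier[OF frame_cmat])

context
  fixes S :: "'f seed"
  assumes S: "frame S"
begin

lemma lam_add_left: "\<alpha> \<in> V \<Longrightarrow> \<beta> \<in> V \<Longrightarrow> \<gamma> \<in> V \<Longrightarrow> lam S (\<alpha> + \<beta>) \<gamma> = lam S \<alpha> \<gamma> + lam S \<beta> \<gamma>"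
  unfolding lam_def using cmat_mult_carrier[OF S] by (simp add: add_scalar_prod_distrib)

lemma lam_smult_left: "\<alpha> \<in> V \<Longrightarrow> \<gamma> \<in> V \<Longrightarrow> lam S (k \<cdot>\<^sub>v \<alpha>) \<gamma> = k * lam S \<alpha> \<gamma>"
  unfolding lam_def using cmat_mult_carrier[OF S] by simp

lemma lam_skew: assumes "\<alpha> \<in> V" "\<beta> \<in> V" shows "lam S \<alpha> \<beta> = - lam S \<beta> \<alpha>"
proof -
  have C: "cmat S \<in> carrier_mat N N" and t: "transpose_mat (cmat S) = - cmat S"
    using S by (auto simp: frame_def skew_symmetric_def)
  have "lam S \<alpha> \<beta> = (transpose_mat (cmat S) *\<^sub>v \<alpha>) \<bullet> \<beta>"
    unfolding lam_def using transpose_vec_mult_scalar[OF C assms(2,1)] by simp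
  also have "transpose_mat (cmat S) *\<^sub>v \<alpha> = - (cmat S *\<^sub>v \<alpha>)"
    unfolding t using C assms by (intro eq_vecI) (auto simp: uminus_scalar_prod)
  also have "\<dots> \<bullet> \<beta> = - lam S \<beta> \<alpha>"
    using C assms cmat_mult_carrier[OF S] comm_scalar_prod[of \<beta> N "cmat S *\<^sub>v \<alpha>"]
    by (auto simp: lam_def)
  finally show ?thesis .
qed

lemma lam_add_right: "\<alpha> \<in> V \<Longrightarrow> \<beta> \<in> V \<Longrightarrow> \<gamma> \<in> V \<Longrightarrow> lam S \<gamma> (\<alpha> + \<beta>) = lam S \<gamma> \<alpha> + lam S \<gamma> \<beta>"
  using lam_add_left[of \<alpha> \<beta> \<gamma>] lam_skew[of \<gamma> "\<alpha> + \<beta>"] lam_skew[of \<gamma> \<alpha>] lam_skew[of \<gamma> \<beta>] by simp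

lemma lam_smult_right: "\<alpha> \<in> V \<Longrightarrow> \<gamma> \<in> V \<Longrightarrow> lam S \<gamma> (k \<cdot>\<^sub>v \<alpha>) = k * lam S \<gamma> \<alpha>"
  using lam_smult_left[of \<alpha> \<gamma> k] lam_skew[of \<gamma> \<alpha>] lam_skew[of \<gamma> "k \<cdot>\<^sub>v \<alpha>"] by simp

lemma lam_minus_left: "\<alpha> \<in> V \<Longrightarrow> \<gamma> \<in> V \<Longrightarrow> lam S (- \<alpha>) \<gamma> = - lam S \<alpha> \<gamma>"
proof -
  assume *: "\<alpha> \<in> V" "\<gamma> \<in> V"
  then have "- \<alpha> = (-1) \<cdot>\<^sub>v \<alpha>" by auto
  with lam_smult_left[OF *, of "-1"] show ?thesis by simp
qed

lemma lam_minus_right: "\<alpha> \<in> V \<Longrightarrow> \<gamma> \<in> V \<Longrightarrow> lam S \<gamma> (- \<alpha>) = - lam S \<gamma> \<alpha>"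
  using lam_minus_left[of \<alpha> \<gamma>] lam_skew[of \<gamma> "- \<alpha>"] lam_skew[of \<gamma> \<alpha>] by simp

lemma lam_diff_left: "\<alpha> \<in> V \<Longrightarrow> \<beta> \<in> V \<Longrightarrow> \<gamma> \<in> V \<Longrightarrow> lam S (\<alpha> - \<beta>) \<gamma> = lam S \<alpha> \<gamma> - lam S \<beta> \<gamma>"
  by (simp add: minus_add_uminus_vec[of _ N] lam_add_left lam_minus_left)

lemma lam_diff_right: "\<alpha> \<in> V \<Longrightarrow> \<beta> \<in> V \<Longrightarrow> \<gamma> \<in> V \<Longrightarrow> lam S \<gamma> (\<alpha> - \<beta>) = lam S \<gamma> \<alpha> - lam S \<gamma> \<beta>"
  by (simp add: minus_add_uminus_vec[of _ N] lam_add_right lam_minus_right)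

lemma lam_self: "\<alpha> \<in> V \<Longrightarrow> lam S \<alpha> \<alpha> = 0"
  using lam_skew[of \<alpha> \<alpha>] by simp

lemma lam_zero: assumes "\<alpha> \<in> V" shows "lam S \<alpha> (0\<^sub>v N) = 0" "lam S (0\<^sub>v N) \<alpha> = 0"
proof -
  have "0 \<cdot>\<^sub>v \<alpha> = 0\<^sub>v N" using assms by (intro eq_vecI) auto
  then show "lam S \<alpha> (0\<^sub>v N) = 0" "lam S (0\<^sub>v N) \<alpha> = 0"
    using lam_smult_right[of \<alpha> \<alpha> 0] lam_smult_left[of \<alpha> \<alpha> 0] assms by auto
qed

lemmas lam_simps = lam_add_left lam_add_right lam_smult_left lam_smult_right lam_minus_left
  lam_minus_right lam_diff_left lam_diff_right lam_self lam_zero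

lemma tmap_nonzero: "\<alpha> \<in> V \<Longrightarrow> tmap S \<alpha> \<noteq> 0"
  using S by (simp add: frame_def)

lemma tmap_mult: "\<alpha> \<in> V \<Longrightarrow> \<beta> \<in> V \<Longrightarrow> tmap S \<alpha> * tmap S \<beta> = sc (lam S \<alpha> \<beta>) (tmap S (\<alpha> + \<beta>))"
  using S by (simp add: frame_def)

lemma tmap_add: "\<alpha> \<in> V \<Longrightarrow> \<beta> \<in> V \<Longrightarrow> tmap S (\<alpha> + \<beta>) = sc (- lam S \<alpha> \<beta>) (tmap S \<alpha> * tmap S \<beta>)"
  by (simp add: tmap_mult)

lemma tmap_zero [simp]: "tmap S (0\<^sub>v N) = 1"
proof -
  have "tmap S (0\<^sub>v N) * tmap S (0\<^sub>v N) = tmap S (0\<^sub>v N)"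
    by (simp add: tmap_mult lam_zero)
  then show ?thesis using tmap_nonzero[of "0\<^sub>v N"] by simp
qed

lemma tmap_inverse: assumes "\<alpha> \<in> V" shows "inverse (tmap S \<alpha>) = tmap S (- \<alpha>)"
proof (rule inverse_unique)
  have "\<alpha> + - \<alpha> = 0\<^sub>v N" using assms by auto
  then show "tmap S \<alpha> * tmap S (- \<alpha>) = 1"
    using assms by (simp add: tmap_mult lam_simps)
qed

lemma tmap_power: assumes "\<alpha> \<in> V" shows "tmap S \<alpha> ^ n = tmap S (int n \<cdot>\<^sub>v \<alpha>)"
proof (induction n)
  case 0
  have "0 \<cdot>\<^sub>v \<alpha> = 0\<^sub>v N" using assms by auto
  then show ?case by simp
next
  case (Suc n)
  have "\<alpha> + int n \<cdot>\<^sub>v \<alpha> = int (Suc n) \<cdot>\<^sub>v \<alpha>"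
    using assms by (intro eq_vecI) (auto simp: algebra_simps)
  with Suc assms show ?case by (simp add: tmap_mult lam_simps)
qed

lemma tmap_powi: assumes "\<alpha> \<in> V" shows "tmap S \<alpha> powi n = tmap S (n \<cdot>\<^sub>v \<alpha>)"
proof (cases "n \<ge> 0")
  case True then show ?thesis using tmap_power[OF assms, of "nat n"] by (simp add: power_int_def)
next
  case False
  then have "tmap S \<alpha> powi n = tmap S (- \<alpha>) ^ nat (- n)"
    using assms by (simp add: power_int_def tmap_inverse)
  also have "\<dots> = tmap S (n \<cdot>\<^sub>v \<alpha>)"
  proof -
    have "int (nat (- n)) \<cdot>\<^sub>v (- \<alpha>) = n \<cdot>\<^sub>v \<alpha>" using False assms by (intro eq_vecI) auto
    then show ?thesis using tmap_power[of "- \<alpha>" "nat (- n)"] assms by simp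
  qed
  finally show ?thesis .
qed

text \<open>The factor 2 arises because \<open>v\<close> is q^(1/2) and exchanging two monomials
  changes the sign of \<Lambda>.\<close>

lemma tmap_hom: "\<alpha> \<in> V \<Longrightarrow> \<eta> \<in> V \<Longrightarrow> tmap S \<alpha> \<in> hom (tmap S \<eta>) (2 * lam S \<eta> \<alpha>)"
  using lam_skew[of \<alpha> \<eta>] by (simp add: hom_def tmap_mult comm_add_vec[of \<eta> N \<alpha>])

lemma mspan_mult:
  assumes "x \<in> mspan S I" "y \<in> mspan S J"
    and "\<And>\<alpha> \<beta>. \<alpha> \<in> V \<Longrightarrow> \<beta> \<in> V \<Longrightarrow> I \<alpha> \<Longrightarrow> J \<beta> \<Longrightarrow> K (\<alpha> + \<beta>)"
  shows "x * y \<in> mspan S K"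
  using assms(1,2) unfolding mspan_def[of _ I] mspan_def[of _ J]
  by (rule span_mult) (auto simp: tmap_mult intro!: mspan_qclosed mspan_base assms(3))

lemma qalg_torus: "qalg (torus S)"
  unfolding qalg_def quantum_torus_eq
  using mspan_base[of "0\<^sub>v N" "\<lambda>_. True" S] by (auto intro: mspan_mult)

lemma mspan_hom:
  assumes "\<eta> \<in> V" "\<And>\<alpha>. \<alpha> \<in> V \<Longrightarrow> I \<alpha> \<Longrightarrow> 2 * lam S \<eta> \<alpha> = d"
  shows "mspan S I \<subseteq> hom (tmap S \<eta>) d"
  using tmap_hom[OF _ assms(1)] assms(2) by (intro mspan_least qclosed_hom) auto

end

lemma tmap_in_torus: "\<alpha> \<in> V \<Longrightarrow> tmap S \<alpha> \<in> torus S"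
  by (simp add: quantum_torus_eq mspan_base)

text \<open>The labelling \<open>f\<close> is arbitrary and uniqueness is not claimed; where it is
  needed it comes from \<open>hom_independent\<close>. Components are defined for all labels, with
  value 0 outside \<open>D\<close>, so that two decompositions can be summed over a common index
  set.\<close>

lemma torus_decomp:
  fixes f :: "int vec \<Rightarrow> 'c"
  assumes "t \<in> torus S"
  shows "\<exists>D g. finite D \<and> (\<forall>d. g d \<in> mspan S (\<lambda>\<alpha>. f \<alpha> = d)) \<and> (\<forall>d. d \<notin> D \<longrightarrow> g d = 0) \<and> t = sum g D"
proof -
  define P where "P t D g \<longleftrightarrow> finite D \<and> (\<forall>d. g d \<in> mspan S (\<lambda>\<alpha>. f \<alpha> = d)) \<and> (\<forall>d. d \<notin> D \<longrightarrow> g d = 0) \<and> t = sum g D"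
    for t and D :: "'c set" and g
  have "torus S \<subseteq> {t. \<exists>D g. P t D g}"
    unfolding quantum_torus_eq
  proof (rule mspan_least)
    fix \<alpha> assume "\<alpha> \<in> V"
    then have "P (tmap S \<alpha>) {f \<alpha>} (\<lambda>d. if d = f \<alpha> then tmap S \<alpha> else 0)"
      by (auto simp: P_def intro: mspan_base mspan_qclosed)
    then show "tmap S \<alpha> \<in> {t. \<exists>D g. P t D g}" by blast
  next
    have "P 0 {} (\<lambda>_. 0)" by (auto simp: P_def intro: mspan_qclosed)
    moreover have "P (x - y) (D \<union> D') (\<lambda>d. g d - g' d)" if "P x D g" "P y D' g'" for x y D D' g g'
    proof -
      have "sum g D = sum g (D \<union> D')" "sum g' D' = sum g' (D \<union> D')"
        using that by (auto simp: P_def intro!: sum.mono_neutral_left)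
      with that show ?thesis by (auto simp: P_def sum_subtractf intro: mspan_qclosed)
    qed
    moreover have "P (sc k x) D (\<lambda>d. sc k (g d))" if "P x D g" for x k D g
      using that by (auto simp: P_def sc_sum intro: mspan_qclosed)
    ultimately show "qclosed {t. \<exists>D g. P t D g}"
      unfolding qclosed_def by blast
  qed
  with assms show ?thesis by (auto simp: P_def)
qed

end

section \<open>Mutation of toric frames\<close>

context quantum_base
begin

definition drop_at :: "nat \<Rightarrow> int vec \<Rightarrow> int vec" where
  "drop_at i \<alpha> = \<alpha> - (\<alpha> $ i) \<cdot>\<^sub>v e i"

lemma drop_at_carrier [simp, intro]: "\<alpha> \<in> V \<Longrightarrow> drop_at i \<alpha> \<in> V"
  by (simp add: drop_at_def)

lemma drop_at_index [simp]: "\<alpha> \<in> V \<Longrightarrow> i < N \<Longrightarrow> j < N \<Longrightarrow> drop_at i \<alpha> $ j = (if j = i then 0 else \<alpha> $ j)"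
  by (auto simp: drop_at_def)

lemma drop_at_split: "\<alpha> \<in> V \<Longrightarrow> i < N \<Longrightarrow> drop_at i \<alpha> + (\<alpha> $ i) \<cdot>\<^sub>v e i = \<alpha>"
  by (intro eq_vecI) (auto simp: drop_at_def)

lemma drop_at_add: "\<alpha> \<in> V \<Longrightarrow> \<beta> \<in> V \<Longrightarrow> i < N \<Longrightarrow> drop_at i (\<alpha> + \<beta>) = drop_at i \<alpha> + drop_at i \<beta>"
  by (intro eq_vecI) (auto simp: drop_at_def algebra_simps)

lemma drop_at_same: "\<alpha> \<in> V \<Longrightarrow> i < N \<Longrightarrow> \<alpha> $ i = 0 \<Longrightarrow> drop_at i \<alpha> = \<alpha>"
  by (intro eq_vecI) (auto simp: drop_at_def)

lemma drop_at_unit: "i < N \<Longrightarrow> drop_at i (e i) = 0\<^sub>v N"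
  by (intro eq_vecI) (auto simp: drop_at_def)

lemma tmap_split:
  assumes "frame S" "\<alpha> \<in> V" "i < N"
  shows "tmap S \<alpha> = sc (- (\<alpha> $ i) * lam S (drop_at i \<alpha>) (e i)) (tmap S (drop_at i \<alpha>) * tmap S (e i) powi (\<alpha> $ i))"
  using assms by (simp add: tmap_powi tmap_mult drop_at_split lam_simps[of S])

definition mvar :: "nat \<Rightarrow> int vec \<Rightarrow> 'f seed \<Rightarrow> 'f" where
  "mvar i b S = tmap S (- e i + pos_part b) + tmap S (- e i + pos_part (- b))"

text \<open>Here \<open>b\<close> is a column of the exchange matrix or its negative, so \<open>d\<close> may have either sign.\<close>

definition mdata :: "nat \<Rightarrow> int vec \<Rightarrow> int \<Rightarrow> 'f seed \<Rightarrow> bool" where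
  "mdata i b d S \<longleftrightarrow> frame S \<and> i < N \<and> b \<in> V \<and> b $ i = 0 \<and> d \<noteq> 0 \<and> (\<forall>\<alpha>\<in>V. lam S \<alpha> b = \<alpha> $ i * d)"

definition mrel :: "nat \<Rightarrow> int vec \<Rightarrow> int \<Rightarrow> 'f seed \<Rightarrow> 'f seed \<Rightarrow> bool" where
  "mrel i b d S S' \<longleftrightarrow> mdata i b d S \<and> frame S' \<and>
     (\<forall>\<alpha>\<in>V. \<alpha> $ i = 0 \<longrightarrow> tmap S' \<alpha> = tmap S \<alpha>) \<and> tmap S' (e i) = mvar i b S"

lemma mvar_minus: "mvar i (- b) S = mvar i b S"
  by (simp add: mvar_def add.commute)

lemma mdata_flip: "mdata i b d S \<Longrightarrow> mdata i (- b) (- d) S"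
  by (auto simp: mdata_def lam_simps)

lemma mrel_flip: "mrel i b d S S' \<Longrightarrow> mrel i (- b) (- d) S S'"
  by (simp add: mrel_def mvar_minus mdata_flip)

context
  fixes i b d S
  assumes md: "mdata i b d S"
begin

lemma mdataD:
  shows "frame S" "i < N" "b \<in> V" "b $ i = 0" "d \<noteq> 0" "\<alpha> \<in> V \<Longrightarrow> lam S \<alpha> b = \<alpha> $ i * d"
    "dim_vec b = N"
  using md by (auto simp: mdata_def)

lemma pos_part_index_i: "pos_part b $ i = 0" "pos_part (- b) $ i = 0"
  using mdataD by auto

lemma lam_pos_part:
  assumes "\<alpha> \<in> V"
  shows "lam S \<alpha> (pos_part b) = \<alpha> $ i * d + lam S \<alpha> (pos_part (- b))"
proof -
  have "lam S \<alpha> (pos_part b - pos_part (- b)) = \<alpha> $ i * d"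
    using mdataD assms by (simp add: pos_part_diff)
  then show ?thesis using mdataD assms by (simp add: lam_simps)
qed

lemma mvar_terms_hom:
  assumes "\<gamma> \<in> V"
  shows "tmap S (- e i + pos_part b) \<in> hom (tmap S \<gamma>) (2 * (- lam S \<gamma> (e i) + lam S \<gamma> (pos_part b)))"
    "tmap S (- e i + pos_part (- b)) \<in> hom (tmap S \<gamma>) (2 * (- lam S \<gamma> (e i) + lam S \<gamma> (pos_part b) - \<gamma> $ i * d))"
  using tmap_hom[of S "- e i + pos_part b" \<gamma>] tmap_hom[of S "- e i + pos_part (- b)" \<gamma>]
    mdataD assms lam_pos_part[OF assms]
  by (auto simp: lam_simps)

text \<open>Under conjugation by x_i the degrees of the two exchange terms differ by 2d, so they
  cannot cancel.\<close>

lemma mvar_nonzero: "mvar i b S \<noteq> 0"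
proof
  assume "mvar i b S = 0"
  then have eq: "tmap S (- e i + pos_part b) = - tmap S (- e i + pos_part (- b))"
    by (simp add: mvar_def add_eq_0_iff2)
  note h = mvar_terms_hom[of "e i"]
  have "tmap S (- e i + pos_part b) \<in> hom (tmap S (e i))
      (2 * (- lam S (e i) (e i) + lam S (e i) (pos_part b) - e i $ i * d))"
    unfolding eq by (intro hom_minus h) auto
  from hom_unique[OF this h(1)] mdataD show False
    using tmap_nonzero[OF mdataD(1), of "- e i + pos_part b"] tmap_nonzero[OF mdataD(1), of "e i"]
    by (auto simp: lam_simps)
qed

text \<open>If \<gamma>_i = 0, conjugation by M(\<gamma>) does not distinguish the two exchange
  terms, so their sum is still homogeneous.\<close>

lemma mvar_hom:
  assumes "\<gamma> \<in> V" "\<gamma> $ i = 0"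
  shows "mvar i b S \<in> hom (tmap S \<gamma>) (2 * lam S \<gamma> (- e i + pos_part b))"
  unfolding mvar_def using mvar_terms_hom[OF assms(1)] assms mdataD
  by (intro hom_add) (auto simp: lam_simps)

lemma mvar_mult_unit:
  "mvar i b S * tmap S (e i) =
     sc (lam S (pos_part b) (e i)) (tmap S (pos_part b)) +
     sc (lam S (pos_part (- b)) (e i)) (tmap S (pos_part (- b)))"
proof -
  have "- e i + p + e i = p" if "p \<in> V" for p
    using that by (intro eq_vecI) auto
  then show ?thesis
    using mdataD by (simp add: mvar_def distrib_right tmap_mult lam_simps)
qed

lemma unit_mult_mvar:
  "tmap S (e i) * mvar i b S =
     sc (lam S (e i) (pos_part b)) (tmap S (pos_part b)) +
     sc (lam S (e i) (pos_part (- b))) (tmap S (pos_part (- b)))"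
proof -
  have "e i + (- e i + p) = p" if "p \<in> V" for p
    using that by (intro eq_vecI) auto
  then show ?thesis
    using mdataD by (simp add: mvar_def distrib_left tmap_mult lam_simps)
qed

text \<open>Column i is the exponent of the first exchange term. Since the new variable commutes
  with the M(\<gamma>), \<gamma>_i = 0, exactly as this single term does, the new form \<Lambda>'
  has to be the pullback of \<Lambda> along this matrix.\<close>

definition mut_lattice :: "int mat" where
  "mut_lattice = mat N N (\<lambda>(j, k). if k = i then (- e i + pos_part b) $ j else if j = k then 1 else 0)"

lemma mut_lattice_carrier [simp]: "mut_lattice \<in> carrier_mat N N"
  by (simp add: mut_lattice_def)

lemma mut_lattice_mult:
  assumes "\<alpha> \<in> V"
  shows "mut_lattice *\<^sub>v \<alpha> = drop_at i \<alpha> + (\<alpha> $ i) \<cdot>\<^sub>v (- e i + pos_part b)"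
proof (rule eq_vecI)
  fix j assume "j < dim_vec (drop_at i \<alpha> + (\<alpha> $ i) \<cdot>\<^sub>v (- e i + pos_part b))"
  then have j: "j < N" using mdataD by auto
  have "(mut_lattice *\<^sub>v \<alpha>) $ j = (\<Sum>k<N. mut_lattice $$ (j, k) * \<alpha> $ k)"
    using j assms by (simp add: mut_lattice_def scalar_prod_def lessThan_atLeast0)
  also have "\<dots> = mut_lattice $$ (j, i) * \<alpha> $ i + (\<Sum>k\<in>{..<N} - {i}. mut_lattice $$ (j, k) * \<alpha> $ k)"
    using mdataD by (intro sum.remove) auto
  also have "(\<Sum>k\<in>{..<N} - {i}. mut_lattice $$ (j, k) * \<alpha> $ k) =
      (\<Sum>k\<in>{..<N} - {i}. if k = j then \<alpha> $ j else 0)"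
    using j by (intro sum.cong) (auto simp: mut_lattice_def)
  also have "\<dots> = drop_at i \<alpha> $ j"
    using j assms mdataD by simp
  finally show "(mut_lattice *\<^sub>v \<alpha>) $ j = (drop_at i \<alpha> + (\<alpha> $ i) \<cdot>\<^sub>v (- e i + pos_part b)) $ j"
    using j assms mdataD by (simp add: mut_lattice_def)
qed (use mdataD in \<open>auto simp: mut_lattice_def\<close>)

text \<open>The power of \<open>v\<close> is the one that \<open>tmap_split\<close> forces on any
  frame with this \<Lambda>'. Negative powers of the new variable are taken in the
  skew-field.\<close>

definition mut_frame :: "'f seed" where
  "mut_frame = S\<lparr>
     exmat := mutate_mat i (exmat S),
     cmat := transpose_mat mut_lattice * (cmat S * mut_lattice),
     tmap := (\<lambda>\<alpha>. sc (- (\<alpha> $ i) * lam S (drop_at i \<alpha>) (- e i + pos_part b))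
        (tmap S (drop_at i \<alpha>) * mvar i b S powi (\<alpha> $ i)))\<rparr>"

lemma lam_mut_frame:
  assumes "\<alpha> \<in> V" "\<beta> \<in> V"
  shows "lam mut_frame \<alpha> \<beta> = lam S (mut_lattice *\<^sub>v \<alpha>) (mut_lattice *\<^sub>v \<beta>)"
proof -
  have C: "cmat S \<in> carrier_mat N N" using mdataD(1) frame_cmat by auto
  let ?E = mut_lattice
  have m: "?E *\<^sub>v \<gamma> \<in> V" if "\<gamma> \<in> V" for \<gamma>
    by (rule mult_mat_vec_carrier[OF mut_lattice_carrier that])
  have C2: "cmat S * ?E \<in> carrier_mat N N"
    by (rule mult_carrier_mat[OF C mut_lattice_carrier])
  define w where "w = cmat S *\<^sub>v (?E *\<^sub>v \<beta>)"
  have w: "w \<in> V" unfolding w_def by (rule mult_mat_vec_carrier[OF C m[OF assms(2)]])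
  have Et: "transpose_mat ?E \<in> carrier_mat N N" by simp
  have "cmat mut_frame *\<^sub>v \<beta> = transpose_mat ?E *\<^sub>v w"
    unfolding w_def mut_frame_def
    by (simp add: assoc_mult_mat_vec[OF Et C2 assms(2)] assoc_mult_mat_vec[OF C mut_lattice_carrier assms(2)])
  then have "lam mut_frame \<alpha> \<beta> = \<alpha> \<bullet> (transpose_mat ?E *\<^sub>v w)"
    by (simp add: lam_def)
  also have "\<dots> = (transpose_mat ?E *\<^sub>v w) \<bullet> \<alpha>"
    by (rule comm_scalar_prod[OF assms(1) mult_mat_vec_carrier[OF Et w]])
  also have "\<dots> = w \<bullet> (?E *\<^sub>v \<alpha>)"
    by (rule transpose_vec_mult_scalar[OF mut_lattice_carrier assms(1) w])
  also have "\<dots> = lam S (?E *\<^sub>v \<alpha>) (?E *\<^sub>v \<beta>)"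
    unfolding lam_def w_def[symmetric] by (rule comm_scalar_prod[OF w m[OF assms(1)]])
  finally show ?thesis .
qed

lemma skew_mut_frame: "skew_symmetric (cmat mut_frame)" "cmat mut_frame \<in> carrier_mat N N"
proof -
  have C: "cmat S \<in> carrier_mat N N" and s: "transpose_mat (cmat S) = - cmat S"
    using mdataD(1) by (auto simp: frame_def skew_symmetric_def)
  let ?E = mut_lattice
  have E: "?E \<in> carrier_mat N N" and Et: "transpose_mat ?E \<in> carrier_mat N N" by simp_all
  note CE = mult_carrier_mat[OF C E]
  show c: "cmat mut_frame \<in> carrier_mat N N"
    using mult_carrier_mat[OF Et CE] by (simp add: mut_frame_def)
  have "transpose_mat (transpose_mat ?E * (cmat S * ?E)) = transpose_mat (cmat S * ?E) * ?E"
    using transpose_mult[OF Et CE] by simp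
  also have "transpose_mat (cmat S * ?E) = transpose_mat ?E * (- cmat S)"
    using transpose_mult[OF C E] s by simp
  also have "\<dots> = - (transpose_mat ?E * cmat S)"
    by (rule uminus_mult_right_mat) (use carrier_matD[OF C] carrier_matD[OF Et] in simp)
  also have "\<dots> * ?E = - (transpose_mat ?E * cmat S * ?E)"
    by (rule uminus_mult_left_mat) (use carrier_matD[OF C] carrier_matD[OF E] in simp)
  also have "transpose_mat ?E * cmat S * ?E = transpose_mat ?E * (cmat S * ?E)"
    by (rule assoc_mult_mat[OF Et C E])
  finally show "skew_symmetric (cmat mut_frame)"
    using c by (auto simp: skew_symmetric_def mut_frame_def)
qed

lemma lam_mut_frame':
  assumes "\<alpha> \<in> V" "\<beta> \<in> V"
  shows "lam mut_frame \<alpha> \<beta> = lam S (drop_at i \<alpha>) (drop_at i \<beta>)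
     + \<beta> $ i * lam S (drop_at i \<alpha>) (- e i + pos_part b)
     - \<alpha> $ i * lam S (drop_at i \<beta>) (- e i + pos_part b)"
proof -
  note F = mdataD(1)
  define w where "w = - e i + pos_part b"
  have w: "w \<in> V" using mdataD by (auto simp: w_def)
  have "lam S w (drop_at i \<beta>) = - lam S (drop_at i \<beta>) w"
    using w assms by (intro lam_skew[OF F]) auto
  then show ?thesis
    using assms w unfolding w_def[symmetric]
    by (simp add: lam_mut_frame mut_lattice_mult w_def[symmetric] lam_simps[OF F] algebra_simps)
qed

lemma frame_mut_frame: "frame mut_frame"
  unfolding frame_def
proof (intro conjI ballI skew_mut_frame)
  note F = mdataD(1) and [simp] = mdataD(2)
  let ?X = "mvar i b S"
  fix \<alpha> \<beta> :: "int vec" assume a: "\<alpha> \<in> V" "\<beta> \<in> V"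
  define w where "w = - e i + pos_part b"
  have w: "w \<in> V" using mdataD by (auto simp: w_def)
  have sw: "?X powi n * tmap S (drop_at i \<beta>) =
      sc (- 2 * n * lam S (drop_at i \<beta>) w) (tmap S (drop_at i \<beta>) * ?X powi n)" for n
    using hom_powi_swap[OF hom_swap[OF mvar_hom], of "drop_at i \<beta>" n] a by (simp add: w_def algebra_simps)
  have "tmap mut_frame \<alpha> * tmap mut_frame \<beta> =
      sc (- (\<alpha> $ i) * lam S (drop_at i \<alpha>) w - \<beta> $ i * lam S (drop_at i \<beta>) w)
       (tmap S (drop_at i \<alpha>) * (?X powi (\<alpha> $ i) * tmap S (drop_at i \<beta>)) * ?X powi (\<beta> $ i))"
    by (simp add: mut_frame_def w_def[symmetric] mult.assoc algebra_simps)
  also have "\<dots> = sc (- (\<alpha> $ i) * lam S (drop_at i \<alpha>) w - \<beta> $ i * lam S (drop_at i \<beta>) w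
        - 2 * (\<alpha> $ i) * lam S (drop_at i \<beta>) w)
       ((tmap S (drop_at i \<alpha>) * tmap S (drop_at i \<beta>)) * (?X powi (\<alpha> $ i) * ?X powi (\<beta> $ i)))"
    by (simp add: sw mult.assoc algebra_simps)
  also have "\<dots> = sc (lam mut_frame \<alpha> \<beta>) (tmap mut_frame (\<alpha> + \<beta>))"
  proof -
    have li: "lam S (drop_at i \<alpha> + drop_at i \<beta>) w = lam S (drop_at i \<alpha>) w + lam S (drop_at i \<beta>) w"
      using a w by (simp add: drop_at_add lam_simps[OF F])
    have "(\<alpha> + \<beta>) $ i = \<alpha> $ i + \<beta> $ i" using a by simp
    then have "tmap mut_frame (\<alpha> + \<beta>) = sc (- (\<alpha> $ i + \<beta> $ i) * (lam S (drop_at i \<alpha>) w + lam S (drop_at i \<beta>) w))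
        (tmap S (drop_at i \<alpha> + drop_at i \<beta>) * (?X powi (\<alpha> $ i) * ?X powi (\<beta> $ i)))"
      using a mvar_nonzero by (simp add: mut_frame_def w_def[symmetric] drop_at_add li power_int_add algebra_simps)
    then show ?thesis
      using a by (simp add: lam_mut_frame' tmap_mult[OF F] w_def[symmetric] algebra_simps)
  qed
  finally show "tmap mut_frame \<alpha> * tmap mut_frame \<beta> = sc (lam mut_frame \<alpha> \<beta>) (tmap mut_frame (\<alpha> + \<beta>))" .
next
  fix \<alpha> :: "int vec" assume "\<alpha> \<in> V"
  then show "tmap mut_frame \<alpha> \<noteq> 0"
    using mvar_nonzero tmap_nonzero[OF mdataD(1), of "drop_at i \<alpha>"] by (auto simp: mut_frame_def)
qed

lemma mrel_mut_frame: "mrel i b d S mut_frame"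
  using md frame_mut_frame mdataD
  by (auto simp: mrel_def mut_frame_def drop_at_same drop_at_unit lam_simps)

end

section \<open>Comparison of a frame with its mutation\<close>

context
  fixes i b d S S'
  assumes mr: "mrel i b d S S'"
begin

lemma mrelD:
  shows "mdata i b d S" "frame S'" "\<alpha> \<in> V \<Longrightarrow> \<alpha> $ i = 0 \<Longrightarrow> tmap S' \<alpha> = tmap S \<alpha>" "tmap S' (e i) = mvar i b S"
  using mr by (auto simp: mrel_def)

lemmas mrel_mdataD = mdataD[OF mrelD(1)]

text \<open>The mutation relation prescribes only monomials, not the matrix \<Lambda>'. Its values
  are recovered here and below by comparing products of nonzero elements, using that
  \<open>v\<close> is not a root of unity.\<close>

lemma mrel_lam_drop:
  assumes "\<alpha> \<in> V" "\<beta> \<in> V" "\<alpha> $ i = 0" "\<beta> $ i = 0"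
  shows "lam S' \<alpha> \<beta> = lam S \<alpha> \<beta>"
proof -
  note [simp] = mrel_mdataD(2)
  have "sc (lam S' \<alpha> \<beta>) (tmap S (\<alpha> + \<beta>)) = sc (lam S \<alpha> \<beta>) (tmap S (\<alpha> + \<beta>))"
    using tmap_mult[OF mrelD(2) assms(1,2)] tmap_mult[OF mrel_mdataD(1) assms(1,2)] assms
    by (simp add: mrelD(3))
  then show ?thesis using tmap_nonzero[OF mrel_mdataD(1), of "\<alpha> + \<beta>"] assms by (simp add: sc_eq_sc_iff)
qed

lemma mrel_lam_unit:
  assumes "\<gamma> \<in> V" "\<gamma> $ i = 0"
  shows "lam S' \<gamma> (e i) = lam S \<gamma> (- e i + pos_part b)"
  using hom_unique[OF mvar_hom[OF mrelD(1) assms], of "2 * lam S' \<gamma> (e i)"] mvar_nonzero[OF mrelD(1)]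
    tmap_hom[OF mrelD(2), of "e i" \<gamma>] assms tmap_nonzero[OF mrel_mdataD(1), of \<gamma>]
  by (auto simp: mrelD(3,4))

lemma mrel_lam:
  assumes "\<alpha> \<in> V" "\<beta> \<in> V"
  shows "lam S' \<alpha> \<beta> = lam S (drop_at i \<alpha>) (drop_at i \<beta>)
     + \<beta> $ i * lam S (drop_at i \<alpha>) (- e i + pos_part b)
     - \<alpha> $ i * lam S (drop_at i \<beta>) (- e i + pos_part b)"
proof -
  note F = mrelD(2) and [simp] = mrel_mdataD(2)
  have "lam S' \<alpha> \<beta> = lam S' (drop_at i \<alpha> + (\<alpha> $ i) \<cdot>\<^sub>v e i) (drop_at i \<beta> + (\<beta> $ i) \<cdot>\<^sub>v e i)"
    using assms by (simp add: drop_at_split)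
  also have "\<dots> = lam S' (drop_at i \<alpha>) (drop_at i \<beta>)
     + \<beta> $ i * lam S' (drop_at i \<alpha>) (e i) - \<alpha> $ i * lam S' (drop_at i \<beta>) (e i)"
    using assms lam_skew[OF F, of "e i" "drop_at i \<beta>"] by (simp add: lam_simps[OF F] algebra_simps)
  finally show ?thesis
    using assms by (simp add: mrel_lam_drop mrel_lam_unit)
qed

lemma mrel_tmap:
  assumes "\<alpha> \<in> V"
  shows "tmap S' \<alpha> = sc (- (\<alpha> $ i) * lam S (drop_at i \<alpha>) (- e i + pos_part b))
        (tmap S (drop_at i \<alpha>) * mvar i b S powi (\<alpha> $ i))"
  using tmap_split[OF mrelD(2) assms mrel_mdataD(2)] assms mrel_mdataD(2)
  by (simp add: mrel_lam_unit mrelD)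

text \<open>The right-hand side refers to S alone, so the tori of neighbours can later be described
  without choosing mutated seeds.\<close>

lemma mrel_torus_eq:
  "torus S' = Zq_span v {tmap S \<gamma> * mvar i b S powi n | \<gamma> n. \<gamma> \<in> V \<and> \<gamma> $ i = 0}"
    (is "_ = Zq_span v ?G")
proof
  note [simp] = mrel_mdataD(2)
  have "tmap S' \<alpha> \<in> Zq_span v ?G" if "\<alpha> \<in> V" for \<alpha>
  proof -
    have "tmap S (drop_at i \<alpha>) * mvar i b S powi (\<alpha> $ i) \<in> ?G"
      using that by (auto intro!: exI[of _ "drop_at i \<alpha>"])
    then show ?thesis
      unfolding mrel_tmap[OF that] by (intro span_qclosed(3) span_base)
  qed
  then show "torus S' \<subseteq> Zq_span v ?G"
    unfolding quantum_torus_eq by (intro mspan_least qclosed_span)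
  have "tmap S \<gamma> * mvar i b S powi n \<in> torus S'" if "\<gamma> \<in> V" "\<gamma> $ i = 0" for \<gamma> n
  proof -
    have "tmap S \<gamma> * mvar i b S powi n = tmap S' \<gamma> * tmap S' (n \<cdot>\<^sub>v e i)"
      using that mrelD tmap_powi[OF mrelD(2), of "e i" n] by simp
    then show ?thesis
      using that by (auto intro!: tmap_in_torus qalgD(3)[OF qalg_torus[OF mrelD(2)]])
  qed
  then show "Zq_span v ?G \<subseteq> torus S'"
    using qalgD(1)[OF qalg_torus[OF mrelD(2)]] by (intro span_least) auto
qed

text \<open>The monomial M(b) is common to both frames because b_i = 0, but the exponent of x_i has
  been replaced by its negative. This change of sign is what makes the i-degrees of adjacent tori
  opposite.\<close>

lemma mrel_mdata_back: "mdata i b (- d) S'"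
  unfolding mdata_def
proof (intro conjI ballI)
  note F = mrel_mdataD(1) and [simp] = mrel_mdataD(2,3,4)
  fix \<alpha> :: "int vec" assume "\<alpha> \<in> V"
  then have "lam S' \<alpha> b = - (\<alpha> $ i) * lam S b (- e i + pos_part b)"
    by (simp add: mrel_lam drop_at_same mrel_mdataD(6))
  also have "lam S b (- e i + pos_part b) = - lam S (- e i + pos_part b) b"
    by (rule lam_skew[OF F]) auto
  also have "\<dots> = d" using mrel_mdataD(6)[of "- e i + pos_part b"] mrel_mdataD(7) by simp
  finally show "lam S' \<alpha> b = \<alpha> $ i * - d" by simp
qed (use mrelD mrel_mdataD in auto)

text \<open>Mutation is an involution: x_i and the variable obtained by mutating S' give the same
  sum of two monomials when multiplied on the right by the new variable, which can then be
  cancelled.\<close>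

lemma mrel_back: "mrel i b (- d) S' S"
  unfolding mrel_def
proof (intro conjI ballI impI mrel_mdata_back)
  note F = mrel_mdataD(1) and [simp] = mrel_mdataD(2,3,4)
  have "mvar i b S' * tmap S' (e i) = 
     sc (lam S' (pos_part b) (e i)) (tmap S (pos_part b)) +
     sc (lam S' (pos_part (- b)) (e i)) (tmap S (pos_part (- b)))"
    unfolding mvar_mult_unit[OF mrel_mdata_back] by (simp add: mrelD(3) pos_part_index_i[OF mrelD(1)])
  also have "lam S' (pos_part b) (e i) = lam S (e i) (pos_part b)"
    using lam_skew[OF F, of "e i" "pos_part b"] by (simp add: mrel_lam_unit pos_part_index_i[OF mrelD(1)] lam_simps[OF F])
  also have "lam S' (pos_part (- b)) (e i) = lam S (e i) (pos_part (- b))"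
    using lam_skew[OF F, of "e i" "pos_part (- b)"] lam_pos_part[OF mrelD(1), of "pos_part (- b)"]
    by (simp add: mrel_lam_unit pos_part_index_i[OF mrelD(1)] lam_simps[OF F])
  also have "sc (lam S (e i) (pos_part b)) (tmap S (pos_part b)) +
     sc (lam S (e i) (pos_part (- b))) (tmap S (pos_part (- b))) = tmap S (e i) * mvar i b S"
    by (rule unit_mult_mvar[OF mrelD(1), symmetric])
  finally show "tmap S (e i) = mvar i b S'"
    using mvar_nonzero[OF mrelD(1)] by (simp add: mrelD(4))
qed (use mrelD mrel_mdataD in auto)

lemma unit_in_mut_torus: "tmap S (e i) \<in> torus S'"
proof -
  have "tmap S (e i) = mvar i b S'" using mrel_back by (simp add: mrel_def)
  then show ?thesis
    using mrel_mdataD(3) qalgD(1)[OF qalg_torus[OF mrelD(2)]]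
    by (auto simp: mvar_def intro!: qclosedD(5) tmap_in_torus)
qed

lemma nonneg_in_mut_torus:
  assumes "\<alpha> \<in> V" "\<alpha> $ i \<ge> 0"
  shows "tmap S \<alpha> \<in> torus S'"
proof -
  note q = qalg_torus[OF mrelD(2)] and [simp] = mrel_mdataD(2)
  have "tmap S (drop_at i \<alpha>) \<in> torus S'"
    using assms tmap_in_torus[of "drop_at i \<alpha>" S'] by (simp add: mrelD(3))
  then show ?thesis
    using assms tmap_split[OF mrel_mdataD(1) assms(1), of i] unit_in_mut_torus
    by (auto simp: power_int_def intro!: qclosedD(3)[OF qalgD(1)[OF q]] qalgD(3,4)[OF q])
qed

lemma mspan_nonneg_in_mut_torus: "mspan S (\<lambda>\<alpha>. \<alpha> $ i \<ge> 0) \<subseteq> torus S'"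
  by (intro mspan_least nonneg_in_mut_torus qalgD(1)[OF qalg_torus[OF mrelD(2)]])

lemma ex_power_in_mut_torus:
  assumes "t \<in> torus S"
  shows "\<exists>n. \<forall>m\<ge>n. t * tmap S (e i) ^ m \<in> torus S'"
proof -
  note [simp] = mrel_mdataD(2) and F = mrel_mdataD(1)
  let ?x = "tmap S (e i)" and ?T = "torus S'"
  let ?R = "{t. \<exists>n. \<forall>m\<ge>n. t * ?x ^ m \<in> ?T}"
  note q = qalgD(1)[OF qalg_torus[OF mrelD(2)]]
  have "mspan S (\<lambda>_. True) \<subseteq> ?R"
  proof (rule mspan_least)
    fix \<alpha> :: "int vec" assume \<alpha>: "\<alpha> \<in> V"
    have "tmap S \<alpha> * ?x ^ m \<in> ?T" if "m \<ge> nat (- (\<alpha> $ i))" for m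
      using that \<alpha> by (auto simp: tmap_power[OF F] tmap_mult[OF F] intro!: qclosedD(3)[OF q] nonneg_in_mut_torus)
    then show "tmap S \<alpha> \<in> ?R" by blast
  qed (intro qclosed_eventually q; simp add: left_diff_distrib)
  with assms show ?thesis by (auto simp: quantum_torus_eq)
qed

end

end

section \<open>Coprimality in graded algebras\<close>

context quantum_base
begin

lemma tmap_split_nonneg:
  assumes "frame S" "\<alpha> \<in> V" "i < N" "\<alpha> $ i \<ge> 0"
  shows "tmap S \<alpha> = sc (- (\<alpha> $ i) * lam S (drop_at i \<alpha>) (e i)) (tmap S (drop_at i \<alpha>) * tmap S (e i) ^ nat (\<alpha> $ i))"
  using tmap_split[OF assms(1-3)] assms(4) by (simp add: power_int_def)

text \<open>Conjugation by M(b) has the same eigenvalue on i-exponent n in S and on i-exponent -n in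
  S'. Hence the component g n of an element of both tori equals g' (-n): for n \<ge> 0 the expansion
  in S uses x_i^n, for n < 0 the expansion in S' uses a positive power of the new variable.\<close>

lemma torus_Int_mut_torus:
  assumes mr: "mrel i b d S S'"
  shows "torus S \<inter> torus S' \<subseteq>
    Zq_span v ({tmap S \<gamma> * tmap S (e i) ^ n | \<gamma> n. \<gamma> \<in> V \<and> \<gamma> $ i = 0} \<union>
               {tmap S \<gamma> * tmap S' (e i) ^ n | \<gamma> n. \<gamma> \<in> V \<and> \<gamma> $ i = 0})"
    (is "_ \<subseteq> Zq_span v ?G")
proof
  note m = mrelD[OF mr] and md = mrel_mdataD[OF mr] and [simp] = mrel_mdataD(2)[OF mr]
  note F = md(1) and F' = m(2)
  fix u assume u: "u \<in> torus S \<inter> torus S'"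
  define y where "y = tmap S b"
  have y: "y = tmap S' b" "y \<noteq> 0" using m(3) md by (auto simp: y_def tmap_nonzero)
  obtain D g where g: "finite D" "\<And>n. g n \<in> mspan S (\<lambda>\<alpha>. \<alpha> $ i = n)" "\<And>n. n \<notin> D \<Longrightarrow> g n = 0" "u = sum g D"
    using torus_decomp[of u S "\<lambda>\<alpha>. \<alpha> $ i"] u by auto
  obtain D' g' where g': "finite D'" "\<And>n. g' n \<in> mspan S' (\<lambda>\<alpha>. \<alpha> $ i = n)" "\<And>n. n \<notin> D' \<Longrightarrow> g' n = 0" "u = sum g' D'"
    using torus_decomp[of u S' "\<lambda>\<alpha>. \<alpha> $ i"] u by auto
  have hg: "g n \<in> hom y (- 2 * d * n)" for n
  proof -
    have "2 * lam S b \<alpha> = - 2 * d * n" if "\<alpha> \<in> V" "\<alpha> $ i = n" for \<alpha>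
      using that md lam_skew[OF F, of b \<alpha>] by simp
    then show ?thesis using mspan_hom[OF F, of b "\<lambda>\<alpha>. \<alpha> $ i = n" "- 2 * d * n"] md g(2)
      unfolding y_def by blast
  qed
  have hg': "g' (- n) \<in> hom y (- 2 * d * n)" for n
  proof -
    have "2 * lam S' b \<alpha> = - 2 * d * n" if "\<alpha> \<in> V" "\<alpha> $ i = - n" for \<alpha>
      using that md lam_skew[OF F', of b \<alpha>] mdataD(6)[OF mrel_mdata_back[OF mr]] by simp
    then show ?thesis using mspan_hom[OF F', of b "\<lambda>\<alpha>. \<alpha> $ i = - n" "- 2 * d * n"] md g'(2)
      unfolding y by blast
  qed
  define E where "E = D \<union> uminus ` D'"
  have E: "finite E" using g g' by (auto simp: E_def)
  have uE: "u = sum g E" unfolding g(4) by (rule sum.mono_neutral_left) (use g E in \<open>auto simp: E_def\<close>)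
  have "sum g' D' = (\<Sum>n\<in>uminus ` D'. g' (- n))" by (simp add: sum.reindex)
  also have "\<dots> = (\<Sum>n\<in>E. g' (- n))"
    by (rule sum.mono_neutral_left) (use g' E in \<open>force simp: E_def image_iff\<close>)+
  finally have "(\<Sum>n\<in>E. g n - g' (- n)) = 0"
    using uE g'(4) by (simp add: sum_subtractf)
  then have eq: "g n - g' (- n) = 0" if "n \<in> E" for n
    using E y hg hg' md(5) that
    by (intro hom_independent_int[of E y "\<lambda>n. g n - g' (- n)" "- 2 * d"] qclosedD(2)[OF qclosed_hom]) auto
  have "g n \<in> Zq_span v ?G" if "n \<in> E" for n
  proof (cases "n \<ge> 0")
    case True
    have "mspan S (\<lambda>\<alpha>. \<alpha> $ i = n) \<subseteq> Zq_span v ?G"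
    proof (rule mspan_least)
      fix \<alpha> assume \<alpha>: "\<alpha> \<in> V" "\<alpha> $ i = n"
      have "tmap S (drop_at i \<alpha>) * tmap S (e i) ^ nat (\<alpha> $ i) \<in> ?G"
        using \<alpha> by (intro UnI1) (auto intro!: exI[of _ "drop_at i \<alpha>"])
      then show "tmap S \<alpha> \<in> Zq_span v ?G"
        using \<alpha> True
        by (subst tmap_split_nonneg[OF F \<alpha>(1) md(2)]) (simp, intro span_qclosed(3) span_base, simp)
    qed simp
    then show ?thesis using g by auto
  next
    case False
    have "mspan S' (\<lambda>\<alpha>. \<alpha> $ i = - n) \<subseteq> Zq_span v ?G"
    proof (rule mspan_least)
      fix \<alpha> assume \<alpha>: "\<alpha> \<in> V" "\<alpha> $ i = - n"
      have "tmap S (drop_at i \<alpha>) * tmap S' (e i) ^ nat (\<alpha> $ i) \<in> ?G"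
        using \<alpha> by (intro UnI2) (auto intro!: exI[of _ "drop_at i \<alpha>"])
      then show "tmap S' \<alpha> \<in> Zq_span v ?G"
        using \<alpha> False m(3)[of "drop_at i \<alpha>"]
        by (subst tmap_split_nonneg[OF F' \<alpha>(1) md(2)]) (simp, simp add: m(3)[of "drop_at i \<alpha>"] span_qclosed(3) span_base)
    qed simp
    then show ?thesis using g'(2)[of "- n"] eq[OF that] by auto
  qed
  then show "u \<in> Zq_span v ?G"
    unfolding uE by (intro qclosed_sum qclosed_span)
qed

definition graded :: "'f set \<Rightarrow> 'f \<Rightarrow> bool" where
  "graded T y \<longleftrightarrow> (\<forall>t\<in>T. \<exists>D g. finite D \<and> (\<forall>d. g d \<in> T \<inter> hom y d) \<and> (\<forall>d. d \<notin> D \<longrightarrow> g d = 0) \<and> t = sum g D)"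

lemma graded_torus:
  assumes F: "frame S" and \<eta>: "\<eta> \<in> V"
  shows "graded (torus S) (tmap S \<eta>)"
  unfolding graded_def
proof
  fix t assume "t \<in> torus S"
  from torus_decomp[OF this, of "\<lambda>\<alpha>. 2 * lam S \<eta> \<alpha>"] obtain D g where
    g: "finite D" "\<And>d. g d \<in> mspan S (\<lambda>\<alpha>. 2 * lam S \<eta> \<alpha> = d)" "\<forall>d. d \<notin> D \<longrightarrow> g d = 0" "t = sum g D"
    by blast
  have "g d \<in> torus S \<inter> hom (tmap S \<eta>) d" for d
    using g(2)[of d] mspan_hom[OF F \<eta>, of "\<lambda>\<alpha>. 2 * lam S \<eta> \<alpha> = d" d]
      mspan_mono[of "\<lambda>\<alpha>. 2 * lam S \<eta> \<alpha> = d" "\<lambda>_. True" S]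
    by (auto simp: quantum_torus_eq)
  with g show "\<exists>D g. finite D \<and> (\<forall>d. g d \<in> torus S \<inter> hom (tmap S \<eta>) d) \<and> (\<forall>d. d \<notin> D \<longrightarrow> g d = 0) \<and> t = sum g D"
    by blast
qed

text \<open>Reverses the order of the degrees, so that division may start from either end.\<close>

lemma graded_inverse: assumes "graded T y" shows "graded T (inverse y)"
  unfolding graded_def
proof
  fix t assume "t \<in> T"
  with assms obtain D g where g: "finite D" "\<And>d. g d \<in> T \<inter> hom y d" "\<And>d. d \<notin> D \<Longrightarrow> g d = 0" "t = sum g D"
    unfolding graded_def by metis
  have "g (- d) \<in> T \<inter> hom (inverse y) d" for d
    using g(2)[of "- d"] hom_inverse_left[of "g (- d)" y "- d"] by auto
  moreover have "t = (\<Sum>d\<in>uminus ` D. g (- d))" using g(4) by (simp add: sum.reindex)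
  ultimately show "\<exists>D g. finite D \<and> (\<forall>d. g d \<in> T \<inter> hom (inverse y) d) \<and> (\<forall>d. d \<notin> D \<longrightarrow> g d = 0) \<and> t = sum g D"
    using g(1,3) by (intro exI[of _ "uminus ` D"] exI[of _ "\<lambda>d. g (- d)"]) (force simp: image_iff)
qed

lemma sum_shift:
  fixes h :: "int \<Rightarrow> 'f"
  assumes "finite X" "(\<lambda>d. d + s) ` D \<subseteq> X" "\<And>d. d \<notin> D \<Longrightarrow> h d = 0"
  shows "(\<Sum>x\<in>X. h (x - s)) = sum h D"
proof -
  have "sum h D = (\<Sum>x\<in>(\<lambda>d. d + s) ` D. h (x - s))"
    by (simp add: sum.reindex)
  also have "\<dots> = (\<Sum>x\<in>X. h (x - s))"
  proof (rule sum.mono_neutral_left[OF assms(1,2)], rule ballI)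
    fix x assume "x \<in> X - (\<lambda>d. d + s) ` D"
    then have "x - s \<notin> D" by (metis DiffD2 diff_add_cancel imageI)
    then show "h (x - s) = 0" by (rule assms(3))
  qed
  finally show ?thesis ..
qed

text \<open>Division of \<open>a\<close> by \<open>V0 + V1\<close> from the bottom degree upwards: comparing extreme degrees in
  \<open>a * W = c * (V0 + V1)\<close> shows that \<open>a\<close> spans at least \<open>\<delta>\<close> degrees unless it vanishes, so removing its lowest
  term never creates a term above its top degree.\<close>

lemma coprime_division_pos:
  assumes T: "qalg T" and y: "y \<noteq> 0" and gr: "graded T y"
    and V0: "V0 \<in> hom y p" "inverse V0 \<in> T" "V0 \<noteq> 0"
    and V1: "V1 \<in> T" "V1 \<in> hom y (p + \<delta>)" "V1 \<noteq> 0" and \<delta>: "\<delta> > 0"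
    and W: "W \<in> T" "W \<in> hom y f" "W \<noteq> 0"
    and VW: "(V0 + V1) * W = sc l (W * (V0 + V1))"
    and a: "a \<in> T" "c \<in> T" "a * W = c * (V0 + V1)"
  shows "\<exists>a'\<in>T. a = a' * (V0 + V1)"
proof -
  note q = qalgD(1)[OF T]
  have step: "\<exists>a'\<in>T. sum g {m..M} = a' * (V0 + V1)"
    if "nat (M + 1 - m) = k" "\<And>d. g d \<in> T \<inter> hom y d" "c \<in> T" "sum g {m..M} * W = c * (V0 + V1)"
    for k m M g c
    using that
  proof (induction k arbitrary: m g c)
    case 0
    then have "sum g {m..M} = 0" by simp
    with qclosedD(1)[OF q] show ?case by auto
  next
    case (Suc k)
    show ?case
    proof (cases "sum g {m..M} = 0")
      case True
      with qclosedD(1)[OF q] show ?thesis by auto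
    next
      case False
      obtain D h where h: "finite D" "\<And>d. h d \<in> T \<inter> hom y d" "\<And>d. d \<notin> D \<Longrightarrow> h d = 0" "c = sum h D"
        using gr Suc.prems(3) unfolding graded_def by metis
      define D' where "D' = {d\<in>D. h d \<noteq> 0}"
      have D': "finite D'" "\<And>d. d \<notin> D' \<Longrightarrow> h d = 0" "c = sum h D'"
        using h by (auto simp: D'_def intro: sum.mono_neutral_right)
      have ne: "D' \<noteq> {}"
        using False W Suc.prems(4) D' by auto
      define G where "G d = (if d \<in> {m..M} then g d * W else 0)" for d
      define X where "X = (\<lambda>d. d + f) ` {m..M} \<union> (\<lambda>d. d + p) ` D' \<union> (\<lambda>d. d + (p + \<delta>)) ` D'"
      have X: "finite X" using D' by (auto simp: X_def)
      have "(\<Sum>x\<in>X. G (x - f)) = sum G {m..M}"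
        by (rule sum_shift) (use X in \<open>auto simp: X_def G_def\<close>)
      also have "\<dots> = sum g {m..M} * W" by (simp add: G_def sum_distrib_right)
      also have "\<dots> = (\<Sum>d\<in>D'. h d * V0) + (\<Sum>d\<in>D'. h d * V1)"
        using Suc.prems(4) D'(3) by (simp add: distrib_left sum_distrib_right)
      also have "(\<Sum>d\<in>D'. h d * V0) = (\<Sum>x\<in>X. h (x - p) * V0)"
        by (rule sum_shift[symmetric]) (use X D' in \<open>auto simp: X_def\<close>)
      also have "(\<Sum>d\<in>D'. h d * V1) = (\<Sum>x\<in>X. h (x - (p + \<delta>)) * V1)"
        by (rule sum_shift[symmetric]) (use X D' in \<open>auto simp: X_def\<close>)
      finally have z: "(\<Sum>x\<in>X. G (x - f) - (h (x - p) * V0 + h (x - (p + \<delta>)) * V1)) = 0"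
        by (simp add: sum_subtractf sum.distrib)
      have hm: "G (x - f) - (h (x - p) * V0 + h (x - (p + \<delta>)) * V1) \<in> hom y (1 * x)" for x
      proof -
        have "G (x - f) \<in> hom y x"
          using hom_mult[of "g (x - f)" y "x - f" W f] Suc.prems(2) W by (auto simp: G_def)
        moreover have "h (x - p) * V0 \<in> hom y x"
          using hom_mult[of "h (x - p)" y "x - p" V0 p] h(2) V0 by auto
        moreover have "h (x - (p + \<delta>)) * V1 \<in> hom y x"
          using hom_mult[of "h (x - (p + \<delta>))" y "x - (p + \<delta>)" V1 "p + \<delta>"] h(2) V1 by auto
        ultimately show ?thesis
          by (auto intro: qclosedD(2)[OF qclosed_hom] hom_add)
      qed
      have eq: "G (x - f) = h (x - p) * V0 + h (x - (p + \<delta>)) * V1" if "x \<in> X" for x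
        using hom_independent_int[OF X y hm _ z that] by simp
      \<comment> \<open>The lowest component of c times V0 meets no term from V1, so it survives as
        a component of the left-hand side and its degree is in range. Likewise the highest component
        times V1 below. Together they give m + \<delta> \<le> M.\<close>
      have lo: "m \<le> Min D' + p - f"
      proof -
        have "Min D' \<in> D'" using D' ne by simp
        moreover have "h (Min D' - \<delta>) = 0" using D' \<delta> Min_le[of D' "Min D' - \<delta>"] by fastforce
        ultimately have "G (Min D' + p - f) = h (Min D') * V0"
          using eq[of "Min D' + p"] by (auto simp: X_def)
        moreover have "h (Min D') * V0 \<noteq> 0" using \<open>Min D' \<in> D'\<close> V0 by (auto simp: D'_def)
        ultimately have "G (Min D' + p - f) \<noteq> 0" by simp
        then show ?thesis by (auto simp: G_def split: if_splits)
      qed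
      have hi: "Max D' + p + \<delta> - f \<le> M"
      proof -
        have "Max D' \<in> D'" using D' ne by simp
        moreover have "h (Max D' + \<delta>) = 0" using D' \<delta> Max_ge[of D' "Max D' + \<delta>"] by fastforce
        ultimately have "G (Max D' + p + \<delta> - f) = h (Max D') * V1"
          using eq[of "Max D' + (p + \<delta>)"] by (auto simp: X_def algebra_simps)
        moreover have "h (Max D') * V1 \<noteq> 0" using \<open>Max D' \<in> D'\<close> V1 by (auto simp: D'_def)
        ultimately have "G (Max D' + p + \<delta> - f) \<noteq> 0" by simp
        then show ?thesis by (auto simp: G_def split: if_splits)
      qed
      have "Min D' \<le> Max D'" using D' ne by simp
      with lo hi have mM: "m + \<delta> \<le> M" by linarith
      define r where "r = g m * inverse V0"
      have r: "r \<in> T" "r * V0 = g m" using Suc.prems(2)[of m] V0 T by (auto simp: r_def mult.assoc intro: qalgD)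
      have "r * V1 \<in> T" using r V1 T by (auto intro: qalgD)
      moreover have "r * V1 \<in> hom y (m + \<delta>)"
        unfolding r_def using hom_mult[OF hom_mult[OF _ hom_inverse[OF V0(1)]] V1(2), of "g m" m] Suc.prems(2)[of m]
        by (simp add: algebra_simps)
      ultimately have rV1: "r * V1 \<in> T \<inter> hom y (m + \<delta>)" by simp
      \<comment> \<open>Subtracting r * (V0 + V1) removes the bottom component g m = r * V0 and
        otherwise changes only degree m + \<delta>, which does not exceed M.\<close>
      define g2 where "g2 = g(m + \<delta> := g (m + \<delta>) - r * V1)"
      have g2: "g2 d \<in> T \<inter> hom y d" for d
        using Suc.prems(2)[of d] rV1 qclosedD(2)[OF q] qclosedD(2)[OF qclosed_hom] by (auto simp: g2_def)
      have mm: "{m..M} = insert m {m+1..M}" using mM \<delta> by auto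
      have in2: "m + \<delta> \<in> {m+1..M}" using mM \<delta> by auto
      have s2: "sum g2 {m+1..M} = sum g {m+1..M} - r * V1"
      proof -
        have "sum g2 {m+1..M} = g2 (m + \<delta>) + sum g2 ({m+1..M} - {m + \<delta>})"
          by (rule sum.remove[OF _ in2]) simp
        also have "sum g2 ({m+1..M} - {m + \<delta>}) = sum g ({m+1..M} - {m + \<delta>})"
          by (rule sum.cong) (auto simp: g2_def)
        finally show ?thesis
          using sum.remove[OF _ in2, of g] by (simp add: g2_def algebra_simps)
      qed
      have s3: "sum g {m..M} = sum g2 {m+1..M} + r * (V0 + V1)"
        unfolding s2 mm using r by (simp add: distrib_left)
      \<comment> \<open>As W commutes with V0 + V1 up to a power of \<open>v\<close>, what is
        subtracted is again a left multiple of V0 + V1, and the hypothesis persists with a new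
        cofactor.\<close>
      have "sum g2 {m+1..M} * W = sum g {m..M} * W - r * ((V0 + V1) * W)"
        unfolding s3 by (simp add: algebra_simps)
      also have "\<dots> = (c - sc l (r * W)) * (V0 + V1)"
        unfolding VW Suc.prems(4) by (simp add: left_diff_distrib mult.assoc)
      finally have "sum g2 {m+1..M} * W = (c - sc l (r * W)) * (V0 + V1)" .
      moreover have "c - sc l (r * W) \<in> T"
        using Suc.prems(3) r W T by (auto intro: qclosedD[OF q] qalgD)
      moreover have "nat (M + 1 - (m + 1)) = k" using Suc.prems(1) by linarith
      ultimately obtain a' where "a' \<in> T" "sum g2 {m+1..M} = a' * (V0 + V1)"
        using Suc.IH[of "m + 1" g2] g2 by blast
      then have "a' + r \<in> T" "sum g {m..M} = (a' + r) * (V0 + V1)"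
        using r s3 by (auto simp: distrib_right intro: qclosedD[OF q])
      then show ?thesis by blast
    qed
  qed
  obtain D g where g: "finite D" "\<And>d. g d \<in> T \<inter> hom y d" "\<And>d. d \<notin> D \<Longrightarrow> g d = 0" "a = sum g D"
    using gr a(1) unfolding graded_def by metis
  obtain m M where "D \<subseteq> {m..M}"
  proof (cases "D = {}")
    case False
    then have "D \<subseteq> {Min D..Max D}" using g by auto
    then show ?thesis by (rule that)
  qed auto
  then have "a = sum g {m..M}"
    unfolding g(4) by (intro sum.mono_neutral_left) (use g in auto)
  with step[OF refl g(2) a(2)] a(3) show ?thesis by auto
qed

text \<open>The invertible term V0 may have the larger degree; conjugation by
  \<open>inverse y\<close> then reverses the order and reduces to the previous case.\<close>

lemma coprime_division:
  assumes "qalg T" "y \<noteq> 0" "graded T y"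
    and "V0 \<in> hom y p" "inverse V0 \<in> T" "V0 \<noteq> 0"
    and "V1 \<in> T" "V1 \<in> hom y p'" "V1 \<noteq> 0" "p \<noteq> p'"
    and "W \<in> T" "W \<in> hom y f" "W \<noteq> 0"
    and "(V0 + V1) * W = sc l (W * (V0 + V1))"
    and "a \<in> T" "c \<in> T" "a * W = c * (V0 + V1)"
  shows "\<exists>a'\<in>T. a = a' * (V0 + V1)"
proof (cases "p < p'")
  case True
  show ?thesis
    by (rule coprime_division_pos[where \<delta> = "p' - p", OF assms(1-7) _ assms(9) _ assms(11-17)])
       (use True assms(8) in auto)
next
  case False
  show ?thesis
    by (rule coprime_division_pos[where \<delta> = "p - p'" and p = "- p" and y = "inverse y" and f = "- f",
          OF assms(1) _ graded_inverse[OF assms(3)] hom_inverse_left[OF assms(4)] assms(5-7) _ assms(9) _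
          assms(11) hom_inverse_left[OF assms(12)] assms(13-17)])
       (use False assms hom_inverse_left[OF assms(8)] in auto)
qed

end

section \<open>The rank two Laurent phenomenon\<close>

context quantum_base
begin

text \<open>The path \<open>Si - S - R - S2\<close> of seeds alternates mutations at \<open>i\<close>, \<open>k\<close>, \<open>i\<close>, and \<open>b\<close>, \<open>c\<close>, \<open>\<beta>\<close> are the
  columns \<open>i\<close>, \<open>k\<close> of \<open>S\<close> and \<open>i\<close> of \<open>R\<close>, all with the same sign. An element \<open>u\<close> of the first three tori
  becomes an element of the last one after multiplication by a power of \<open>x\<^sub>i\<close> (as \<open>u\<close> lies in the torus
  of \<open>R\<close>) or of \<open>x\<^sub>k\<close> (as it lies in those of \<open>S\<close> and \<open>Si\<close>), and these two are coprime there.\<close>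

context
  fixes i k b c \<beta> d dk d' S Si R S2
  assumes Si: "mrel i b d S Si" and R: "mrel k c dk S R" and S2: "mrel i \<beta> d' R S2"
    and ik: "i \<noteq> k" and bk: "b $ k \<ge> 0" and ci: "c $ i = - (b $ k)"
    and \<beta>: "\<And>j. j < N \<Longrightarrow> \<beta> $ j = b $ j - (if j = k then 2 * b $ k else 0) + b $ k * max (c $ j) 0"
begin

lemma r2_simps:
  "i < N" "k < N" "b \<in> V" "c \<in> V" "\<beta> \<in> V" "dim_vec b = N" "dim_vec c = N" "dim_vec \<beta> = N"
  "b $ i = 0" "\<beta> $ i = 0" "c $ k = 0" "frame S" "frame Si" "frame R" "frame S2"
  using mrel_mdataD[OF Si] mrel_mdataD[OF R] mrel_mdataD[OF S2] mrelD(2)[OF Si] mrelD(2)[OF R] mrelD(2)[OF S2]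
  by auto

lemma r2_units: "tmap R (e i) = tmap S (e i)" "tmap Si (e k) = tmap S (e k)"
  using mrelD(3)[OF R, of "e i"] mrelD(3)[OF Si, of "e k"] ik r2_simps by auto

definition "gexp = - e k + pos_part c"
definition "hexp = - e k + pos_part (- c)"

lemma gh_carrier: "gexp \<in> V" "hexp \<in> V" "gexp $ i = 0" "hexp $ i = b $ k"
  using r2_simps ik bk ci by (auto simp: gexp_def hexp_def)

lemma xk_eq: "tmap S (e k) = tmap R gexp + tmap R hexp"
  using mrelD(4)[OF mrel_back[OF R]] by (simp add: mvar_def gexp_def hexp_def)

lemma xk_in: "tmap S (e k) \<in> torus S2"
  unfolding xk_eq using gh_carrier bk
  by (intro qclosedD(5)[OF qalgD(1)[OF qalg_torus[OF r2_simps(15)]]] nonneg_in_mut_torus[OF S2]) auto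

lemma xi_in: "tmap S (e i) \<in> torus S2"
  using unit_in_mut_torus[OF S2] r2_units by simp

text \<open>Replaces the binomial theorem for noncommuting g and h: each word other than g^m
  contains h, which has i-degree b_k, while g has i-degree 0.\<close>

lemma gh_power: "(tmap R gexp + tmap R hexp) ^ m - tmap R gexp ^ m \<in> mspan R (\<lambda>\<alpha>. \<alpha> $ i \<ge> b $ k)"
proof (induction m)
  case 0
  then show ?case by (simp add: mspan_qclosed)
next
  case (Suc m)
  note [simp] = r2_simps
  have g: "tmap R gexp \<in> mspan R (\<lambda>\<alpha>. \<alpha> $ i \<ge> 0)"
    and h: "tmap R hexp \<in> mspan R (\<lambda>\<alpha>. \<alpha> $ i \<ge> b $ k)"
    and h0: "tmap R hexp \<in> mspan R (\<lambda>\<alpha>. \<alpha> $ i \<ge> 0)"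
    using gh_carrier bk by (auto intro!: mspan_base)
  have gm: "tmap R gexp ^ m \<in> mspan R (\<lambda>\<alpha>. \<alpha> $ i \<ge> 0)"
    using gh_carrier by (auto simp: tmap_power intro!: mspan_base)
  have eq: "(tmap R gexp + tmap R hexp) ^ Suc m - tmap R gexp ^ Suc m =
      (tmap R gexp + tmap R hexp) * ((tmap R gexp + tmap R hexp) ^ m - tmap R gexp ^ m)
      + tmap R hexp * tmap R gexp ^ m"
    by (simp add: algebra_simps)
  show ?case unfolding eq
    by (intro mspan_qclosed(5) mspan_mult[OF r2_simps(14) mspan_qclosed(5)[OF g h0] Suc] mspan_mult[OF r2_simps(14) h gm])
      auto
qed

text \<open>The variable \<open>x\<^sub>k\<close> is \<open>g + h\<close> with \<open>g\<close> of \<open>i\<close>-degree 0 and \<open>h\<close> of \<open>i\<close>-degree \<open>b\<^sub>k\<close>. Substituting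
  this into the new variable of \<open>Si\<close>, the part of \<open>i\<close>-degree \<open>-1\<close> is a monomial multiple of the new variable
  of \<open>S2\<close>, and the rest has nonnegative \<open>i\<close>-degree.\<close>

lemma new_variable_in: "tmap Si (e i) \<in> torus S2"
proof -
  note [simp] = r2_simps gh_carrier
  note FS = r2_simps(12) and FR = r2_simps(14) and q = qalg_torus[OF r2_simps(15)]
  define n where "n = b $ k"
  have n: "n \<ge> 0" using bk by (simp add: n_def)
  \<comment> \<open>Exponents \<alpha> and \<zeta> of the two exchange terms of x_i in S. As b_k = n
    \<ge> 0, the first contains x_k^n, which has to be expanded in R, while the second is free of
    x_k and is the same monomial in R.\<close>
  define \<alpha> where "\<alpha> = - e i + pos_part b"
  define \<gamma> where "\<gamma> = drop_at k \<alpha>"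
  define \<zeta> where "\<zeta> = - e i + pos_part (- b)"
  have \<alpha>: "\<alpha> \<in> V" "\<alpha> $ k = n" "\<alpha> $ i = -1" using ik n by (auto simp: \<alpha>_def n_def)
  have \<gamma>: "\<gamma> \<in> V" "\<gamma> $ k = 0" "\<gamma> $ i = -1" using \<alpha> ik by (auto simp: \<gamma>_def)
  have \<zeta>: "\<zeta> \<in> V" "\<zeta> $ k = 0" using ik n by (auto simp: \<zeta>_def n_def)
  define g where "g = tmap R gexp"
  define rest where "rest = (tmap R gexp + tmap R hexp) ^ nat n - g ^ nat n"
  have xn: "tmap S (e k) ^ nat n = g ^ nat n + rest" by (simp add: rest_def xk_eq)
  have l: "lam S \<gamma> (e k) = lam R \<gamma> gexp"
    using mrel_lam_unit[OF mrel_back[OF R] \<gamma>(1,2)] by (simp add: gexp_def)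
  have "tmap S \<alpha> = sc (- n * lam S \<gamma> (e k)) (tmap R \<gamma> * (g ^ nat n + rest))"
    using tmap_split_nonneg[OF FS \<alpha>(1), of k] \<alpha> n xn \<gamma>_def[symmetric] mrelD(3)[OF R \<gamma>(1,2)] by simp
  also have "\<dots> = tmap R (\<gamma> + n \<cdot>\<^sub>v gexp) + sc (- n * lam S \<gamma> (e k)) (tmap R \<gamma> * rest)"
    using \<gamma> n by (simp add: g_def tmap_power[OF FR] tmap_mult[OF FR] distrib_left sc_add lam_simps[OF FR] l)
  finally have 1: "tmap S \<alpha> = tmap R (\<gamma> + n \<cdot>\<^sub>v gexp) + sc (- n * lam S \<gamma> (e k)) (tmap R \<gamma> * rest)" .
  have rest_in: "tmap R \<gamma> * rest \<in> torus S2"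
  \<comment> \<open>For n = 0 the remainder is zero, whereas \<open>gh_power\<close> would only give
    i-degree at least -1.\<close>
  proof (cases "n = 0")
    case True
    then show ?thesis using qclosedD(1)[OF qalgD(1)[OF q]] by (simp add: rest_def)
  next
    case False
    have g: "tmap R \<gamma> \<in> mspan R (\<lambda>\<alpha>. \<alpha> $ i \<ge> -1)" using \<gamma> by (intro mspan_base) auto
    have "tmap R \<gamma> * rest \<in> mspan R (\<lambda>\<alpha>. \<alpha> $ i \<ge> 0)"
      unfolding rest_def g_def by (rule mspan_mult[OF FR g gh_power]) (use False n n_def in auto)
    then show ?thesis using mspan_nonneg_in_mut_torus[OF S2] by blast
  qed
  \<comment> \<open>The common factor of the two surviving monomials: each of their exponents is
    \<mu> plus an exchange exponent of R at i. For the first one this is the mutation rule for the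
    column \<beta>.\<close>
  define \<mu> where "\<mu> = pos_part (- b) - pos_part (- \<beta>)"
  have \<mu>: "\<mu> \<in> V" "\<mu> $ i = 0" by (auto simp: \<mu>_def)
  define w where "w = - e i + pos_part \<beta>"
  define w' where "w' = - e i + pos_part (- \<beta>)"
  have w: "w \<in> V" "w' \<in> V" by (auto simp: w_def w'_def)
  have v1: "\<zeta> = \<mu> + w'"
    by (rule eq_vecI) (auto simp: \<zeta>_def \<mu>_def w'_def)
  have v2: "\<gamma> + n \<cdot>\<^sub>v gexp = \<mu> + w"
  proof (rule eq_vecI)
    fix j assume "j < dim_vec (\<mu> + w)"
    then have j: "j < N" using w by auto
    have gj: "\<gamma> $ j = (if j = k then 0 else - e i $ j + max (b $ j) 0)"
      using j \<alpha> by (simp add: \<gamma>_def \<alpha>_def)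
    have "n * (max (c $ j) 0) = \<beta> $ j - b $ j + (if j = k then 2 * n else 0)"
      using \<beta>[OF j] by (simp add: n_def)
    moreover have "c $ j = 0" if "j = k" using that by simp
    ultimately show "(\<gamma> + n \<cdot>\<^sub>v gexp) $ j = (\<mu> + w) $ j"
      using j \<gamma> ik n by (auto simp: gj gexp_def \<mu>_def w_def n_def[symmetric] algebra_simps)
  qed (use \<gamma> w in auto)
  \<comment> \<open>By compatibility both exchange exponents pair equally with \<mu>, as \<mu>_i =
    0; so M(\<mu>) factors out of the sum with one power of \<open>v\<close>.\<close>
  have lw: "lam R \<mu> w = lam R \<mu> w'"
    using lam_pos_part[OF mrelD(1)[OF S2] \<mu>(1)] \<mu> by (simp add: w_def w'_def lam_simps[OF FR])
  have "tmap R (\<gamma> + n \<cdot>\<^sub>v gexp) + tmap R \<zeta> = sc (- lam R \<mu> w) (tmap R \<mu> * mvar i \<beta> R)"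
    unfolding v1 v2 using \<mu> w by (simp add: tmap_add[OF FR] lw mvar_def w_def[symmetric] w'_def[symmetric] distrib_left sc_add)
  also have "\<dots> = sc (- lam R \<mu> w) (tmap S2 \<mu> * tmap S2 (e i))"
    using mrelD(3,4)[OF S2] \<mu> by simp
  finally have 2: "tmap R (\<gamma> + n \<cdot>\<^sub>v gexp) + tmap R \<zeta> = sc (- lam R \<mu> w) (tmap S2 \<mu> * tmap S2 (e i))" .
  have "tmap Si (e i) = tmap S \<alpha> + tmap S \<zeta>"
    using mrelD(4)[OF Si] by (simp add: mvar_def \<alpha>_def \<zeta>_def)
  also have "\<dots> = (tmap R (\<gamma> + n \<cdot>\<^sub>v gexp) + tmap R \<zeta>) + sc (- n * lam S \<gamma> (e k)) (tmap R \<gamma> * rest)"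
    unfolding 1 using mrelD(3)[OF R \<zeta>] by simp
  finally show ?thesis
    unfolding 2 using \<mu> rest_in
    by (auto intro!: qclosedD(3,5)[OF qalgD(1)[OF q]] qalgD(3)[OF q] tmap_in_torus)
qed

lemma nonneg2_in:
  assumes "\<alpha> \<in> V" "\<alpha> $ i \<ge> 0" "\<alpha> $ k \<ge> 0"
  shows "tmap S \<alpha> \<in> torus S2"
proof -
  note [simp] = r2_simps
  note q = qalg_torus[OF r2_simps(15)]
  have "tmap S (drop_at k \<alpha>) \<in> torus S2"
    using nonneg_in_mut_torus[OF S2, of "drop_at k \<alpha>"] mrelD(3)[OF R, of "drop_at k \<alpha>"] assms ik by simp
  then show ?thesis
    using assms xk_in
    by (subst tmap_split_nonneg[of S \<alpha> k]) (auto intro!: qclosedD(3)[OF qalgD(1)[OF q]] qalgD(3,4)[OF q])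
qed

text \<open>On the spanning set of \<open>torus_Int_mut_torus\<close> only the exponent of x_k can
  be harmful: x_i and its mutation in Si both lie in the last torus, and a power of x_k makes that
  exponent nonnegative.\<close>

lemma ex_xk_power_in:
  assumes "u \<in> torus S" "u \<in> torus Si"
  shows "\<exists>n. \<forall>m\<ge>n. u * tmap S (e k) ^ m \<in> torus S2"
proof -
  note [simp] = r2_simps
  note FS = r2_simps(12) and q = qalg_torus[OF r2_simps(15)]
  let ?T = "torus S2" and ?x = "tmap S (e k)"
  let ?Q = "{t. \<exists>n. \<forall>m\<ge>n. t * ?x ^ m \<in> ?T}"
  have "tmap S \<gamma> * tmap S (e i) ^ r \<in> ?Q" if \<gamma>: "\<gamma> \<in> V" "\<gamma> $ i = 0" for \<gamma> r
  proof -
    have "tmap S \<gamma> * tmap S (e i) ^ r * ?x ^ m \<in> ?T" if "m \<ge> nat (- (\<gamma> $ k))" for m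
    proof -
      have "tmap S \<gamma> * tmap S (e i) ^ r * ?x ^ m =
          sc (lam S \<gamma> (int r \<cdot>\<^sub>v e i) + lam S (\<gamma> + int r \<cdot>\<^sub>v e i) (int m \<cdot>\<^sub>v e k)) (tmap S (\<gamma> + int r \<cdot>\<^sub>v e i + int m \<cdot>\<^sub>v e k))"
        using \<gamma> by (simp add: tmap_power[OF FS] tmap_mult[OF FS])
      also have "\<dots> \<in> ?T"
        using \<gamma> ik that by (intro qclosedD(3)[OF qalgD(1)[OF q]] nonneg2_in) auto
      finally show ?thesis .
    qed
    then show ?thesis by blast
  qed
  moreover have "tmap S \<gamma> * tmap Si (e i) ^ r \<in> ?Q" if \<gamma>: "\<gamma> \<in> V" "\<gamma> $ i = 0" for \<gamma> r
  proof -
    have "tmap S \<gamma> * tmap Si (e i) ^ r * ?x ^ m \<in> ?T" if "m \<ge> nat (- (\<gamma> $ k))" for m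
    proof -
      have "tmap Si (e i) ^ r * ?x ^ m = sc (2 * lam Si (int r \<cdot>\<^sub>v e i) (int m \<cdot>\<^sub>v e k)) (?x ^ m * tmap Si (e i) ^ r)"
        using tmap_hom[OF r2_simps(13), of "int m \<cdot>\<^sub>v e k" "int r \<cdot>\<^sub>v e i"]
        by (simp add: r2_units(2)[symmetric] tmap_power[OF r2_simps(13)] hom_def)
      then have "tmap S \<gamma> * tmap Si (e i) ^ r * ?x ^ m =
          sc (2 * lam Si (int r \<cdot>\<^sub>v e i) (int m \<cdot>\<^sub>v e k)) ((tmap S \<gamma> * ?x ^ m) * tmap Si (e i) ^ r)"
        by (simp add: mult.assoc)
      moreover have "tmap S \<gamma> * ?x ^ m \<in> ?T"
        using \<gamma> ik that by (simp add: tmap_power[OF FS] tmap_mult[OF FS])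
          (intro qclosedD(3)[OF qalgD(1)[OF q]] nonneg2_in; auto)
      ultimately show ?thesis
        using new_variable_in by (auto intro!: qclosedD(3)[OF qalgD(1)[OF q]] qalgD(3,4)[OF q])
    qed
    then show ?thesis by blast
  qed
  ultimately have "torus S \<inter> torus Si \<subseteq> ?Q"
    using qclosed_eventually[OF qalgD(1)[OF q], of "\<lambda>m t. t * ?x ^ m"]
    by (intro subset_trans[OF torus_Int_mut_torus[OF Si]] span_least) (auto simp: left_diff_distrib)
  with assms show ?thesis by blast
qed

text \<open>Coprimality of x_k and x_i^m in the last torus: there x_k = g + h with g invertible,
  since g has i-degree 0, so division by x_k is possible once it is possible after multiplication by
  x_i^m.\<close>

lemma cancel_xk:
  assumes "w * tmap S (e k) \<in> torus S2" "w * tmap S (e i) ^ m \<in> torus S2"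
  shows "w \<in> torus S2"
proof -
  note [simp] = r2_simps gh_carrier
  note FS = r2_simps(12) and FR = r2_simps(14) and F2 = r2_simps(15) and q = qalg_torus[OF r2_simps(15)]
  let ?T = "torus S2"
  \<comment> \<open>With \<eta>_i = 0 the monomial M(\<eta>) is common to R and S2 and grades the
    torus of S2. The exponents of g and h differ by c, so \<Lambda>(\<eta>, c) \<noteq> 0 in R gives
    them different degrees.\<close>
  obtain \<eta> where \<eta>: "\<eta> \<in> V" "\<eta> $ i = 0" "lam R \<eta> c \<noteq> 0"
  proof (cases "b $ k = 0")
    case True
    have "lam R (e k) c \<noteq> 0" using mdataD(5)[OF mrel_mdata_back[OF R]] mdataD(6)[OF mrel_mdata_back[OF R], of "e k"] by simp
    then show ?thesis using that[of "e k"] ik by simp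
  next
    case False
    have "lam R \<beta> c = b $ k * d'"
      using lam_skew[OF FR, of \<beta> c] mrel_mdataD(6)[OF S2, of c] ci by simp
    then show ?thesis using that[of \<beta>] False mrel_mdataD(5)[OF S2] by simp
  qed
  let ?y = "tmap R \<eta>"
  have y: "?y = tmap S2 \<eta>" using mrelD(3)[OF S2 \<eta>(1,2)] by simp
  have hx: "tmap R hexp \<in> ?T" using bk by (intro nonneg_in_mut_torus[OF S2]) auto
  have gi: "inverse (tmap R gexp) \<in> ?T"
    by (simp add: tmap_inverse[OF FR]) (intro nonneg_in_mut_torus[OF S2], auto simp: carrier_vecD[OF gh_carrier(1)])
  have xi: "tmap S (e i) ^ m = tmap R (int m \<cdot>\<^sub>v e i)"
    by (simp add: r2_units(1)[symmetric] tmap_power[OF FR])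
  have xiS: "tmap S (e i) ^ m = tmap S (int m \<cdot>\<^sub>v e i)"
    by (simp add: tmap_power[OF FS])
  have comm: "tmap S (e k) * tmap S (e i) ^ m = sc (2 * lam S (e k) (int m \<cdot>\<^sub>v e i)) (tmap S (e i) ^ m * tmap S (e k))"
    using tmap_hom[OF FS, of "int m \<cdot>\<^sub>v e i" "e k"] by (simp add: xiS hom_def)
  have "\<exists>a'\<in>?T. w * tmap S (e k) = a' * (tmap R gexp + tmap R hexp)"
  proof (rule coprime_division[where y = ?y and W = "tmap S (e i) ^ m"])
    show "graded ?T ?y" unfolding y by (rule graded_torus[OF F2 \<eta>(1)])
    show "tmap R gexp \<in> hom ?y (2 * lam R \<eta> gexp)" "tmap R hexp \<in> hom ?y (2 * lam R \<eta> hexp)"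
      using \<eta> by (auto intro: tmap_hom[OF FR])
    have "lam R \<eta> c = lam R \<eta> (pos_part c) - lam R \<eta> (pos_part (- c))"
      using \<eta> lam_diff_right[OF FR, of "pos_part c" "pos_part (- c)" \<eta>] by (simp add: pos_part_diff)
    then show "2 * lam R \<eta> gexp \<noteq> 2 * lam R \<eta> hexp"
      using \<eta> by (simp add: gexp_def hexp_def lam_simps[OF FR])
    show "tmap S (e i) ^ m \<in> hom ?y (2 * lam R \<eta> (int m \<cdot>\<^sub>v e i))"
      unfolding xi using \<eta> by (intro tmap_hom[OF FR]) auto
    show "tmap S (e i) ^ m \<in> ?T" using xi_in by (intro qalgD(4)[OF q])
    show "(tmap R gexp + tmap R hexp) * tmap S (e i) ^ m =
        sc (2 * lam S (e k) (int m \<cdot>\<^sub>v e i)) (tmap S (e i) ^ m * (tmap R gexp + tmap R hexp))"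
      using comm by (simp add: xk_eq)
    have "w * tmap S (e k) * tmap S (e i) ^ m =
        sc (2 * lam S (e k) (int m \<cdot>\<^sub>v e i)) (w * tmap S (e i) ^ m) * tmap S (e k)"
      using comm by (simp add: mult.assoc)
    then show "w * tmap S (e k) * tmap S (e i) ^ m =
        sc (2 * lam S (e k) (int m \<cdot>\<^sub>v e i)) (w * tmap S (e i) ^ m) * (tmap R gexp + tmap R hexp)"
      by (simp only: xk_eq)
    show "sc (2 * lam S (e k) (int m \<cdot>\<^sub>v e i)) (w * tmap S (e i) ^ m) \<in> ?T"
      by (intro qclosedD(3)[OF qalgD(1)[OF q]] assms)
  qed (use q gi hx assms \<eta> tmap_nonzero[OF FR] tmap_nonzero[OF FS] in auto)
  then obtain a' where "a' \<in> ?T" "w * tmap S (e k) = a' * tmap S (e k)" by (auto simp: xk_eq)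
  then show ?thesis using tmap_nonzero[OF FS, of "e k"] by simp
qed

text \<open>The powers of x_k are cancelled one at a time; the power of x_i stays available at each
  stage because x_k itself lies in the last torus.\<close>

lemma rank_two_nonneg:
  assumes u: "u \<in> torus S" "u \<in> torus Si" "u \<in> torus R"
  shows "u \<in> torus S2"
proof -
  note [simp] = r2_simps
  note FS = r2_simps(12) and q = qalg_torus[OF r2_simps(15)]
  let ?T = "torus S2" and ?x = "tmap S (e k)" and ?z = "tmap S (e i)"
  from ex_xk_power_in[OF u(1,2)] obtain n where n: "u * ?x ^ n \<in> ?T" by blast
  from ex_power_in_mut_torus[OF S2 u(3)] obtain m where m: "u * ?z ^ m \<in> ?T" by (auto simp: r2_units)
  have "u * ?x ^ r \<in> ?T \<Longrightarrow> u \<in> ?T" for r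
  proof (induction r)
    case (Suc r)
    have xz: "?x ^ r * ?z ^ m = sc (2 * lam S (int r \<cdot>\<^sub>v e k) (int m \<cdot>\<^sub>v e i)) (?z ^ m * ?x ^ r)"
      using tmap_hom[OF FS, of "int m \<cdot>\<^sub>v e i" "int r \<cdot>\<^sub>v e k"] by (simp add: tmap_power[OF FS] hom_def)
    have "u * ?x ^ r * ?z ^ m = sc (2 * lam S (int r \<cdot>\<^sub>v e k) (int m \<cdot>\<^sub>v e i)) (u * ?z ^ m * ?x ^ r)"
      by (simp add: mult.assoc xz)
    also have "\<dots> \<in> ?T" using qclosedD(3)[OF qalgD(1)[OF q] qalgD(3)[OF q m qalgD(4)[OF q xk_in]]] .
    finally have "u * ?x ^ r * ?z ^ m \<in> ?T" .
    moreover have "u * ?x ^ r * ?x \<in> ?T" using Suc.prems by (simp add: mult.assoc power_commutes)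
    ultimately have "u * ?x ^ r \<in> ?T" by (rule cancel_xk[rotated])
    then show ?case by (rule Suc.IH)
  qed simp
  with n show ?thesis by blast
qed

end

text \<open>The exchange relation is symmetric in its two terms, so all three columns can be negated
  together. This reduces b_k < 0 to b_k \<ge> 0.\<close>

lemma rank_two:
  assumes Si: "mrel i b d S Si" and R: "mrel k c dk S R" and S2: "mrel i \<beta> d' R S2"
    and ik: "i \<noteq> k" and ci: "c $ i = - (b $ k)"
    and \<beta>: "\<And>j. j < N \<Longrightarrow> \<beta> $ j = (if j = k then - (b $ k) else b $ j + (\<bar>c $ j\<bar> * b $ k + c $ j * \<bar>b $ k\<bar>) div 2)"
    and u: "u \<in> torus S" "u \<in> torus Si" "u \<in> torus R"
  shows "u \<in> torus S2"
proof -
  have dims: "i < N" "k < N" "dim_vec b = N" "dim_vec c = N" "dim_vec \<beta> = N" "c $ k = 0"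
    using mrel_mdataD[OF Si] mrel_mdataD[OF R] mrel_mdataD[OF S2] by auto
  have half: "(\<bar>x\<bar> * n + x * n) div 2 = n * max x 0" for x n :: int
    by (cases "x \<ge> 0") (auto simp: max_def)
  have half': "(\<bar>x\<bar> * n - x * n) div 2 = - (- n * max (- x) 0)" for x n :: int
  proof -
    have "\<bar>x\<bar> * n - x * n = 2 * (n * max (- x) 0)" by (cases "x \<ge> 0") (auto simp: max_def)
    then show ?thesis by simp
  qed
  show ?thesis
  proof (cases "b $ k \<ge> 0")
    case True
    show ?thesis
    proof (rule rank_two_nonneg[OF Si R S2 ik True ci _ u])
      fix j assume "j < N"
      from \<beta>[OF this] True dims show "\<beta> $ j = b $ j - (if j = k then 2 * b $ k else 0) + b $ k * max (c $ j) 0"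
        by (auto simp: half)
    qed
  next
    case False
    show ?thesis
    proof (rule rank_two_nonneg[OF mrel_flip[OF Si] mrel_flip[OF R] mrel_flip[OF S2] ik _ _ _ u])
      fix j assume "j < N"
      from \<beta>[OF this] False dims \<open>j < N\<close>
      show "(- \<beta>) $ j = (- b) $ j - (if j = k then 2 * (- b) $ k else 0) + (- b) $ k * max ((- c) $ j) 0"
        by (auto simp: half')
    qed (use False dims ci in auto)
  qed
qed

end

section \<open>Mutation of quantum seeds\<close>

text \<open>If v^k = 1, the Laurent polynomial q^(k/2) - 1 annihilates the monomial M(0), so
  freeness forces it to vanish.\<close>

lemma (in Zq_algebra) quantum_seed_not_root_of_unity:
  assumes "quantum_seed v N S" "v powi k = 1"
  shows "k = 0"
proof -
  let ?m = "tmap S (0\<^sub>v N)" and ?u = "Poly_Mapping.single k 1 - (1 :: Zq)"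
  have ind: "independent (tmap S ` carrier_vec N)"
    using assms(1) by (simp add: quantum_seed_def)
  have "Zq_eval v ?u + Zq_eval v 1 = Zq_eval v (Poly_Mapping.single k 1)"
    by (simp only: Zq_eval_add[symmetric]) simp
  then have "Zq_eval v ?u = 0" using assms(2) by simp
  then have "(\<Sum>w\<in>{?m}. Zq_scale v ?u w) = 0" by (simp add: Zq_scale_def)
  from independentD[OF ind _ _ this, of ?m] have "?u = 0" by auto
  then have "Poly_Mapping.lookup (Poly_Mapping.single k (1::int)) k = Poly_Mapping.lookup (1 :: Zq) k"
    by simp
  then show ?thesis by (auto simp: lookup_one when_def split: if_splits)
qed

section \<open>Mutation and permutation of integer matrices, and principal parts\<close>

lemma mutation_term:
  "(\<bar>x\<bar> * y + x * \<bar>y\<bar>) div 2 = (if x > 0 \<and> y > 0 then x * y else if x < 0 \<and> y < 0 then - x * y else (0::int))"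
  by (cases "x > 0"; cases "y > 0"; cases "x = 0"; cases "y = 0") auto

lemma mutation_term_antisym:
  "(\<bar>- y\<bar> * - x + - y * \<bar>- x\<bar>) div 2 = - ((\<bar>x\<bar> * y + x * \<bar>y\<bar>) div (2::int))"
  unfolding mutation_term by auto

lemma mutate_mat_index:
  "j < dim_row B \<Longrightarrow> k < dim_col B \<Longrightarrow> mutate_mat i B $$ (j, k) =
    (if i = j \<or> i = k then - B $$ (j, k)
     else B $$ (j, k) + (\<bar>B $$ (j, i)\<bar> * B $$ (i, k) + B $$ (j, i) * \<bar>B $$ (i, k)\<bar>) div 2)"
  by (simp add: mutate_mat_def)

lemma mutate_mat_dim [simp]: "dim_row (mutate_mat i B) = dim_row B" "dim_col (mutate_mat i B) = dim_col B"
  by (simp_all add: mutate_mat_def)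

lemma mutate_mat_carrier [simp]: "B \<in> carrier_mat n m \<Longrightarrow> mutate_mat i B \<in> carrier_mat n m"
  by (intro carrier_matI) auto

lemma mutate_mat_involution:
  assumes "B \<in> carrier_mat n n" "i < n" "B $$ (i, i) = 0"
  shows "mutate_mat i (mutate_mat i B) = B"
  by (rule eq_matI) (use assms in \<open>auto simp: mutate_mat_index mutation_term\<close>)

lemma permute_mat_index: "j < dim_row B \<Longrightarrow> k < dim_col B \<Longrightarrow> permute_mat p B $$ (j, k) = B $$ (p j, p k)"
  by (simp add: permute_mat_def)

lemma permute_mat_dim [simp]: "dim_row (permute_mat p B) = dim_row B" "dim_col (permute_mat p B) = dim_col B"
  by (simp_all add: permute_mat_def)

lemma permute_mat_carrier [simp]: "B \<in> carrier_mat n m \<Longrightarrow> permute_mat p B \<in> carrier_mat n m"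
  by (intro carrier_matI) auto

lemma permute_mat_inv:
  assumes "B \<in> carrier_mat n n" "p permutes {..<n}"
  shows "permute_mat (inv_into UNIV p) (permute_mat p B) = B" "permute_mat p (permute_mat (inv_into UNIV p) B) = B"
proof -
  have "p j < n" "inv_into UNIV p j < n" if "j < n" for j
    using assms(2) permutes_inv[OF assms(2)] that permutes_in_image lessThan_iff by metis+
  then show "permute_mat (inv_into UNIV p) (permute_mat p B) = B" "permute_mat p (permute_mat (inv_into UNIV p) B) = B"
    using assms by (auto intro!: eq_matI simp: permute_mat_index permutes_inverses[OF assms(2)])
qed

lemma skew_symmetric_iff:
  assumes "A \<in> carrier_mat n n"
  shows "skew_symmetric A \<longleftrightarrow> (\<forall>j<n. \<forall>k<n. A $$ (j, k) = - A $$ (k, j))"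
proof
  assume "skew_symmetric A"
  then have t: "transpose_mat A = - A" by (simp add: skew_symmetric_def)
  have "A $$ (j, k) = - A $$ (k, j)" if "j < n" "k < n" for j k
  proof -
    have "A $$ (j, k) = transpose_mat A $$ (k, j)" using that assms by simp
    also have "\<dots> = - A $$ (k, j)" unfolding t using that assms by simp
    finally show ?thesis .
  qed
  then show "\<forall>j<n. \<forall>k<n. A $$ (j, k) = - A $$ (k, j)" by blast
next
  assume *: "\<forall>j<n. \<forall>k<n. A $$ (j, k) = - A $$ (k, j)"
  have "transpose_mat A = - A"
  proof (rule eq_matI)
    fix j k assume "j < dim_row (- A)" "k < dim_col (- A)"
    with assms have jk: "j < n" "k < n" by auto
    with * have "A $$ (k, j) = - A $$ (j, k)" by blast
    with jk assms show "transpose_mat A $$ (j, k) = (- A) $$ (j, k)" by simp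
  qed (use assms in auto)
  then show "skew_symmetric A" using assms by (auto simp: skew_symmetric_def)
qed

lemma principal_part_carrier:
  assumes "exmat S \<in> carrier_mat N N" "ex S \<subseteq> {..<N}"
  shows "principal_part S \<in> carrier_mat (card (ex S)) (card (ex S))"
proof -
  have "{j. j < N \<and> j \<in> ex S} = ex S" using assms(2) by auto
  then show ?thesis
    using assms by (intro carrier_matI) (auto simp: principal_part_def dim_submatrix)
qed

lemma principal_part_index:
  assumes "exmat S \<in> carrier_mat N N" "ex S \<subseteq> {..<N}" "a < card (ex S)" "b < card (ex S)"
  shows "principal_part S $$ (a, b) = exmat S $$ (pick (ex S) a, pick (ex S) b)"
proof -
  have "{j. j < N \<and> j \<in> ex S} = ex S" using assms(2) by auto
  then show ?thesis
    using assms unfolding principal_part_def by (subst submatrix_index) auto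
qed

lemma pick_surj: "finite E \<Longrightarrow> j \<in> E \<Longrightarrow> \<exists>a<card E. pick E a = j"
proof -
  assume E: "finite E" "j \<in> E"
  have "{a\<in>E. a < j} \<subset> E" using E by auto
  then have "card {a\<in>E. a < j} < card E" using E(1) by (rule psubset_card_mono[rotated])
  then show ?thesis using pick_card_in_set[OF E(2)] by blast
qed

lemma principal_part_skew_iff:
  assumes "exmat S \<in> carrier_mat N N" "ex S \<subseteq> {..<N}"
  shows "skew_symmetric (principal_part S) \<longleftrightarrow>
    (\<forall>j\<in>ex S. \<forall>k\<in>ex S. exmat S $$ (j, k) = - exmat S $$ (k, j))"
proof -
  have f: "finite (ex S)" using assms(2) finite_subset by blast
  note iff = skew_symmetric_iff[OF principal_part_carrier[OF assms]]
  show ?thesis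
  proof
    assume *: "skew_symmetric (principal_part S)"
    show "\<forall>j\<in>ex S. \<forall>k\<in>ex S. exmat S $$ (j, k) = - exmat S $$ (k, j)"
    proof (intro ballI)
      fix j k assume "j \<in> ex S" "k \<in> ex S"
      then obtain a b where ab: "a < card (ex S)" "b < card (ex S)" "j = pick (ex S) a" "k = pick (ex S) b"
        using pick_surj[OF f] by metis
      have "principal_part S $$ (a, b) = - principal_part S $$ (b, a)"
        using * ab(1,2) unfolding iff by blast
      then show "exmat S $$ (j, k) = - exmat S $$ (k, j)"
        by (simp add: principal_part_index[OF assms] ab)
    qed
  next
    assume "\<forall>j\<in>ex S. \<forall>k\<in>ex S. exmat S $$ (j, k) = - exmat S $$ (k, j)"
    then have *: "exmat S $$ (pick (ex S) a, pick (ex S) b) = - exmat S $$ (pick (ex S) b, pick (ex S) a)"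
      if "a < card (ex S)" "b < card (ex S)" for a b
      using that pick_in_set_le by blast
    have "principal_part S $$ (a, b) = - principal_part S $$ (b, a)" if "a < card (ex S)" "b < card (ex S)" for a b
      unfolding principal_part_index[OF assms that] principal_part_index[OF assms that(2,1)] by (rule *[OF that])
    then show "skew_symmetric (principal_part S)"
      unfolding iff by blast
  qed
qed

context quantum_base
begin

section \<open>Quantum seeds as frames with compatible columns and free monomials\<close>

definition bcol :: "'f seed \<Rightarrow> nat \<Rightarrow> int vec" where
  "bcol S k = col (exmat S) k"

definition compatible :: "'f seed \<Rightarrow> bool" where
  "compatible S \<longleftrightarrow> (\<forall>k\<in>ex S. \<exists>d>0. \<forall>\<alpha>\<in>V. lam S \<alpha> (bcol S k) = \<alpha> $ k * d)"

lemma bcol_carrier [simp]: "exmat S \<in> carrier_mat N N \<Longrightarrow> bcol S k \<in> V"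
  by (auto simp: bcol_def)

lemma dim_bcol [simp]: "dim_vec (bcol S k) = dim_row (exmat S)"
  by (simp add: bcol_def)

lemma bcol_index: "exmat S \<in> carrier_mat N N \<Longrightarrow> k < N \<Longrightarrow> j < N \<Longrightarrow> bcol S k $ j = exmat S $$ (j, k)"
  by (auto simp: bcol_def)

lemma compatible_iff:
  assumes C: "cmat S \<in> carrier_mat N N" and B: "exmat S \<in> carrier_mat N N" and E: "ex S \<subseteq> {..<N}"
    and z: "\<forall>j < N. \<forall>k < N. k \<notin> ex S \<longrightarrow> exmat S $$ (j, k) = 0"
  shows "(\<exists>D \<in> carrier_mat N N. diagonal_mat D \<and> (\<forall>j < N. D $$ (j, j) > 0) \<and>
        cmat S * exmat S = D * incl_mat N (ex S)) \<longleftrightarrow> compatible S" (is "?L \<longleftrightarrow> _")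
proof -
  have I: "(D * incl_mat N (ex S)) $$ (j, k) = (if k \<in> ex S \<and> j = k then D $$ (k, k) else 0)"
    if "D \<in> carrier_mat N N" "diagonal_mat D" "j < N" "k < N" for D j k
  proof -
    have "(D * incl_mat N (ex S)) $$ (j, k) = (\<Sum>l<N. D $$ (j, l) * incl_mat N (ex S) $$ (l, k))"
      using that by (simp add: incl_mat_def scalar_prod_def lessThan_atLeast0)
    also have "\<dots> = (\<Sum>l<N. if l = k then (if k \<in> ex S then D $$ (j, k) else 0) else 0)"
      using that by (intro sum.cong) (auto simp: incl_mat_def)
    also have "\<dots> = (if k \<in> ex S \<and> j = k then D $$ (k, k) else 0)"
      using that by (auto simp: diagonal_mat_def)
    finally show ?thesis .
  qed
  have L: "lam S \<alpha> (bcol S k) = \<alpha> \<bullet> col (cmat S * exmat S) k" if "k < N" for \<alpha> k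
    unfolding lam_def bcol_def by (subst col_mult2[OF C B that]) (rule refl)
  have Le: "(cmat S * exmat S) $$ (j, k) = lam S (e j) (bcol S k)" if "j < N" "k < N" for j k
    using that C B by (simp add: L)
  show ?thesis
  proof
    assume ?L
    then obtain D where D: "D \<in> carrier_mat N N" "diagonal_mat D" "\<And>j. j < N \<Longrightarrow> D $$ (j, j) > 0"
        "cmat S * exmat S = D * incl_mat N (ex S)" by blast
    show "compatible S"
      unfolding compatible_def
    proof (rule ballI)
      fix k assume k: "k \<in> ex S"
      with E have kN: "k < N" by auto
      have "lam S \<alpha> (bcol S k) = \<alpha> $ k * D $$ (k, k)" if \<alpha>: "\<alpha> \<in> V" for \<alpha>
      proof -
      have "lam S \<alpha> (bcol S k) = (\<Sum>j<N. \<alpha> $ j * (D * incl_mat N (ex S)) $$ (j, k))"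
        using kN D(1) \<alpha> by (simp add: L D(4) scalar_prod_def incl_mat_def lessThan_atLeast0)
      also have "\<dots> = (\<Sum>j<N. if j = k then \<alpha> $ k * D $$ (k, k) else 0)"
        using kN k by (intro sum.cong) (auto simp: I D)
      finally show ?thesis using kN by simp
      qed
      with D(3)[OF kN] show "\<exists>d>0. \<forall>\<alpha>\<in>V. lam S \<alpha> (bcol S k) = \<alpha> $ k * d" by blast
    qed
  next
    assume "compatible S"
    then obtain d where d: "\<And>k. k \<in> ex S \<Longrightarrow> d k > 0" "\<And>k \<alpha>. k \<in> ex S \<Longrightarrow> \<alpha> \<in> V \<Longrightarrow> lam S \<alpha> (bcol S k) = \<alpha> $ k * d k"
      unfolding compatible_def by metis
    \<comment> \<open>At indices outside \<open>ex S\<close> the inclusion matrix has a zero column,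
      so any positive diagonal entry will do; 1 is taken.\<close>
    define D where "D = mat N N (\<lambda>(j, k). if j = k then if k \<in> ex S then d k else 1 else 0)"
    have D: "D \<in> carrier_mat N N" "diagonal_mat D" "\<And>j. j < N \<Longrightarrow> D $$ (j, j) > 0"
      using d by (auto simp: D_def diagonal_mat_def)
    have "cmat S * exmat S = D * incl_mat N (ex S)"
    proof (rule eq_matI)
      fix j k assume "j < dim_row (D * incl_mat N (ex S))" "k < dim_col (D * incl_mat N (ex S))"
      then have jk: "j < N" "k < N" by (auto simp: D_def incl_mat_def)
      show "(cmat S * exmat S) $$ (j, k) = (D * incl_mat N (ex S)) $$ (j, k)"
      proof (cases "k \<in> ex S")
        case True
        then show ?thesis using jk D d by (simp add: Le I) (simp add: D_def)
      next
        case False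
        have "(cmat S * exmat S) $$ (j, k) = (\<Sum>l<N. cmat S $$ (j, l) * exmat S $$ (l, k))"
          using jk C B by (simp add: scalar_prod_def lessThan_atLeast0)
        also have "\<dots> = 0" using False z jk by (intro sum.neutral) auto
        finally show ?thesis using jk D False by (simp add: I)
      qed
    qed (use C B in \<open>auto simp: D_def incl_mat_def\<close>)
    with D show ?L by blast
  qed
qed

text \<open>Relations are indexed by exponents instead of by monomials, so that injectivity of M is
  included and sums can be split according to a coordinate of the exponent.\<close>

definition monomials_free :: "'f seed \<Rightarrow> bool" where
  "monomials_free S \<longleftrightarrow> (\<forall>F c. finite F \<longrightarrow> F \<subseteq> V \<longrightarrow> (\<Sum>\<alpha>\<in>F. Zq_scale v (c \<alpha>) (tmap S \<alpha>)) = 0 \<longrightarrow> (\<forall>\<alpha>\<in>F. c \<alpha> = 0))"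

lemma monomials_freeD:
  assumes "monomials_free S" "finite F" "F \<subseteq> V" "(\<Sum>\<alpha>\<in>F. Zq_scale v (c \<alpha>) (tmap S \<alpha>)) = 0" "\<alpha> \<in> F"
  shows "c \<alpha> = 0"
  using assms(1)[unfolded monomials_free_def, rule_format, OF assms(2-5)] .

lemma monomials_free_iff:
  "monomials_free S \<longleftrightarrow> inj_on (tmap S) V \<and> independent (tmap S ` V)"
proof
  assume m: "monomials_free S"
  have inj: "inj_on (tmap S) V"
  proof (rule inj_onI, rule ccontr)
    fix \<alpha> \<beta> assume *: "\<alpha> \<in> V" "\<beta> \<in> V" "tmap S \<alpha> = tmap S \<beta>" "\<alpha> \<noteq> \<beta>"
    let ?c = "\<lambda>\<gamma>. if \<gamma> = \<alpha> then (1 :: Zq) else - 1"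
    have "(\<Sum>\<gamma>\<in>{\<alpha>, \<beta>}. Zq_scale v (?c \<gamma>) (tmap S \<gamma>)) = 0"
      using * by simp
    then have "?c \<alpha> = 0" by (rule monomials_freeD[OF m, rotated 2]) (use * in auto)
    then show False by simp
  qed
  moreover have "independent (tmap S ` V)"
  proof
    assume "dependent (tmap S ` V)"
    then obtain t u w where t: "finite t" "t \<subseteq> tmap S ` V" "(\<Sum>w\<in>t. Zq_scale v (u w) w) = 0" "w \<in> t" "u w \<noteq> 0"
      unfolding dependent_explicit by (elim exE conjE bexE) (rule that)
    obtain F where F: "F \<subseteq> V" "finite F" "t = tmap S ` F"
      using finite_subset_image[OF t(1,2)] by blast
    have "inj_on (tmap S) F" using inj F(1) inj_on_subset by blast
    then have "(\<Sum>\<alpha>\<in>F. Zq_scale v (u (tmap S \<alpha>)) (tmap S \<alpha>)) = 0"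
      using t(3) by (simp add: F(3) sum.reindex)
    then have "u (tmap S \<alpha>) = 0" if "\<alpha> \<in> F" for \<alpha>
      by (rule monomials_freeD[where c = "\<lambda>\<alpha>. u (tmap S \<alpha>)", OF m F(2,1) _ that])
    with t F show False by auto
  qed
  ultimately show "inj_on (tmap S) V \<and> independent (tmap S ` V)" ..
next
  assume *: "inj_on (tmap S) V \<and> independent (tmap S ` V)"
  show "monomials_free S"
    unfolding monomials_free_def
  proof (intro allI impI ballI)
    fix F c \<alpha> assume F: "finite F" "F \<subseteq> V" "(\<Sum>\<alpha>\<in>F. Zq_scale v (c \<alpha>) (tmap S \<alpha>)) = 0" "\<alpha> \<in> F"
    have inj: "inj_on (tmap S) F" using * F(2) inj_on_subset by blast
    have "(\<Sum>w\<in>tmap S ` F. Zq_scale v (c (inv_into F (tmap S) w)) w) = 0"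
      using F(3) inj by (simp add: sum.reindex)
    then have "c (inv_into F (tmap S) (tmap S \<alpha>)) = 0"
      by (rule independentD[OF conjunct2[OF *], rotated 2]) (use F in auto)
    then show "c \<alpha> = 0" using inj F(4) by simp
  qed
qed

definition torus_fractions :: "'f seed \<Rightarrow> bool" where
  "torus_fractions S \<longleftrightarrow> (\<forall>x. \<exists>a\<in>torus S. \<exists>b\<in>torus S. b \<noteq> 0 \<and> x = a / b)"

lemma quantum_seed_iff:
  "qseed S \<longleftrightarrow> ex S \<subseteq> {..<N} \<and> exmat S \<in> carrier_mat N N \<and>
     (\<forall>j < N. \<forall>k < N. k \<notin> ex S \<longrightarrow> exmat S $$ (j, k) = 0) \<and>
     (\<forall>j\<in>ex S. \<forall>k\<in>ex S. exmat S $$ (j, k) = - exmat S $$ (k, j)) \<and>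
     frame S \<and> compatible S \<and> monomials_free S \<and> torus_fractions S"
proof (cases "ex S \<subseteq> {..<N} \<and> exmat S \<in> carrier_mat N N \<and>
     (\<forall>j < N. \<forall>k < N. k \<notin> ex S \<longrightarrow> exmat S $$ (j, k) = 0) \<and> cmat S \<in> carrier_mat N N")
  case True
  then have 1: "(\<exists>D \<in> carrier_mat N N. diagonal_mat D \<and> (\<forall>j < N. D $$ (j, j) > 0) \<and>
        cmat S * exmat S = D * incl_mat N (ex S)) = compatible S"
    by (intro compatible_iff) auto
  have 2: "skew_symmetric (principal_part S) =
      (\<forall>j\<in>ex S. \<forall>k\<in>ex S. exmat S $$ (j, k) = - exmat S $$ (k, j))"
    using True by (intro principal_part_skew_iff) auto
  show ?thesis
    unfolding quantum_seed_def 1 2 monomials_free_iff torus_fractions_def frame_def sc_def lam_def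
    by argo
next
  case False
  then show ?thesis unfolding quantum_seed_def frame_def by argo
qed

lemma quantum_seedD:
  assumes "qseed S"
  shows "ex S \<subseteq> {..<N}" "exmat S \<in> carrier_mat N N" "finite (ex S)"
    "j < N \<Longrightarrow> k < N \<Longrightarrow> k \<notin> ex S \<Longrightarrow> exmat S $$ (j, k) = 0"
    "j \<in> ex S \<Longrightarrow> k \<in> ex S \<Longrightarrow> exmat S $$ (j, k) = - exmat S $$ (k, j)"
    "frame S" "compatible S" "monomials_free S" "torus_fractions S"
    "j \<in> ex S \<Longrightarrow> exmat S $$ (j, j) = 0" "j \<in> ex S \<Longrightarrow> j < N" "bcol S j \<in> V"
    "skew_symmetric (principal_part S)"
    "principal_part S \<in> carrier_mat (card (ex S)) (card (ex S))"
proof -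
  show *: "ex S \<subseteq> {..<N}" "exmat S \<in> carrier_mat N N" 
    "j < N \<Longrightarrow> k < N \<Longrightarrow> k \<notin> ex S \<Longrightarrow> exmat S $$ (j, k) = 0"
    "j \<in> ex S \<Longrightarrow> k \<in> ex S \<Longrightarrow> exmat S $$ (j, k) = - exmat S $$ (k, j)"
    "frame S" "compatible S" "monomials_free S" "torus_fractions S"
    using assms unfolding quantum_seed_iff by blast+
  show "finite (ex S)" using *(1) finite_subset by blast
  have "exmat S $$ (j, j) = - exmat S $$ (j, j)" if "j \<in> ex S" for j
    using assms that unfolding quantum_seed_iff by blast
  then show "j \<in> ex S \<Longrightarrow> exmat S $$ (j, j) = 0" by fastforce
  show "j \<in> ex S \<Longrightarrow> j < N" using * by auto
  show "bcol S j \<in> V" using * by simp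
  show "skew_symmetric (principal_part S)" using assms by (simp add: quantum_seed_def)
  show "principal_part S \<in> carrier_mat (card (ex S)) (card (ex S))"
    using principal_part_carrier *(1,2) by blast
qed

lemma quantum_seed_mdata:
  assumes S: "qseed S" and i: "i \<in> ex S"
  shows "\<exists>d>0. mdata i (bcol S i) d S"
proof -
  obtain d where "d > 0" "\<forall>\<alpha>\<in>V. lam S \<alpha> (bcol S i) = \<alpha> $ i * d"
    using quantum_seedD(7)[OF S] i unfolding compatible_def by blast
  then show ?thesis
    using quantum_seedD(2,6,10,11,12)[OF S] i by (intro exI[of _ d]) (auto simp: mdata_def bcol_index)
qed

lemma seed_mutation_iff:
  "seed_mutation v N i S S' \<longleftrightarrow> qseed S \<and> qseed S' \<and> i \<in> ex S \<and>
     ex S' = ex S \<and> exmat S' = mutate_mat i (exmat S) \<and> (\<exists>d>0. mrel i (bcol S i) d S S')"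
proof (cases "qseed S \<and> qseed S' \<and> i \<in> ex S")
  case True
  then have S: "qseed S" "qseed S'" "i \<in> ex S" by auto
  have B: "exmat S \<in> carrier_mat N N" "i < N" using quantum_seedD(2,11)[OF S(1)] S(3) by auto
  have 1: "vec N (\<lambda>j. if exmat S $$ (j, i) > 0 then exmat S $$ (j, i) else 0) = pos_part (bcol S i)"
    using B by (intro eq_vecI) (auto simp: pos_part_def bcol_def)
  have 2: "- e i - vec N (\<lambda>j. if exmat S $$ (j, i) < 0 then exmat S $$ (j, i) else 0) = - e i + pos_part (- bcol S i)"
    using B by (intro eq_vecI) (auto simp: pos_part_def bcol_def)
  show ?thesis
    using quantum_seed_mdata[OF S(1,3)] quantum_seedD(6)[OF S(2)] S
    unfolding seed_mutation_def mrel_def 1 2 mvar_def by blast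
qed (auto simp: seed_mutation_def)

lemma bcol_mutate_same:
  assumes "qseed S" "i \<in> ex S" "exmat S' = mutate_mat i (exmat S)"
  shows "bcol S' i = - bcol S i"
  using quantum_seedD(2,11)[OF assms(1)] assms(2,3)
  by (intro eq_vecI) (auto simp: bcol_def mutate_mat_index)

text \<open>Conjugation by M'(b) splits a relation according to the i-exponent. Within i-exponent n
  all terms share the right factor given by the n-th power of the new variable; cancelling it leaves
  a relation between monomials of S.\<close>

lemma monomials_free_mutate:
  assumes mr: "mrel i b d S S'" and fr: "monomials_free S"
  shows "monomials_free S'"
  unfolding monomials_free_def
proof (intro allI impI)
  fix F c assume F: "finite F" "F \<subseteq> V" "(\<Sum>\<alpha>\<in>F. Zq_scale v (c \<alpha>) (tmap S' \<alpha>)) = 0"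
  note md = mrel_mdataD[OF mr] and F' = mrelD(2)[OF mr]
  define y where "y = tmap S' b"
  have y: "y \<noteq> 0" using tmap_nonzero[OF F'] md by (simp add: y_def)
  have hm: "Zq_scale v k (tmap S' \<alpha>) \<in> hom y (2 * d * (\<alpha> $ i))" if "\<alpha> \<in> V" for \<alpha> k
    using tmap_hom[OF F' that md(3)] lam_skew[OF F' md(3) that] mdataD(6)[OF mrel_mdata_back[OF mr] that]
    by (intro qclosed_Zq_scale qclosed_hom) (simp add: y_def mult.commute mult.left_commute)
  define Fn where "Fn n = {\<alpha>\<in>F. \<alpha> $ i = n}" for n
  have s: "(\<Sum>n\<in>(\<lambda>\<alpha>. \<alpha> $ i) ` F. \<Sum>\<alpha>\<in>Fn n. Zq_scale v (c \<alpha>) (tmap S' \<alpha>)) = 0"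
    using F(3) sum.image_gen[OF F(1), of "\<lambda>\<alpha>. Zq_scale v (c \<alpha>) (tmap S' \<alpha>)" "\<lambda>\<alpha>. \<alpha> $ i"]
    by (simp add: Fn_def)
  show "\<forall>\<alpha>\<in>F. c \<alpha> = 0"
  proof
    fix \<alpha>0 assume \<alpha>0: "\<alpha>0 \<in> F"
    define n where "n = \<alpha>0 $ i"
    have "(\<Sum>\<alpha>\<in>Fn n. Zq_scale v (c \<alpha>) (tmap S' \<alpha>)) = 0"
    proof (rule hom_independent_int[OF _ y _ _ s])
      fix n show "(\<Sum>\<alpha>\<in>Fn n. Zq_scale v (c \<alpha>) (tmap S' \<alpha>)) \<in> hom y (2 * d * n)"
        using hm F(2) by (intro qclosed_sum qclosed_hom) (auto simp: Fn_def)
    qed (use F md \<alpha>0 in \<open>auto simp: n_def\<close>)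
    moreover have "(\<Sum>\<alpha>\<in>Fn n. Zq_scale v (c \<alpha>) (tmap S' \<alpha>)) =
      (\<Sum>\<alpha>\<in>Fn n. Zq_scale v (c \<alpha>) (sc (- n * lam S (drop_at i \<alpha>) (- e i + pos_part b)) (tmap S (drop_at i \<alpha>)))) * mvar i b S powi n"
      unfolding sum_distrib_right
      by (rule sum.cong) (use F(2) in \<open>auto simp: Fn_def mrel_tmap[OF mr] Zq_scale_def mult.assoc\<close>)
    ultimately have "(\<Sum>\<alpha>\<in>Fn n. Zq_scale v (c \<alpha>) (sc (- n * lam S (drop_at i \<alpha>) (- e i + pos_part b)) (tmap S (drop_at i \<alpha>)))) = 0"
      using mvar_nonzero[OF mrelD(1)[OF mr]] by simp
    \<comment> \<open>Absorbs the normalizing power of \<open>v\<close> into the coefficient. It is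
      a unit of Z_q, so the vanishing of c2 gives that of c.\<close>
    moreover define c2 where "c2 \<gamma> = c (\<gamma> + n \<cdot>\<^sub>v e i) * Poly_Mapping.single (- n * lam S \<gamma> (- e i + pos_part b)) 1" for \<gamma>
    have sp: "drop_at i \<alpha> + n \<cdot>\<^sub>v e i = \<alpha>" if "\<alpha> \<in> Fn n" for \<alpha>
      using that F(2) drop_at_split[of \<alpha> i] md(2) by (auto simp: Fn_def)
    have "Zq_scale v (c2 (drop_at i \<alpha>)) (tmap S (drop_at i \<alpha>)) =
        Zq_scale v (c \<alpha>) (sc (- n * lam S (drop_at i \<alpha>) (- e i + pos_part b)) (tmap S (drop_at i \<alpha>)))" if "\<alpha> \<in> Fn n" for \<alpha>
      using sp[OF that] by (simp add: c2_def Zq_scale_def Zq_eval_mult sc_def mult.assoc)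
    ultimately have "(\<Sum>\<alpha>\<in>Fn n. Zq_scale v (c2 (drop_at i \<alpha>)) (tmap S (drop_at i \<alpha>))) = 0"
      by simp
    moreover have "inj_on (drop_at i) (Fn n)"
      using sp by (metis inj_onI)
    ultimately have "(\<Sum>\<gamma>\<in>drop_at i ` Fn n. Zq_scale v (c2 \<gamma>) (tmap S \<gamma>)) = 0"
      by (simp add: sum.reindex)
    moreover have "finite (drop_at i ` Fn n)" "drop_at i ` Fn n \<subseteq> V"
      using F by (auto simp: Fn_def)
    moreover have "drop_at i \<alpha>0 \<in> drop_at i ` Fn n" using \<alpha>0 by (auto simp: Fn_def n_def)
    ultimately have "c2 (drop_at i \<alpha>0) = 0" by (intro monomials_freeD[where c = c2, OF fr])
    then have "c \<alpha>0 * Poly_Mapping.single (- n * lam S (drop_at i \<alpha>0) (- e i + pos_part b)) 1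
        * Poly_Mapping.single (n * lam S (drop_at i \<alpha>0) (- e i + pos_part b)) 1 = 0"
      using sp[of \<alpha>0] \<alpha>0 by (simp add: c2_def Fn_def n_def)
    then show "c \<alpha>0 = 0" by (simp add: mult.assoc mult_single)
  qed
qed

text \<open>A right fraction is unchanged when numerator and denominator are multiplied on the right
  by the same power of x_i, and a high power moves both into the mutated torus.\<close>

lemma torus_fractions_mutate:
  assumes mr: "mrel i b d S S'" and fr: "torus_fractions S"
  shows "torus_fractions S'"
  unfolding torus_fractions_def
proof
  fix x
  let ?z = "tmap S (e i)"
  obtain a c where ac: "a \<in> torus S" "c \<in> torus S" "c \<noteq> 0" "x = a / c"
    using fr unfolding torus_fractions_def by blast
  obtain n n' where "\<forall>m\<ge>n. a * ?z ^ m \<in> torus S'" "\<forall>m\<ge>n'. c * ?z ^ m \<in> torus S'"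
    using ex_power_in_mut_torus[OF mr] ac by metis
  then have m: "a * ?z ^ max n n' \<in> torus S'" "c * ?z ^ max n n' \<in> torus S'"
    by auto
  have z: "?z ^ max n n' \<noteq> 0" using tmap_nonzero[OF mrel_mdataD(1)[OF mr], of "e i"] by simp
  have "x = (a * ?z ^ max n n') / (c * ?z ^ max n n')"
    using ac z by (simp add: divide_inverse nonzero_inverse_mult_distrib mult.assoc)
      (simp flip: mult.assoc add: z)
  with m ac z show "\<exists>a\<in>torus S'. \<exists>b\<in>torus S'. b \<noteq> 0 \<and> x = a / b"
    by (intro bexI[OF _ m(1)] bexI[OF _ m(2)]) auto
qed

text \<open>The diagonal entries are the same before and after mutation. For k \<noteq> i the new
  column, carried to the lattice of S by \<open>mut_lattice\<close>, is b_k plus a multiple of b_i,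
  so its pairing follows from those of b_k and b_i.\<close>

lemma compatible_mutate:
  assumes S: "qseed S" and i: "i \<in> ex S" and mr: "mrel i (bcol S i) d S S'"
    and S': "ex S' = ex S" "exmat S' = mutate_mat i (exmat S)" and d: "d > 0"
  shows "compatible S'"
  unfolding compatible_def
proof
  fix k assume "k \<in> ex S'"
  then have k: "k \<in> ex S" by (simp add: S')
  note q = quantum_seedD[OF S] and [simp] = quantum_seedD(2,6,11,12)[OF S] carrier_matD[OF quantum_seedD(2)[OF S]]
  note md = mrel_mdataD[OF mr] and F = quantum_seedD(6)[OF S] and F' = mrelD(2)[OF mr]
  let ?b = "bcol S i"
  have iN: "i < N" and kN: "k < N" using i k by auto
  show "\<exists>d>0. \<forall>\<alpha>\<in>V. lam S' \<alpha> (bcol S' k) = \<alpha> $ k * d"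
  proof (cases "k = i")
    case True
    have "lam S' \<alpha> (bcol S' k) = \<alpha> $ k * d" if "\<alpha> \<in> V" for \<alpha>
      using mdataD(6)[OF mrel_mdata_back[OF mr] that] bcol_mutate_same[OF S i S'(2)] that
      by (simp add: True lam_simps[OF F'])
    then show ?thesis using d by blast
  next
    case False
    obtain dk where dk: "dk > 0" "\<And>\<alpha>. \<alpha> \<in> V \<Longrightarrow> lam S \<alpha> (bcol S k) = \<alpha> $ k * dk"
      using q(7) k unfolding compatible_def by blast
    define y where "y = exmat S $$ (i, k)"
    have yk: "exmat S $$ (k, i) = - y" using q(5)[OF k i] by (simp add: y_def)
    have bk: "bcol S k $ i = y" "?b $ k = - y" using iN kN by (auto simp: bcol_index yk) (simp add: y_def)
    define w where "w = - e i + pos_part ?b"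
    have w: "w \<in> V" "w $ i = -1" "w $ k = max (- y) 0" using iN kN md(4) False bk by (auto simp: w_def md(7))
    define \<beta> where "\<beta> = bcol S' k"
    have \<beta>: "\<beta> \<in> V" by (simp add: \<beta>_def S')
    have \<beta>i: "\<beta> $ i = - y" using iN kN carrier_matD[OF q(2)] by (simp add: \<beta>_def bcol_index S' mutate_mat_index y_def)
    \<comment> \<open>Equivalently, \<beta> without its i-th coordinate plus \<beta>_i w is b_k +
      max(-y, 0) b_i, where w is the first exchange exponent and \<beta>_i = -y.\<close>
    have \<beta>0: "drop_at i \<beta> = bcol S k + (max (- y) 0) \<cdot>\<^sub>v ?b + y \<cdot>\<^sub>v w"
    proof (rule eq_vecI)
      fix j assume "j < dim_vec (bcol S k + (max (- y) 0) \<cdot>\<^sub>v ?b + y \<cdot>\<^sub>v w)"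
      then have j: "j < N" using w by simp
      show "drop_at i \<beta> $ j = (bcol S k + (max (- y) 0) \<cdot>\<^sub>v ?b + y \<cdot>\<^sub>v w) $ j"
      proof (cases "j = i")
        case True
        then show ?thesis using iN \<beta> w md bk by simp
      next
        case ji: False
        define x where "x = exmat S $$ (j, i)"
        have "w $ j = max x 0" using j ji md iN by (simp add: w_def bcol_index x_def)
        moreover have "\<beta> $ j = exmat S $$ (j, k) + (\<bar>x\<bar> * y + x * \<bar>y\<bar>) div 2"
          using j kN ji False carrier_matD[OF q(2)] by (simp add: \<beta>_def bcol_index S' mutate_mat_index x_def y_def)
        ultimately show ?thesis
          using j ji iN kN \<beta> w by (auto simp: bcol_index mutation_term x_def[symmetric] max_def)
      qed
    qed (use \<beta> w in auto)
    \<comment> \<open>Evaluating \<Lambda>(b_i, b_k) in two ways and using the skew-symmetry of the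
      principal part: the diagonal entries at i and k agree whenever y is nonzero.\<close>
    have dd: "y * dk = y * d"
    proof -
      have "lam S ?b (bcol S k) = - lam S (bcol S k) ?b" by (rule lam_skew[OF F]) auto
      then show ?thesis using dk(2)[of ?b] md(6)[of "bcol S k"] bk by simp
    qed
    have lw: "lam S (bcol S k) w = - max (- y) 0 * dk" "lam S ?b w = d"
      using lam_skew[OF F, of "bcol S k" w] lam_skew[OF F, of ?b w] dk(2)[of w] md(6)[of w] w by auto
    have l0: "lam S (drop_at i \<beta>) w = 0"
      unfolding \<beta>0 using w dd by (auto simp: lam_simps[OF F] lw max_def)
    have "lam S' \<alpha> \<beta> = \<alpha> $ k * dk" if \<alpha>: "\<alpha> \<in> V" for \<alpha>
    proof -
      have "lam S (drop_at i \<alpha>) (drop_at i \<beta>) = \<alpha> $ k * dk + y * lam S (drop_at i \<alpha>) w"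
        unfolding \<beta>0 using \<alpha> w False iN kN dk(2)[of "drop_at i \<alpha>"] md(6)[of "drop_at i \<alpha>"]
        by (simp add: lam_simps[OF F])
      then show ?thesis
        using mrel_lam[OF mr \<alpha> \<beta>] by (simp add: w_def[symmetric] l0 \<beta>i)
    qed
    then show ?thesis using dk(1) unfolding \<beta>_def by blast
  qed
qed

text \<open>Mutation is given as a relation between quantum seeds, so existence needs a
  construction. The frame \<open>mut_frame\<close> inherits compatibility, freeness and the fraction
  property from S.\<close>

lemma ex_seed_mutation:
  assumes S: "qseed S" and i: "i \<in> ex S"
  shows "\<exists>S'. seed_mutation v N i S S'"
proof -
  note q = quantum_seedD[OF S]
  obtain d where d: "d > 0" "mdata i (bcol S i) d S" using quantum_seed_mdata[OF S i] by blast
  define S' where "S' = mut_frame i (bcol S i) S"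
  have mr: "mrel i (bcol S i) d S S'" unfolding S'_def by (rule mrel_mut_frame[OF d(2)])
  have S': "ex S' = ex S" "exmat S' = mutate_mat i (exmat S)"
    by (simp_all add: S'_def mut_frame_def[OF d(2)])
  have "qseed S'"
    unfolding quantum_seed_iff
  proof (intro conjI)
    show "compatible S'" by (rule compatible_mutate[OF S i mr S' d(1)])
    show "\<forall>j<N. \<forall>k<N. k \<notin> ex S' \<longrightarrow> exmat S' $$ (j, k) = 0"
      using q(2,4) q(11)[OF i] by (auto simp: S' mutate_mat_index)
    show "\<forall>j\<in>ex S'. \<forall>k\<in>ex S'. exmat S' $$ (j, k) = - exmat S' $$ (k, j)"
    proof (intro ballI)
      fix j k assume "j \<in> ex S'" "k \<in> ex S'"
      then have jk: "j \<in> ex S" "k \<in> ex S" by (auto simp: S')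
      then show "exmat S' $$ (j, k) = - exmat S' $$ (k, j)"
        using q(2) q(11)[OF i] q(11)[OF jk(1)] q(11)[OF jk(2)] q(5)[OF jk]
          mutation_term_antisym[of "exmat S $$ (i, k)" "exmat S $$ (j, i)"]
        by (auto simp: S' mutate_mat_index q(5)[OF i jk(1)] q(5)[OF jk(2) i])
    qed
  qed (use q(1,2,8,9) S' mrelD(2)[OF mr] monomials_free_mutate[OF mr] torus_fractions_mutate[OF mr] in auto)
  then show ?thesis using S i S' mr d(1) unfolding seed_mutation_iff by blast
qed

lemma seed_mutation_sym:
  assumes "seed_mutation v N i S S'"
  shows "seed_mutation v N i S' S"
proof -
  obtain d where *: "qseed S" "qseed S'" "i \<in> ex S" "ex S' = ex S"
      "exmat S' = mutate_mat i (exmat S)" "d > 0" "mrel i (bcol S i) d S S'"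
    using assms[unfolded seed_mutation_iff] by blast
  have "mutate_mat i (exmat S') = exmat S"
    unfolding *(5) by (rule mutate_mat_involution[OF quantum_seedD(2)[OF *(1)] quantum_seedD(11,10)[OF *(1) *(3)]])
  \<comment> \<open>Going back keeps the column and negates d; flipping both signs gives the actual
    column -b of S' together with the positive d.\<close>
  moreover have "mrel i (bcol S' i) d S' S"
    using mrel_flip[OF mrel_back[OF *(7)]] bcol_mutate_same[OF *(1,3,5)] by simp
  ultimately show ?thesis using *(1-4,6) unfolding seed_mutation_iff by metis
qed

end

section \<open>Reordering and the Laurent phenomenon\<close>

context quantum_base
begin

definition pvec :: "(nat \<Rightarrow> nat) \<Rightarrow> int vec \<Rightarrow> int vec" where
  "pvec p \<alpha> = vec N (\<lambda>j. \<alpha> $ p j)"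

lemma pvec_carrier [simp]: "pvec p \<alpha> \<in> V"
  by (simp add: pvec_def)

lemma dim_pvec [simp]: "dim_vec (pvec p \<alpha>) = N"
  by (simp add: pvec_def)

lemma pvec_index [simp]: "j < N \<Longrightarrow> pvec p \<alpha> $ j = \<alpha> $ p j"
  by (simp add: pvec_def)

lemma permutes_less:
  assumes "p permutes {..<N}" "j < N" shows "p j < N" "pinv p j < N"
proof -
  show "p j < N" using permutes_in_image[OF assms(1), of j] assms(2) by simp
  show "pinv p j < N" using permutes_in_image[OF permutes_inv[OF assms(1)], of j] assms(2) by simp
qed

lemma pvec_inv:
  assumes "p permutes {..<N}" "\<alpha> \<in> V"
  shows "pvec (pinv p) (pvec p \<alpha>) = \<alpha>" "pvec p (pvec (pinv p) \<alpha>) = \<alpha>"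
  using assms(2) permutes_less[OF assms(1)] by (auto intro!: eq_vecI simp: permutes_inverses[OF assms(1)])

lemma pvec_add: "p permutes {..<N} \<Longrightarrow> \<alpha> \<in> V \<Longrightarrow> \<beta> \<in> V \<Longrightarrow> pvec p (\<alpha> + \<beta>) = pvec p \<alpha> + pvec p \<beta>"
  using permutes_less(1)[of p] by (intro eq_vecI) auto

lemma lam_sum:
  assumes "cmat S \<in> carrier_mat N N" "\<alpha> \<in> V" "\<beta> \<in> V"
  shows "lam S \<alpha> \<beta> = (\<Sum>j<N. \<Sum>k<N. \<alpha> $ j * cmat S $$ (j, k) * \<beta> $ k)"
  using assms by (auto simp: lam_def scalar_prod_def lessThan_atLeast0 sum_distrib_left mult.assoc intro!: sum.cong)

lemma lam_permute:
  assumes p: "p permutes {..<N}" and C: "cmat S \<in> carrier_mat N N" "cmat S' = permute_mat p (cmat S)"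
    and "\<alpha> \<in> V" "\<beta> \<in> V"
  shows "lam S' (pvec p \<alpha>) (pvec p \<beta>) = lam S \<alpha> \<beta>"
proof -
  have "lam S' (pvec p \<alpha>) (pvec p \<beta>) = (\<Sum>j<N. \<Sum>k<N. \<alpha> $ p j * cmat S $$ (p j, p k) * \<beta> $ p k)"
    using C by (subst lam_sum) (auto simp: permute_mat_index intro!: sum.cong)
  also have "\<dots> = (\<Sum>j<N. \<Sum>k<N. \<alpha> $ p j * cmat S $$ (p j, k) * \<beta> $ k)"
    by (rule sum.cong[OF refl], rule sum.reindex_bij_betw[OF permutes_imp_bij[OF p], of "\<lambda>k. \<alpha> $ p j * cmat S $$ (p j, k) * \<beta> $ k" for j])
  also have "\<dots> = (\<Sum>j<N. \<Sum>k<N. \<alpha> $ j * cmat S $$ (j, k) * \<beta> $ k)"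
    by (rule sum.reindex_bij_betw[OF permutes_imp_bij[OF p]])
  finally show ?thesis using assms by (simp add: lam_sum)
qed

definition reorder :: "(nat \<Rightarrow> nat) \<Rightarrow> 'f seed \<Rightarrow> 'f seed" where
  "reorder p S = S\<lparr>ex := pinv p ` ex S, exmat := permute_mat p (exmat S),
     cmat := permute_mat p (cmat S), tmap := (\<lambda>\<alpha>. tmap S (pvec (pinv p) \<alpha>))\<rparr>"

lemma reorder_simps [simp]:
  "ex (reorder p S) = pinv p ` ex S" "exmat (reorder p S) = permute_mat p (exmat S)"
  "cmat (reorder p S) = permute_mat p (cmat S)" "tmap (reorder p S) \<alpha> = tmap S (pvec (pinv p) \<alpha>)"
  by (simp_all add: reorder_def)

lemma tmap_image_reorder:
  assumes p: "p permutes {..<N}"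
  shows "tmap (reorder p S) ` V = tmap S ` V"
proof -
  have "pvec (pinv p) ` V = V"
  proof
    show "V \<subseteq> pvec (pinv p) ` V"
    proof
      fix \<alpha> :: "int vec" assume "\<alpha> \<in> V"
      then have "\<alpha> = pvec (pinv p) (pvec p \<alpha>)" by (simp add: pvec_inv[OF p])
      then show "\<alpha> \<in> pvec (pinv p) ` V" by (rule image_eqI) simp
    qed
  qed auto
  then have "tmap S ` V = tmap S ` pvec (pinv p) ` V" by simp
  then show ?thesis by (simp add: image_image)
qed

lemma quantum_seed_reorder:
  assumes S: "qseed S" and p: "p permutes {..<N}"
  shows "qseed (reorder p S)"
proof -
  let ?p' = "pinv p"
  note q = quantum_seedD[OF S] and F = quantum_seedD(6)[OF S]
  note C = frame_cmat[OF F]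
  have l: "lam (reorder p S) \<alpha> \<beta> = lam S (pvec ?p' \<alpha>) (pvec ?p' \<beta>)" if "\<alpha> \<in> V" "\<beta> \<in> V" for \<alpha> \<beta>
    using lam_permute[OF p C, of "reorder p S" "pvec ?p' \<alpha>" "pvec ?p' \<beta>"] that by (simp add: pvec_inv[OF p])
  have frame: "frame (reorder p S)"
    unfolding frame_def
  proof (intro conjI ballI)
    have sk: "\<forall>j<N. \<forall>k<N. cmat S $$ (j, k) = - cmat S $$ (k, j)"
      by (rule iffD1[OF skew_symmetric_iff[OF C]]) (use F in \<open>simp add: frame_def\<close>)
    show c: "cmat (reorder p S) \<in> carrier_mat N N" using C by simp
    show "skew_symmetric (cmat (reorder p S))"
      unfolding skew_symmetric_iff[OF c]
    proof (intro allI impI)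
      fix j k assume jk: "j < N" "k < N"
      have "cmat S $$ (p j, p k) = - cmat S $$ (p k, p j)" using sk jk permutes_less[OF p] by blast
      then show "cmat (reorder p S) $$ (j, k) = - cmat (reorder p S) $$ (k, j)"
        using jk C by (simp add: permute_mat_index)
    qed
  next
    fix \<alpha> \<beta> assume "\<alpha> \<in> V" "\<beta> \<in> V"
    then show "tmap (reorder p S) \<alpha> * tmap (reorder p S) \<beta> = sc (lam (reorder p S) \<alpha> \<beta>) (tmap (reorder p S) (\<alpha> + \<beta>))"
      by (simp add: l tmap_mult[OF F] pvec_add[OF permutes_inv[OF p]])
  qed (simp add: tmap_nonzero[OF F])
  show ?thesis
    unfolding quantum_seed_iff
  proof (intro conjI)
    show "ex (reorder p S) \<subseteq> {..<N}" using q(1) permutes_less[OF p] by auto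
    have pe: "p j \<in> ex S \<longleftrightarrow> j \<in> ?p' ` ex S" for j
    proof
      assume "p j \<in> ex S"
      then have "?p' (p j) \<in> ?p' ` ex S" by (rule imageI)
      then show "j \<in> ?p' ` ex S" by (simp add: permutes_inverses[OF p])
    qed (auto simp: permutes_inverses[OF p])
    show "\<forall>j<N. \<forall>k<N. k \<notin> ex (reorder p S) \<longrightarrow> exmat (reorder p S) $$ (j, k) = 0"
      using q(2,4) permutes_less[OF p] pe by (auto simp: permute_mat_index)
    show "\<forall>j\<in>ex (reorder p S). \<forall>k\<in>ex (reorder p S). exmat (reorder p S) $$ (j, k) = - exmat (reorder p S) $$ (k, j)"
    proof (intro ballI)
      fix j k assume "j \<in> ex (reorder p S)" "k \<in> ex (reorder p S)"
      then have "p j \<in> ex S" "p k \<in> ex S" "j < N" "k < N" using pe permutes_less[OF p] q(11) by auto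
      then show "exmat (reorder p S) $$ (j, k) = - exmat (reorder p S) $$ (k, j)"
        using q(5)[of "p j" "p k"] q(2) by (simp add: permute_mat_index)
    qed
    show "compatible (reorder p S)"
      unfolding compatible_def
    proof
      fix k assume "k \<in> ex (reorder p S)"
      then have k: "p k \<in> ex S" "k < N" using pe permutes_less[OF p] q(11) by auto
      obtain d where d: "d > 0" "\<And>\<alpha>. \<alpha> \<in> V \<Longrightarrow> lam S \<alpha> (bcol S (p k)) = \<alpha> $ p k * d"
        using q(7) k unfolding compatible_def by blast
      have "bcol (reorder p S) k = pvec p (bcol S (p k))"
        using q(2) k permutes_less[OF p] by (intro eq_vecI) (auto simp: bcol_def permute_mat_index)
      then have "pvec ?p' (bcol (reorder p S) k) = bcol S (p k)"
        using q(2) by (simp add: pvec_inv[OF p])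
      then have "lam (reorder p S) \<alpha> (bcol (reorder p S) k) = \<alpha> $ k * d" if "\<alpha> \<in> V" for \<alpha>
        using l[OF that, of "bcol (reorder p S) k"] d(2)[of "pvec ?p' \<alpha>"] q(2) k permutes_less[OF p]
        by (simp add: permutes_inverses[OF p])
      with d(1) show "\<exists>d>0. \<forall>\<alpha>\<in>V. lam (reorder p S) \<alpha> (bcol (reorder p S) k) = \<alpha> $ k * d" by blast
    qed
    have "inj_on (tmap S) V" "independent (tmap S ` V)"
      using q(8) by (auto simp: monomials_free_iff)
    moreover have "inj_on (tmap (reorder p S)) V"
    proof (rule inj_onI)
      fix \<alpha> \<beta> assume *: "\<alpha> \<in> V" "\<beta> \<in> V" "tmap (reorder p S) \<alpha> = tmap (reorder p S) \<beta>"
      then have "pvec ?p' \<alpha> = pvec ?p' \<beta>"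
        using \<open>inj_on (tmap S) V\<close> by (auto dest: inj_onD)
      then have "pvec p (pvec ?p' \<alpha>) = pvec p (pvec ?p' \<beta>)" by simp
      then show "\<alpha> = \<beta>" using * by (simp add: pvec_inv[OF p])
    qed
    ultimately show "monomials_free (reorder p S)"
      unfolding monomials_free_iff tmap_image_reorder[OF p] by blast
    show "torus_fractions (reorder p S)"
      using q(9) unfolding torus_fractions_def quantum_torus_def tmap_image_reorder[OF p] .
  qed (use q(2) frame in auto)
qed

lemma seed_reordering_reorder:
  assumes "qseed S" "p permutes {..<N}"
  shows "seed_reordering v N p S (reorder p S)"
proof -
  have "p ` pinv p ` ex S = ex S"
    by (simp add: image_image permutes_inverses[OF assms(2)])
  then show ?thesis
    using assms quantum_seed_reorder[OF assms] pvec_inv(1)[OF assms(2)]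
    by (auto simp: seed_reordering_def pvec_def[symmetric])
qed

lemma seed_reordering_sym:
  assumes "seed_reordering v N p S S'"
  shows "seed_reordering v N (pinv p) S' S"
proof -
  let ?p' = "pinv p"
  have *: "qseed S" "qseed S'" and p: "p permutes {..<N}" and E: "ex S = p ` ex S'"
    and m: "exmat S' = permute_mat p (exmat S)" "cmat S' = permute_mat p (cmat S)"
    and t: "\<And>\<alpha>. \<alpha> \<in> V \<Longrightarrow> tmap S' (pvec p \<alpha>) = tmap S \<alpha>"
    using assms by (auto simp: seed_reordering_def pvec_def)
  have "ex S' = ?p' ` ex S" by (simp add: E image_image permutes_inverses[OF p])
  moreover have "exmat S = permute_mat ?p' (exmat S')" "cmat S = permute_mat ?p' (cmat S')"
    using permute_mat_inv(1)[OF _ p] quantum_seedD(2)[OF *(1)] frame_cmat[OF quantum_seedD(6)[OF *(1)]] m by auto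
  moreover have "tmap S (pvec ?p' \<alpha>) = tmap S' \<alpha>" if "\<alpha> \<in> V" for \<alpha>
    using t[of "pvec ?p' \<alpha>"] that by (simp add: pvec_inv[OF p])
  ultimately show ?thesis
    using * permutes_inv[OF p] by (simp add: seed_reordering_def pvec_def)
qed

section \<open>Mutation equivalence and the invariance of upper bounds\<close>

definition seed_step :: "'f seed \<Rightarrow> 'f seed \<Rightarrow> bool" where
  "seed_step S S' \<longleftrightarrow> (\<exists>i. seed_mutation v N i S S') \<or> (\<exists>p. seed_reordering v N p S S')"

lemma seed_step_sym: "seed_step S S' \<Longrightarrow> seed_step S' S"
  using seed_mutation_sym seed_reordering_sym unfolding seed_step_def by blast

text \<open>Mutations and reorderings can be undone, so the generated equivalence is plain
  reachability and inductions need not treat reversed steps.\<close>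

lemma mutation_equivalent_iff: "mut_equiv S S' \<longleftrightarrow> seed_step\<^sup>*\<^sup>* S S'"
proof -
  have "symp seed_step" using seed_step_sym by (auto intro: sympI)
  then have "symclp seed_step = seed_step" by (auto simp: symclp_def fun_eq_iff dest: sympD)
  then show ?thesis
    unfolding mutation_equivalent_def seed_step_def[symmetric, abs_def] equivclp_def by simp
qed

lemma mutation_equivalent_refl: "mut_equiv S S"
  by (simp add: mutation_equivalent_iff)

lemma mutation_equivalent_trans:
  "mut_equiv S S' \<Longrightarrow> mut_equiv S' S'' \<Longrightarrow> mut_equiv S S''"
  by (simp add: mutation_equivalent_iff)

lemma mutation_equivalent_sym: "mut_equiv S S' \<Longrightarrow> mut_equiv S' S"
  unfolding mutation_equivalent_def by (rule equivclp_sym)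

lemma mutation_equivalent_step:
  "mut_equiv S S' \<Longrightarrow> seed_step S' S'' \<Longrightarrow> mut_equiv S S''"
  by (simp add: mutation_equivalent_iff)

lemma mutation_equivalent_mutation: "seed_mutation v N i S S' \<Longrightarrow> mut_equiv S S'"
  by (rule mutation_equivalent_step[OF mutation_equivalent_refl]) (auto simp: seed_step_def)

lemma mutation_equivalent_seed:
  assumes "mut_equiv S S'" "qseed S"
  shows "qseed S'"
  using assms unfolding mutation_equivalent_iff
  by (induction rule: rtranclp_induct) (auto simp: seed_step_def seed_mutation_def seed_reordering_def)

lemma algebra_cong:
  assumes "mut_equiv S S'"
  shows "cluster_alg S = cluster_alg S'"
    "upper_alg S = upper_alg S'"
proof -
  have *: "mut_equiv S = mut_equiv S'"
    using assms mutation_equivalent_sym mutation_equivalent_trans by (intro ext) blast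
  show "cluster_alg S = cluster_alg S'"
    "upper_alg S = upper_alg S'"
    unfolding quantum_cluster_algebra_def quantum_upper_cluster_algebra_def * by (rule refl)+
qed

lemma qalg_cluster: "qalg (cluster_alg S)"
  unfolding quantum_cluster_algebra_def by (rule qalg_hull)

lemma cluster_generator:
  assumes "mut_equiv S S'" "\<alpha> \<in> V" "\<And>i. i \<in> ex S' \<Longrightarrow> \<alpha> $ i \<ge> 0"
  shows "tmap S' \<alpha> \<in> cluster_alg S"
  unfolding quantum_cluster_algebra_def using assms by (intro hull_inc) auto

text \<open>Unlike a single quantum torus, the upper bound is invariant under mutation; this is what proves the
  quantum Laurent phenomenon.\<close>

definition adj_torus :: "nat \<Rightarrow> int vec \<Rightarrow> 'f seed \<Rightarrow> 'f set" where
  "adj_torus i b S = Zq_span v {tmap S \<gamma> * mvar i b S powi n | \<gamma> n. \<gamma> \<in> V \<and> \<gamma> $ i = 0}"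

definition upper_bound :: "'f seed \<Rightarrow> 'f set" where
  "upper_bound S = torus S \<inter> (\<Inter>i\<in>ex S. adj_torus i (bcol S i) S)"

lemma adj_torus_eq: "seed_mutation v N i S S' \<Longrightarrow> torus S' = adj_torus i (bcol S i) S"
  unfolding seed_mutation_iff adj_torus_def using mrel_torus_eq by blast

text \<open>For i = k the neighbour of R is S again. For i \<noteq> k it is the end of the path Si -
  S - R - S2, and the upper bound of S provides membership in the first three tori, as
  \<open>rank_two\<close> requires.\<close>

lemma upper_bound_mutation_subset:
  assumes k: "seed_mutation v N k S R"
  shows "upper_bound S \<subseteq> upper_bound R"
proof
  fix u assume u: "u \<in> upper_bound S"
  from k obtain dk where S: "qseed S" "qseed R" "k \<in> ex S" "ex R = ex S"
      "exmat R = mutate_mat k (exmat S)" and mk: "mrel k (bcol S k) dk S R"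
    unfolding seed_mutation_iff by blast
  note q = quantum_seedD[OF S(1)]
  have uR: "u \<in> torus R" using u S(3) adj_torus_eq[OF k] by (auto simp: upper_bound_def)
  have uS: "u \<in> torus S" using u by (simp add: upper_bound_def)
  have "u \<in> adj_torus i (bcol R i) R" if i: "i \<in> ex R" for i
  proof (cases "i = k")
    case True
    then show ?thesis using uS adj_torus_eq[OF seed_mutation_sym[OF k]] by simp
  next
    case False
    have iS: "i \<in> ex S" using i S(4) by simp
    obtain Si where Si: "seed_mutation v N i S Si" using ex_seed_mutation[OF S(1) iS] by blast
    then obtain d where mi: "mrel i (bcol S i) d S Si" unfolding seed_mutation_iff by blast
    obtain S2 where S2: "seed_mutation v N i R S2" using ex_seed_mutation[OF S(2) i] by blast
    then obtain d' where m2: "mrel i (bcol R i) d' R S2" unfolding seed_mutation_iff by blast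
    have iN: "i < N" and kN: "k < N" using q(11) iS S(3) by auto
    have "u \<in> torus S2"
    proof (rule rank_two[OF mi mk m2 False])
      show "u \<in> torus Si"
        using u iS adj_torus_eq[OF Si] by (auto simp: upper_bound_def)
      show "bcol S k $ i = - (bcol S i $ k)"
        using q(2) q(5)[OF iS S(3)] iN kN by (simp add: bcol_index)
      fix j assume j: "j < N"
      show "bcol R i $ j = (if j = k then - (bcol S i $ k)
          else bcol S i $ j + (\<bar>bcol S k $ j\<bar> * bcol S i $ k + bcol S k $ j * \<bar>bcol S i $ k\<bar>) div 2)"
        using q(2) iN kN j False quantum_seedD(2)[OF S(2)] by (auto simp: bcol_index S(5) mutate_mat_index)
    qed (use uS uR in auto)
    then show ?thesis using adj_torus_eq[OF S2] by simp
  qed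
  with uR show "u \<in> upper_bound R" by (auto simp: upper_bound_def)
qed

lemma quantum_torus_reordering:
  assumes "seed_reordering v N p S S'"
  shows "torus S' = torus S"
proof -
  have p: "p permutes {..<N}" and t: "\<And>\<alpha>. \<alpha> \<in> V \<Longrightarrow> tmap S' (pvec p \<alpha>) = tmap S \<alpha>"
    using assms by (auto simp: seed_reordering_def pvec_def)
  have "tmap S' ` V = tmap S ` V"
  proof (intro equalityI subsetI)
    fix x assume "x \<in> tmap S' ` V"
    then obtain \<alpha> where "\<alpha> \<in> V" "x = tmap S' \<alpha>" by blast
    then have "x = tmap S (pvec (pinv p) \<alpha>)"
      using t[of "pvec (pinv p) \<alpha>"] by (simp add: pvec_inv[OF p])
    then show "x \<in> tmap S ` V" by simp
  next
    fix x assume "x \<in> tmap S ` V"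
    then obtain \<alpha> where "\<alpha> \<in> V" "x = tmap S \<alpha>" by blast
    then have "x = tmap S' (pvec p \<alpha>)" by (simp add: t)
    then show "x \<in> tmap S' ` V" by simp
  qed
  then show ?thesis by (simp add: quantum_torus_def)
qed

lemma upper_bound_reordering_subset:
  assumes r: "seed_reordering v N p S S'"
  shows "upper_bound S \<subseteq> upper_bound S'"
proof -
  have *: "qseed S" and p: "p permutes {..<N}" and E: "ex S = p ` ex S'"
    and m: "exmat S' = permute_mat p (exmat S)" 
    and t: "\<And>\<alpha>. \<alpha> \<in> V \<Longrightarrow> tmap S' (pvec p \<alpha>) = tmap S \<alpha>"
    using r by (auto simp: seed_reordering_def pvec_def)
  note B = quantum_seedD(2)[OF *]
  have "adj_torus (p i) (bcol S (p i)) S \<subseteq> adj_torus i (bcol S' i) S'" if i: "i \<in> ex S'" for i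
  proof -
    have piN: "p i < N" using quantum_seedD(1)[OF *] E i by auto
    then have iN: "i < N" using permutes_less(2)[OF p, of "p i"] by (simp add: permutes_inverses[OF p])
    have ue: "pvec p (e (p i)) = e i"
      using permutes_less(1)[OF p] iN piN permutes_inj[OF p] by (intro eq_vecI) (auto simp: unit_vec_def inj_eq)
    have b: "bcol S' i = pvec p (bcol S (p i))"
      using B iN permutes_less[OF p] by (intro eq_vecI) (auto simp: bcol_def permute_mat_index m)
    have pp: "pvec p (- e (p i) + pos_part c) = - e i + pos_part (pvec p c)" if "c \<in> V" for c
      using permutes_less(1)[OF p] that ue[symmetric] by (intro eq_vecI) (auto simp: pvec_def)
    have "- pvec p c = pvec p (- c)" if "c \<in> V" for c
      using permutes_less(1)[OF p] that by (intro eq_vecI) auto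
    then have "mvar i (bcol S' i) S' = mvar (p i) (bcol S (p i)) S"
      using B by (simp add: mvar_def b pp[symmetric] t)
    then have "tmap S \<gamma> * mvar (p i) (bcol S (p i)) S powi n \<in> {tmap S' \<gamma> * mvar i (bcol S' i) S' powi n | \<gamma> n. \<gamma> \<in> V \<and> \<gamma> $ i = 0}"
      if "\<gamma> \<in> V" "\<gamma> $ p i = 0" for \<gamma> n
      using that t[of \<gamma>] iN by (intro CollectI exI[of _ "pvec p \<gamma>"] exI[of _ n]) simp
    then show ?thesis unfolding adj_torus_def by (intro span_mono) auto
  qed
  then show ?thesis
    using quantum_torus_reordering[OF r] by (fastforce simp: upper_bound_def E)
qed

lemma upper_bound_equivalent:
  assumes "mut_equiv S S'"
  shows "upper_bound S \<subseteq> upper_bound S'"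
  using assms unfolding mutation_equivalent_iff
proof (induction rule: rtranclp_induct)
  case (step R R')
  have "upper_bound R \<subseteq> upper_bound R'"
    using step.hyps(2)[unfolded seed_step_def] upper_bound_mutation_subset upper_bound_reordering_subset by blast
  with step.IH show ?case by blast
qed simp

text \<open>A cluster monomial has nonnegative mutable exponents, so it lies in the torus of its own
  seed and in those of all neighbours. This upper bound is then carried along mutations to any
  equivalent seed.\<close>

theorem cluster_algebra_subset_upper:
  assumes S: "qseed S"
  shows "cluster_alg S \<subseteq> upper_alg S"
  unfolding quantum_cluster_algebra_def
proof (rule hull_minimal)
  show "Zq_subalgebra v (upper_alg S)"
    unfolding Zq_subalgebra_iff quantum_upper_cluster_algebra_def
    using mutation_equivalent_seed[OF _ S] quantum_seedD(6) by (intro qalg_Inter) (auto intro: qalg_torus)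
  have "tmap S' \<alpha> \<in> torus S''"
    if S': "mut_equiv S S'" and \<alpha>: "\<alpha> \<in> V" "\<forall>i\<in>ex S'. \<alpha> $ i \<ge> 0"
      and S'': "mut_equiv S S''" for S' S'' \<alpha>
  proof -
    have q: "qseed S'" by (rule mutation_equivalent_seed[OF S' S])
    have "tmap S' \<alpha> \<in> adj_torus i (bcol S' i) S'" if i: "i \<in> ex S'" for i
    proof -
      obtain R where R: "seed_mutation v N i S' R" using ex_seed_mutation[OF q i] by blast
      then obtain d where "mrel i (bcol S' i) d S' R" unfolding seed_mutation_iff by blast
      from nonneg_in_mut_torus[OF this \<alpha>(1)] \<alpha>(2) i show ?thesis using adj_torus_eq[OF R] by simp
    qed
    then have "tmap S' \<alpha> \<in> upper_bound S'"
      using \<alpha> by (auto simp: upper_bound_def tmap_in_torus)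
    moreover have "mut_equiv S' S''"
      using S' S'' mutation_equivalent_sym mutation_equivalent_trans by blast
    ultimately have "tmap S' \<alpha> \<in> upper_bound S''" using upper_bound_equivalent by blast
    then show ?thesis by (simp add: upper_bound_def)
  qed
  then show "{tmap S' \<alpha> | S' \<alpha>. mut_equiv S S' \<and> \<alpha> \<in> V \<and> (\<forall>i\<in>ex S'. \<alpha> $ i \<ge> 0)}
      \<subseteq> upper_alg S"
    unfolding quantum_upper_cluster_algebra_def by blast
qed

end

section \<open>Exchange types and freezing\<close>

lemma exchange_step_carrier:
  assumes "exchange_step A A'"
  shows "A \<in> carrier_mat (dim_row A) (dim_row A)" "A' \<in> carrier_mat (dim_row A) (dim_row A)"
proof -
  show "A \<in> carrier_mat (dim_row A) (dim_row A)"
    using assms by (auto simp: exchange_step_def skew_symmetric_def)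
  then show "A' \<in> carrier_mat (dim_row A) (dim_row A)"
    using assms unfolding exchange_step_def by (metis mutate_mat_carrier permute_mat_carrier)
qed

lemma exchange_step_skew:
  assumes "exchange_step A A'"
  shows "skew_symmetric A'"
proof -
  define n where "n = dim_row A"
  note c = exchange_step_carrier[OF assms, folded n_def]
  have sk: "A $$ (j, k) = - A $$ (k, j)" if "j < n" "k < n" for j k
  proof -
    have "skew_symmetric A" using assms by (simp add: exchange_step_def)
    then show ?thesis using that unfolding skew_symmetric_iff[OF c(1)] by blast
  qed
  from assms consider i where "i < n" "A' = mutate_mat i A" | p where "p permutes {..<n}" "A' = permute_mat p A"
    by (auto simp: exchange_step_def n_def)
  then show ?thesis
  proof cases
    case 1
    show ?thesis unfolding skew_symmetric_iff[OF c(2)]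
    proof (intro allI impI)
      fix j k assume jk: "j < n" "k < n"
      show "A' $$ (j, k) = - A' $$ (k, j)"
        using jk 1 c(1) sk[OF jk] mutation_term_antisym[of "A $$ (i, k)" "A $$ (j, i)"]
        by (auto simp: mutate_mat_index sk[OF 1(1) jk(1)] sk[OF jk(2) 1(1)])
    qed
  next
    case 2
    show ?thesis unfolding skew_symmetric_iff[OF c(2)]
    proof (intro allI impI)
      fix j k assume jk: "j < n" "k < n"
      then have "p j < n" "p k < n" using permutes_in_image[OF 2(1)] by auto
      then show "A' $$ (j, k) = - A' $$ (k, j)"
        using jk 2 c(1) sk[of "p j" "p k"] by (simp add: permute_mat_index)
    qed
  qed
qed

lemma exchange_step_sym:
  assumes "exchange_step A A'"
  shows "exchange_step A' A"
proof -
  define n where "n = dim_row A"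
  note c = exchange_step_carrier[OF assms, folded n_def] and sk = exchange_step_skew[OF assms]
  have n': "dim_row A' = n" using c by auto
  have z: "A $$ (i, i) = 0" if "i < n" for i
  proof -
    have "A $$ (i, i) = - A $$ (i, i)"
      using assms that skew_symmetric_iff[OF c(1)] unfolding exchange_step_def by blast
    then show ?thesis by simp
  qed
  from assms consider i where "i < n" "A' = mutate_mat i A" | p where "p permutes {..<n}" "A' = permute_mat p A"
    by (auto simp: exchange_step_def n_def)
  then show ?thesis
  proof cases
    case 1
    then have "A = mutate_mat i A'" using mutate_mat_involution[OF c(1) 1(1) z] by simp
    with 1 sk n' show ?thesis unfolding exchange_step_def by blast
  next
    case 2
    then have "A = permute_mat (inv_into UNIV p) A'" using permute_mat_inv[OF c(1) 2(1)] by simp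
    with sk n' permutes_inv[OF 2(1)] show ?thesis unfolding exchange_step_def by blast
  qed
qed

lemma exchange_type_iff: "A' \<in> exchange_type A \<longleftrightarrow> exchange_step\<^sup>*\<^sup>* A A'"
proof -
  have "symclp exchange_step = exchange_step"
    using exchange_step_sym by (auto simp: symclp_def fun_eq_iff)
  then show ?thesis by (simp add: exchange_type_def equivclp_def)
qed

lemma exchange_type_refl: "A \<in> exchange_type A"
  by (simp add: exchange_type_iff)

lemma exchange_step_zero:
  assumes "exchange_step (0\<^sub>m n n) A"
  shows "A = 0\<^sub>m n n"
proof -
  from assms consider i where "i < n" "A = mutate_mat i (0\<^sub>m n n)" | p where "p permutes {..<n}" "A = permute_mat p (0\<^sub>m n n)"
    by (auto simp: exchange_step_def)
  then show ?thesis
  proof cases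
    case 1
    then show ?thesis by (intro eq_matI) (auto simp: mutate_mat_index)
  next
    case 2
    have "p j < n" if "j < n" for j using permutes_in_image[OF 2(1), of j] that by simp
    with 2 show ?thesis by (intro eq_matI) (auto simp: permute_mat_index)
  qed
qed

text \<open>The zero matrix is fixed by every exchange step. Hence an isolated type makes the
  principal part of the given seed vanish, and not merely that of some equivalent seed.\<close>

lemma exchange_type_zero:
  assumes "A \<in> exchange_type (0\<^sub>m n n)"
  shows "A = 0\<^sub>m n n"
  using assms unfolding exchange_type_iff
  by (induction rule: rtranclp_induct) (auto dest: exchange_step_zero)

lemma pick_eq_iff: "a < card E \<Longrightarrow> b < card E \<Longrightarrow> pick E a = pick E b \<longleftrightarrow> a = b"
  using card_pick_le by metis

lemma pick_permutation:
  assumes E: "finite E" and p: "p permutes {..<card E}"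
  obtains P where "P permutes E" "\<And>a. a < card E \<Longrightarrow> P (pick E a) = pick E (p a)"
proof -
  define idx where "idx j = card {a\<in>E. a < j}" for j
  have pb: "bij_betw (pick E) {..<card E} E"
    unfolding bij_betw_def
  proof
    show "inj_on (pick E) {..<card E}" by (rule inj_onI) (simp add: pick_eq_iff)
    show "pick E ` {..<card E} = E"
    proof (intro equalityI subsetI)
      fix j assume "j \<in> E"
      then show "j \<in> pick E ` {..<card E}" using pick_surj[OF E] by blast
    qed (auto intro: pick_in_set_le)
  qed
  have ip: "idx (pick E a) = a" if "a < card E" for a
    using card_pick_le[OF that] by (simp add: idx_def)
  have pi: "idx j < card E \<and> pick E (idx j) = j" if "j \<in> E" for j
    using pick_surj[OF E that] ip by auto
  have ib: "bij_betw idx E {..<card E}"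
    by (rule bij_betw_byWitness[where f' = "pick E"])
       (use ip pi pick_in_set_le[of _ E] in auto)
  define P where "P j = (if j \<in> E then pick E (p (idx j)) else j)" for j
  have "bij_betw (pick E \<circ> (p \<circ> idx)) E E"
    by (intro bij_betw_trans[OF _ pb] bij_betw_trans[OF ib] permutes_imp_bij[OF p])
  moreover have "bij_betw P E E \<longleftrightarrow> bij_betw (pick E \<circ> (p \<circ> idx)) E E"
    by (rule bij_betw_cong) (simp add: P_def)
  ultimately have "bij_betw P E E" by simp
  then have "P permutes E" by (rule bij_imp_permutes) (simp add: P_def)
  moreover have "P (pick E a) = pick E (p a)" if "a < card E" for a
    using that pick_in_set_le[OF that] by (simp add: P_def ip)
  ultimately show ?thesis using that by blast
qed

text \<open>Removing the a-th element shifts the later positions by one, which is the index shift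
  made by \<open>mat_delete\<close>.\<close>

lemma pick_remove:
  assumes a: "a < card E" and x: "x < card E - 1"
  shows "pick (E - {pick E a}) x = pick E (if x < a then x else Suc x)"
proof -
  have E: "finite E" using a by (intro card_ge_0_finite) simp
  define y where "y = (if x < a then x else Suc x)"
  have y: "y < card E" "y \<noteq> a" using x a by (auto simp: y_def)
  define z where "z = pick E y"
  define E' where "E' = E - {pick E a}"
  have z: "z \<in> E'" using y a pick_in_set_le[OF y(1)] pick_eq_iff[OF y(1) a] by (simp add: z_def E'_def)
  have cz: "card {t\<in>E. t < z} = y" unfolding z_def by (rule card_pick_le[OF y(1)])
  have "card {t\<in>E'. t < z} = x"
  proof (cases "x < a")
    case True
    then have "z < pick E a" using pick_mono_le[OF a, of y] by (simp add: y_def z_def)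
    then have "{t\<in>E'. t < z} = {t\<in>E. t < z}" by (auto simp: E'_def)
    with cz True show ?thesis by (simp add: y_def)
  next
    case False
    then have "pick E a < z" using pick_mono_le[OF y(1), of a] by (simp add: y_def z_def)
    then have "{t\<in>E. t < z} = insert (pick E a) {t\<in>E'. t < z}" using pick_in_set_le[OF a] by (auto simp: E'_def)
    then have "card {t\<in>E. t < z} = Suc (card {t\<in>E'. t < z})" using E by (simp add: E'_def)
    with cz False show ?thesis by (simp add: y_def)
  qed
  with pick_card_in_set[OF z] show ?thesis by (simp add: E'_def z_def y_def)
qed

section \<open>Exchange matrices realized by equivalent seeds\<close>

context quantum_base
begin

lemma realize_exchange_step:
  assumes S: "qseed S" and st: "exchange_step (principal_part S) A"
  shows "\<exists>S'. mut_equiv S S' \<and> principal_part S' = A"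
proof -
  note q = quantum_seedD[OF S]
  let ?E = "ex S" and ?n = "card (ex S)"
  have n: "dim_row (principal_part S) = ?n" "dim_col (principal_part S) = ?n" using q(14) by auto
  from st n consider a where "a < ?n" "A = mutate_mat a (principal_part S)"
    | p where "p permutes {..<?n}" "A = permute_mat p (principal_part S)"
    by (auto simp: exchange_step_def)
  then show ?thesis
  proof cases
    case 1
    define i where "i = pick ?E a"
    have i: "i \<in> ?E" using pick_in_set_le[OF 1(1)] by (simp add: i_def)
    obtain S' where S': "seed_mutation v N i S S'" using ex_seed_mutation[OF S i] by blast
    then have f: "ex S' = ?E" "exmat S' = mutate_mat i (exmat S)" "qseed S'"
      by (auto simp: seed_mutation_def)
    have "principal_part S' = A"
    proof (rule eq_matI)
      fix x y assume "x < dim_row A" "y < dim_col A"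
      then have xy: "x < ?n" "y < ?n" using 1 n by auto
      have N: "pick ?E x < N" "pick ?E y < N" "i < N"
        using q(11) pick_in_set_le xy i by auto
      show "principal_part S' $$ (x, y) = A $$ (x, y)"
        using xy N q(2) 1(1) pick_eq_iff[of _ ?E] quantum_seedD(1,2)[OF f(3)] q(1)
        by (simp add: principal_part_index[of _ N] f(1,2) 1(2) mutate_mat_index n i_def)
    qed (use quantum_seedD(14)[OF f(3)] f 1 n in auto)
    then show ?thesis using mutation_equivalent_mutation[OF S'] by blast
  next
    case 2
    obtain P where P: "P permutes ?E" "\<And>a. a < ?n \<Longrightarrow> P (pick ?E a) = pick ?E (p a)"
      using pick_permutation[OF q(3) 2(1)] by blast
    have PN: "P permutes {..<N}" using P(1) q(1) by (rule permutes_subset)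
    define S' where "S' = reorder P S"
    have e: "ex S' = ?E" unfolding S'_def using permutes_image[OF permutes_inv[OF P(1)]] by simp
    have S': "qseed S'" unfolding S'_def by (rule quantum_seed_reorder[OF S PN])
    have "principal_part S' = A"
    proof (rule eq_matI)
      fix x y assume "x < dim_row A" "y < dim_col A"
      then have xy: "x < ?n" "y < ?n" using 2 n by auto
      then have pxy: "p x < ?n" "p y < ?n" using permutes_in_image[OF 2(1)] by auto
      have N: "pick ?E x < N" "pick ?E y < N" using q(11) pick_in_set_le xy by auto
      have "principal_part S' $$ (x, y) = exmat S' $$ (pick ?E x, pick ?E y)"
        using principal_part_index[OF quantum_seedD(2,1)[OF S'], of x y] xy by (simp add: e)
      also have "\<dots> = exmat S $$ (pick ?E (p x), pick ?E (p y))"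
        using N q(2) xy by (simp add: S'_def permute_mat_index P)
      also have "\<dots> = principal_part S $$ (p x, p y)"
        using principal_part_index[OF q(2,1) pxy] by simp
      finally show "principal_part S' $$ (x, y) = A $$ (x, y)"
        using xy n by (simp add: 2(2) permute_mat_index)
    qed (use quantum_seedD(14)[OF S'] e 2 n in auto)
    moreover have "mut_equiv S S'"
      using seed_reordering_reorder[OF S PN] unfolding S'_def
      by (intro mutation_equivalent_step[OF mutation_equivalent_refl]) (auto simp: seed_step_def)
    ultimately show ?thesis by blast
  qed
qed

text \<open>Allows the given seed to be replaced by one whose principal part is the very matrix with
  the source or sink; neither algebra changes.\<close>

lemma realize_exchange_type:
  assumes S: "qseed S" and A: "A \<in> exchange_type (principal_part S)"
  shows "\<exists>S'. mut_equiv S S' \<and> principal_part S' = A"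
  using A unfolding exchange_type_iff
proof (induction rule: rtranclp_induct)
  case base
  then show ?case using mutation_equivalent_refl by blast
next
  case (step A A')
  then obtain S' where S': "mut_equiv S S'" "principal_part S' = A" by blast
  obtain S'' where "mut_equiv S' S''" "principal_part S'' = A'"
    using realize_exchange_step[OF mutation_equivalent_seed[OF S'(1) S]] step.hyps(2) S'(2) by blast
  then show ?case using S'(1) mutation_equivalent_trans by blast
qed

definition freeze :: "nat \<Rightarrow> 'f seed \<Rightarrow> 'f seed" where
  "freeze i S = S\<lparr>ex := ex S - {i}, exmat := mat N N (\<lambda>(j, k). if k = i then 0 else exmat S $$ (j, k))\<rparr>"

lemma freeze_simps [simp]: "ex (freeze i S) = ex S - {i}"
  "exmat (freeze i S) = mat N N (\<lambda>(j, k). if k = i then 0 else exmat S $$ (j, k))"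
  "cmat (freeze i S) = cmat S" "tmap (freeze i S) = tmap S"
  by (simp_all add: freeze_def)

lemma quantum_seed_freeze:
  assumes S: "qseed S"
  shows "qseed (freeze i S)"
  unfolding quantum_seed_iff
proof (intro conjI)
  note q = quantum_seedD[OF S]
  have l: "lam (freeze i S) = lam S" by (simp add: lam_def fun_eq_iff)
  have b: "bcol (freeze i S) k = bcol S k" if "k \<in> ex S" "k \<noteq> i" for k
    using that q(2) q(11)[OF that(1)] by (intro eq_vecI) (auto simp: bcol_def)
  show "compatible (freeze i S)"
    using q(7) b unfolding compatible_def l by auto
  show "\<forall>j\<in>ex (freeze i S). \<forall>k\<in>ex (freeze i S). exmat (freeze i S) $$ (j, k) = - exmat (freeze i S) $$ (k, j)"
  proof (intro ballI)
    fix j k assume "j \<in> ex (freeze i S)" "k \<in> ex (freeze i S)"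
    then show "exmat (freeze i S) $$ (j, k) = - exmat (freeze i S) $$ (k, j)"
      using q(5)[of j k] q(11)[of j] q(11)[of k] by simp
  qed
  show "frame (freeze i S)" using q(6) by (simp add: frame_def l)
  show "monomials_free (freeze i S)" using q(8) by (simp add: monomials_free_def)
  show "torus_fractions (freeze i S)" using q(9) by (simp add: torus_fractions_def quantum_torus_def)
qed (use quantum_seedD(1,4)[OF S] in auto)

lemma principal_part_freeze:
  assumes S: "qseed S" and a: "a < card (ex S)"
  shows "principal_part (freeze (pick (ex S) a) S) = freezing (principal_part S) a"
proof -
  let ?i = "pick (ex S) a"
  note q = quantum_seedD[OF S] and qf = quantum_seedD[OF quantum_seed_freeze[OF S, of ?i]]
  have i: "?i \<in> ex S" by (rule pick_in_set_le[OF a])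
  then have c: "card (ex S - {?i}) = card (ex S) - 1" using q(3) by simp
  show ?thesis
  proof (rule eq_matI)
    fix x y assume "x < dim_row (freezing (principal_part S) a)" "y < dim_col (freezing (principal_part S) a)"
    then have xy: "x < card (ex S) - 1" "y < card (ex S) - 1" using q(14) by (auto simp: freezing_def)
    let ?s = "\<lambda>x. if x < a then x else Suc x"
    have s: "?s x < card (ex S)" "?s y < card (ex S)" "?s y \<noteq> a" using xy by auto
    have "principal_part (freeze ?i S) $$ (x, y) = exmat (freeze ?i S) $$ (pick (ex S) (?s x), pick (ex S) (?s y))"
      using principal_part_index[OF qf(2,1), of x y] xy c by (simp add: pick_remove[OF a])
    also have "\<dots> = exmat S $$ (pick (ex S) (?s x), pick (ex S) (?s y))"
      using q(11)[OF pick_in_set_le[OF s(1)]] q(11)[OF pick_in_set_le[OF s(2)]] pick_eq_iff[OF s(2) a] s(3)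
      by simp
    also have "\<dots> = principal_part S $$ (?s x, ?s y)"
      using principal_part_index[OF q(2,1) s(1,2)] by simp
    also have "\<dots> = freezing (principal_part S) a $$ (x, y)"
      using xy q(14) by (auto simp: freezing_def mat_delete_def)
    finally show "principal_part (freeze ?i S) $$ (x, y) = freezing (principal_part S) a $$ (x, y)" .
  qed (use q(14) qf(14) c in \<open>auto simp: freezing_def\<close>)
qed

definition unfreezes :: "nat \<Rightarrow> 'f seed \<Rightarrow> 'f seed \<Rightarrow> bool" where
  "unfreezes i F S \<longleftrightarrow> qseed S \<and> i \<in> ex S \<and> ex F = ex S - {i} \<and>
     (\<forall>j<N. \<forall>k\<in>ex F. exmat F $$ (j, k) = exmat S $$ (j, k)) \<and> (\<forall>\<alpha>\<in>V. tmap F \<alpha> = tmap S \<alpha>)"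

lemma unfreezes_freeze: "qseed S \<Longrightarrow> i \<in> ex S \<Longrightarrow> unfreezes i (freeze i S) S"
  using quantum_seedD(11)[of S] by (auto simp: unfreezes_def)

lemma lam_cong:
  assumes "frame S" "frame S'" "\<And>\<alpha>. \<alpha> \<in> V \<Longrightarrow> tmap S \<alpha> = tmap S' \<alpha>" "\<alpha> \<in> V" "\<beta> \<in> V"
  shows "lam S \<alpha> \<beta> = lam S' \<alpha> \<beta>"
proof -
  have "sc (lam S \<alpha> \<beta>) (tmap S' (\<alpha> + \<beta>)) = sc (lam S' \<alpha> \<beta>) (tmap S' (\<alpha> + \<beta>))"
    using tmap_mult[OF assms(1,4,5)] tmap_mult[OF assms(2,4,5)] assms(3-5) by simp
  then show ?thesis using tmap_nonzero[OF assms(2), of "\<alpha> + \<beta>"] assms(4,5) by (simp add: sc_eq_sc_iff)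
qed

text \<open>A mutation at k changes column l using only columns k and l. With k and l both different
  from i, column i never interferes, so the same mutation of S produces the same columns and the
  same monomials.\<close>

lemma unfreezes_step:
  assumes u: "unfreezes i F S" and st: "seed_step F F'"
  shows "\<exists>i' S'. unfreezes i' F' S' \<and> mut_equiv S S' \<and> tmap S' (e i') = tmap S (e i)"
proof -
  have S: "qseed S" and i: "i \<in> ex S" and E: "ex F = ex S - {i}"
    and B: "\<And>j k. j < N \<Longrightarrow> k \<in> ex F \<Longrightarrow> exmat F $$ (j, k) = exmat S $$ (j, k)"
    and t: "\<And>\<alpha>. \<alpha> \<in> V \<Longrightarrow> tmap F \<alpha> = tmap S \<alpha>"
    using u by (auto simp: unfreezes_def)
  note q = quantum_seedD[OF S]
  from st consider k where "seed_mutation v N k F F'" | p where "seed_reordering v N p F F'"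
    by (auto simp: seed_step_def)
  then show ?thesis
  proof cases
    case 1
    then obtain d where F: "qseed F" "qseed F'" and k: "k \<in> ex F" and E': "ex F' = ex F"
      and B': "exmat F' = mutate_mat k (exmat F)" and m: "mrel k (bcol F k) d F F'"
      unfolding seed_mutation_iff by blast
    have kS: "k \<in> ex S" "k \<noteq> i" using k E by auto
    have kN: "k < N" using q(11)[OF kS(1)] .
    obtain S' where S': "seed_mutation v N k S S'" using ex_seed_mutation[OF S kS(1)] by blast
    then obtain d' where S2: "qseed S'" "ex S' = ex S" "exmat S' = mutate_mat k (exmat S)"
      and m': "mrel k (bcol S k) d' S S'"
      unfolding seed_mutation_iff by blast
    have b: "bcol F k = bcol S k"
      using B k kN q(2) quantum_seedD(2)[OF F(1)] by (intro eq_vecI) (auto simp: bcol_def)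
    have l: "lam F \<alpha> \<beta> = lam S \<alpha> \<beta>" if "\<alpha> \<in> V" "\<beta> \<in> V" for \<alpha> \<beta>
      using lam_cong[OF quantum_seedD(6)[OF F(1)] q(6) t that] .
    have mv: "mvar k (bcol S k) F = mvar k (bcol S k) S"
      using q(12) by (simp add: mvar_def t)
    have "tmap F' \<alpha> = tmap S' \<alpha>" if "\<alpha> \<in> V" for \<alpha>
      using mrel_tmap[OF m that] mrel_tmap[OF m' that] that q(12)[of k]
      by (simp add: b l mv t)
    moreover have "exmat F' $$ (j, l) = exmat S' $$ (j, l)" if "j < N" "l \<in> ex F'" for j l
    proof -
      have l: "l \<in> ex F" "l \<in> ex S" "l < N" using that E E' q(11) by auto
      show ?thesis
        using that(1) l kN q(2) quantum_seedD(2)[OF F(1)] B[OF that(1) l(1)] B[OF that(1) k] B[OF kN l(1)]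
        by (simp add: B' S2(3) mutate_mat_index)
    qed
    ultimately have "unfreezes i F' S'"
      using S2 i E E' by (auto simp: unfreezes_def)
    moreover have "tmap S' (e i) = tmap S (e i)"
      using mrelD(3)[OF m', of "e i"] kS kN q(11)[OF i] by simp
    ultimately show ?thesis using mutation_equivalent_mutation[OF S'] by blast
  next
    case 2
    let ?p' = "pinv p"
    from 2 have F: "qseed F" "qseed F'" and p: "p permutes {..<N}" and E': "ex F = p ` ex F'"
      and B': "exmat F' = permute_mat p (exmat F)" and t': "\<And>\<alpha>. \<alpha> \<in> V \<Longrightarrow> tmap F' (pvec p \<alpha>) = tmap F \<alpha>"
      by (auto simp: seed_reordering_def pvec_def)
    define S' where "S' = reorder p S"
    have S': "qseed S'" unfolding S'_def by (rule quantum_seed_reorder[OF S p])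
    have me: "mut_equiv S S'"
      using seed_reordering_reorder[OF S p] unfolding S'_def
      by (intro mutation_equivalent_step[OF mutation_equivalent_refl]) (auto simp: seed_step_def)
    have injp: "inj ?p'" using permutes_inj[OF permutes_inv[OF p]] .
    have "ex F' = ?p' ` ex F" by (simp add: E' image_image permutes_inverses[OF p])
    also have "\<dots> = ?p' ` ex S - {?p' i}" unfolding E by (simp add: image_set_diff[OF injp])
    finally have e: "ex F' = ex S' - {?p' i}" by (simp add: S'_def)
    have tt: "tmap F' \<alpha> = tmap S' \<alpha>" if "\<alpha> \<in> V" for \<alpha>
      using t'[of "pvec ?p' \<alpha>"] that by (simp add: pvec_inv[OF p] S'_def t)
    have bb: "exmat F' $$ (j, l) = exmat S' $$ (j, l)" if "j < N" "l \<in> ex F'" for j l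
    proof -
      have l: "p l \<in> ex F" "l < N" using that E' quantum_seedD(11)[OF F(2)] by auto
      show ?thesis
        using that(1) l permutes_less[OF p] q(2) quantum_seedD(2)[OF F(1)] B[of "p j" "p l"]
        by (simp add: B' S'_def permute_mat_index)
    qed
    have "?p' i \<in> ex S'" using i by (simp add: S'_def)
    with S' e tt bb have "unfreezes (?p' i) F' S'" by (simp add: unfreezes_def)
    moreover have "pvec ?p' (e (?p' i)) = e i"
      using permutes_less[OF p] q(11)[OF i] injp
      by (intro eq_vecI) (auto simp: unit_vec_def inj_eq)
    then have "tmap S' (e (?p' i)) = tmap S (e i)" by (simp add: S'_def)
    ultimately show ?thesis using me by blast
  qed
qed

lemma unfreezes_equivalent:
  assumes "mut_equiv (freeze i S) F" "qseed S" "i \<in> ex S"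
  shows "\<exists>i' S'. unfreezes i' F S' \<and> mut_equiv S S' \<and> tmap S' (e i') = tmap S (e i)"
  using assms(1) unfolding mutation_equivalent_iff[of "freeze i S"]
proof (induction rule: rtranclp_induct)
  case base
  then show ?case using unfreezes_freeze[OF assms(2,3)] mutation_equivalent_refl by blast
next
  case (step F F')
  then obtain i' S' where "unfreezes i' F S'" "mut_equiv S S'" "tmap S' (e i') = tmap S (e i)"
    by blast
  moreover from unfreezes_step[OF this(1) step.hyps(2)] obtain i'' S''
    where "unfreezes i'' F' S''" "mut_equiv S' S''" "tmap S'' (e i'') = tmap S' (e i')" by blast
  ultimately have "unfreezes i'' F' S'' \<and> mut_equiv S S'' \<and> tmap S'' (e i'') = tmap S (e i)"
    using mutation_equivalent_trans[of S S' S''] by simp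
  then show ?case by blast
qed

lemma upper_subset_freeze:
  assumes "qseed S" "i \<in> ex S"
  shows "upper_alg S \<subseteq> upper_alg (freeze i S)"
proof
  fix u assume u: "u \<in> upper_alg S"
  show "u \<in> upper_alg (freeze i S)"
    unfolding quantum_upper_cluster_algebra_def
  proof (intro INT_I)
    fix F assume "F \<in> {S'. mut_equiv (freeze i S) S'}"
    then obtain i' S' where *: "unfreezes i' F S'" "mut_equiv S S'"
      using unfreezes_equivalent[OF _ assms] by blast
    then have "tmap F ` V = tmap S' ` V" by (auto simp: unfreezes_def)
    then have "torus F = torus S'" by (simp add: quantum_torus_def)
    with u *(2) show "u \<in> torus F" by (auto simp: quantum_upper_cluster_algebra_def)
  qed
qed

lemma unit_in_cluster:
  assumes S: "qseed S" and i: "i < N"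
  shows "tmap S (e i) \<in> cluster_alg S"
proof (rule cluster_generator[OF mutation_equivalent_refl])
  fix k assume "k \<in> ex S"
  then have "k < N" by (rule quantum_seedD(11)[OF S])
  with i show "e i $ k \<ge> 0" by simp
qed simp

text \<open>Freezing only adds monomials with negative powers of x_i, and this element x_i is the
  same in all the lifted seeds; so powers of x_i clear the denominators.\<close>

lemma freeze_algebra_subset:
  assumes S: "qseed S" and i: "i \<in> ex S" and a: "a \<in> cluster_alg (freeze i S)"
  shows "\<exists>n. \<forall>m\<ge>n. tmap S (e i) ^ m * a \<in> cluster_alg S"
proof -
  let ?x = "tmap S (e i)" and ?A = "cluster_alg S"
  note qA = qalg_cluster[of S]
  \<comment> \<open>Homogeneity for conjugation by x_i is required so that powers of x_i can be
    moved between the factors of a product. It makes W multiplicative and its span an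
    algebra.\<close>
  define W where "W = {w. (\<exists>d. w \<in> hom ?x d) \<and> (\<exists>n. \<forall>m\<ge>n. ?x ^ m * w \<in> ?A)}"
  have x: "?x \<in> ?A" by (rule unit_in_cluster[OF S quantum_seedD(11)[OF S i]])
  have one: "1 \<in> W" unfolding W_def using hom_one qalgD(4)[OF qA x] by auto
  have mult: "w * w' \<in> W" if w: "w \<in> W" "w' \<in> W" for w w'
  proof -
    from w obtain d n d' n' where h: "w \<in> hom ?x d" "w' \<in> hom ?x d'"
      and n: "\<And>m. m \<ge> n \<Longrightarrow> ?x ^ m * w \<in> ?A" "\<And>m. m \<ge> n' \<Longrightarrow> ?x ^ m * w' \<in> ?A"
      unfolding W_def by blast
    have "?x ^ m * (w * w') \<in> ?A" if "m \<ge> n + n'" for m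
    proof -
      have 1: "?x ^ m = ?x ^ (m - n') * ?x ^ n'" using that by (simp flip: power_add)
      have 2: "?x ^ n' * w = sc (int n' * d) (w * ?x ^ n')"
        using hom_powi_swap[OF h(1), of "int n'"] by simp
      have "?x ^ m * (w * w') = ?x ^ (m - n') * ((?x ^ n' * w) * w')"
        by (simp only: 1 mult.assoc)
      also have "\<dots> = sc (int n' * d) ((?x ^ (m - n') * w) * (?x ^ n' * w'))"
        unfolding 2 by (simp add: mult.assoc)
      also have "\<dots> \<in> ?A" using that by (intro qclosedD(3)[OF qalgD(1)[OF qA]] qalgD(3)[OF qA] n) auto
      finally show ?thesis .
    qed
    then show ?thesis using hom_mult[OF h] unfolding W_def by blast
  qed
  have "qalg (Zq_span v W)"
    unfolding qalg_def
  proof (intro conjI ballI)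
    show "1 \<in> Zq_span v W" by (rule span_base[OF one])
    fix y z assume "y \<in> Zq_span v W" "z \<in> Zq_span v W"
    then show "y * z \<in> Zq_span v W" by (rule span_mult) (auto intro: span_base mult)
  qed simp
  moreover have "tmap F \<alpha> \<in> W"
    if F: "mut_equiv (freeze i S) F" "\<alpha> \<in> V" "\<forall>k\<in>ex F. \<alpha> $ k \<ge> 0" for F \<alpha>
  proof -
    obtain i' S' where *: "unfreezes i' F S'" "mut_equiv S S'" "tmap S' (e i') = ?x"
      using unfreezes_equivalent[OF F(1) S i] by blast
    have q: "qseed S'" and i': "i' \<in> ex S'" and E: "ex F = ex S' - {i'}" and t: "tmap F \<alpha> = tmap S' \<alpha>"
      using *(1) F(2) by (auto simp: unfreezes_def)
    note f = quantum_seedD(6)[OF q] and iN = quantum_seedD(11)[OF q i']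
    have "tmap F \<alpha> \<in> hom ?x (2 * lam S' (e i') \<alpha>)"
      unfolding t *(3)[symmetric] by (intro tmap_hom[OF f]) (use F in auto)
    moreover have "?x ^ m * tmap F \<alpha> \<in> ?A" if "m \<ge> nat (- (\<alpha> $ i'))" for m
    proof -
      have "?x ^ m * tmap F \<alpha> = sc (int m * lam S' (e i') \<alpha>) (tmap S' (int m \<cdot>\<^sub>v e i' + \<alpha>))"
        unfolding t *(3)[symmetric] using F(2) by (simp add: tmap_power[OF f] tmap_mult[OF f] lam_simps[OF f])
      also have "\<dots> \<in> ?A"
      proof (intro qclosedD(3)[OF qalgD(1)[OF qA]] cluster_generator *(2))
        fix k assume k: "k \<in> ex S'"
        then have "k < N" by (rule quantum_seedD(11)[OF q])
        then show "(int m \<cdot>\<^sub>v e i' + \<alpha>) $ k \<ge> 0"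
          using F(2,3) k E iN that by (cases "k = i'") auto
      qed (use F in auto)
      finally show ?thesis .
    qed
    ultimately show ?thesis unfolding W_def by blast
  qed
  ultimately have "cluster_alg (freeze i S) \<subseteq> Zq_span v W"
    unfolding quantum_cluster_algebra_def by (intro hull_minimal) (auto simp: Zq_subalgebra_iff intro: span_base)
  moreover have "Zq_span v W \<subseteq> {a. \<exists>n. \<forall>m\<ge>n. ?x ^ m * a \<in> ?A}" (is "_ \<subseteq> ?Q")
  proof (rule span_least)
    show "qclosed ?Q"
      by (intro qclosed_eventually qalgD(1)[OF qA]; simp add: right_diff_distrib)
  qed (auto simp: W_def)
  ultimately show ?thesis using a by blast
qed

end

section \<open>The equality of the two algebras\<close>

context quantum_base
begin

text \<open>The monomial M(p) involves frozen variables only and is a unit of the cluster algebra,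
  while r_j > 0 makes M(r) a left multiple of x_j. Solving the relation for M(p) and multiplying by
  its inverse expresses 1.\<close>

lemma comaximal_aux:
  assumes S: "qseed S" and j: "j \<in> ex S" and x: "x' \<in> cluster_alg S"
    and p: "p \<in> V" "\<And>k. k \<in> ex S \<Longrightarrow> p $ k = 0" and r: "r \<in> V" "\<And>k. k \<in> ex S \<Longrightarrow> r $ k \<ge> 0" "r $ j > 0"
    and rel: "x' * tmap S (e i) = sc a (tmap S p) + sc c (tmap S r)"
  shows "\<exists>f\<in>cluster_alg S. \<exists>g\<in>cluster_alg S. 1 = f * tmap S (e i) + g * tmap S (e j)"
proof -
  note q = quantum_seedD[OF S] and F = quantum_seedD(6)[OF S] and qA = qalg_cluster[of S]
  let ?A = "cluster_alg S"
  have jN: "j < N" by (rule q(11)[OF j])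
  have P: "tmap S (- p) \<in> ?A"
    using p q(11) by (intro cluster_generator mutation_equivalent_refl) auto
  have P1: "tmap S (- p) * tmap S p = 1"
    using tmap_inverse[OF F p(1)] tmap_nonzero[OF F p(1)] by (metis left_inverse)
  define r' where "r' = r - e j"
  have r': "r' \<in> V" "tmap S r' \<in> ?A"
  proof -
    show r'V: "r' \<in> V" using r by (simp add: r'_def)
    show "tmap S r' \<in> ?A"
    proof (intro cluster_generator mutation_equivalent_refl r'V)
      fix k assume k: "k \<in> ex S"
      then show "r' $ k \<ge> 0" using r(2)[OF k] r(1,3) jN q(11)[OF k] by (cases "k = j") (auto simp: r'_def)
    qed
  qed
  have "r' + e j = r" using r(1) by (intro eq_vecI) (auto simp: r'_def)
  then have R: "tmap S r = sc (- lam S r' (e j)) (tmap S r' * tmap S (e j))"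
    using tmap_add[OF F r'(1), of "e j"] by simp
  have "1 = sc (- a) (tmap S (- p) * sc a (tmap S p))" using P1 by simp
  also have "sc a (tmap S p) = x' * tmap S (e i) - sc c (tmap S r)" unfolding rel by simp
  also have "sc (- a) (tmap S (- p) * (x' * tmap S (e i) - sc c (tmap S r))) =
      sc (- a) (tmap S (- p) * x') * tmap S (e i) + (- sc (c - a - lam S r' (e j)) (tmap S (- p) * tmap S r')) * tmap S (e j)"
    unfolding R by (simp add: right_diff_distrib sc_diff mult.assoc algebra_simps)
  finally have "1 = sc (- a) (tmap S (- p) * x') * tmap S (e i) + (- sc (c - a - lam S r' (e j)) (tmap S (- p) * tmap S r')) * tmap S (e j)" .
  moreover have "sc (- a) (tmap S (- p) * x') \<in> ?A"
    by (intro qclosedD(3)[OF qalgD(1)[OF qA]] qalgD(3)[OF qA] P x)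
  moreover have "- sc (c - a - lam S r' (e j)) (tmap S (- p) * tmap S r') \<in> ?A"
    by (intro qclosedD(3,4)[OF qalgD(1)[OF qA]] qalgD(3)[OF qA] P r')
  ultimately show ?thesis by blast
qed

text \<open>At a source the positive part of column i has no mutable coordinates, at a sink the
  negative part has none; the remaining exchange term then contains x_j, as its entry in column i is
  nonzero.\<close>

lemma comaximal:
  assumes S: "qseed S" and i: "i \<in> ex S" and j: "j \<in> ex S" and nz: "exmat S $$ (j, i) \<noteq> 0"
    and ss: "(\<forall>k\<in>ex S. exmat S $$ (k, i) \<le> 0) \<or> (\<forall>k\<in>ex S. exmat S $$ (k, i) \<ge> 0)"
  shows "\<exists>f\<in>cluster_alg S. \<exists>g\<in>cluster_alg S. 1 = f * tmap S (e i) + g * tmap S (e j)"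
proof -
  note q = quantum_seedD[OF S]
  obtain R where R: "seed_mutation v N i S R" using ex_seed_mutation[OF S i] by blast
  then obtain d where R': "qseed R" "ex R = ex S" and m: "mrel i (bcol S i) d S R"
    unfolding seed_mutation_iff by blast
  note md = mrelD(1)[OF m]
  have x: "mvar i (bcol S i) S \<in> cluster_alg S"
    unfolding mrelD(4)[OF m, symmetric] algebra_cong(1)[OF mutation_equivalent_mutation[OF R]]
    by (rule unit_in_cluster[OF R'(1) q(11)[OF i]])
  have b: "bcol S i $ k = exmat S $$ (k, i)" if "k \<in> ex S" for k
    using bcol_index[OF q(2) q(11)[OF i] q(11)[OF that]] .
  have pp: "pos_part (bcol S i) $ k = max (exmat S $$ (k, i)) 0"
    "pos_part (- bcol S i) $ k = max (- exmat S $$ (k, i)) 0" if "k \<in> ex S" for k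
    using b[OF that] q(11)[OF that] carrier_matD[OF q(2)] by auto
  note rel = mvar_mult_unit[OF md]
  from ss show ?thesis
  proof
    assume neg: "\<forall>k\<in>ex S. exmat S $$ (k, i) \<le> 0"
    show ?thesis
      by (rule comaximal_aux[OF S j x _ _ _ _ _ rel]) (use neg nz j q(12) in \<open>auto simp: pp max_def order.order_iff_strict\<close>)
  next
    assume pos: "\<forall>k\<in>ex S. exmat S $$ (k, i) \<ge> 0"
    have rel': "mvar i (bcol S i) S * tmap S (e i) =
        sc (lam S (pos_part (- bcol S i)) (e i)) (tmap S (pos_part (- bcol S i))) +
        sc (lam S (pos_part (bcol S i)) (e i)) (tmap S (pos_part (bcol S i)))"
      unfolding rel by (rule add.commute)
    show ?thesis
      by (rule comaximal_aux[OF S j x _ _ _ _ _ rel'])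
         (use pos nz j q(12) in \<open>auto simp: pp max_def order.order_iff_strict\<close>)
  qed
qed

text \<open>From w = f (x w) + g (y w), membership of x w and y w gives that of w. Applied to w =
  x^a y^b u, this lowers the total exponent a + b step by step to 0, and no statement about powers
  of f and g arises.\<close>

lemma comaximal_descent:
  assumes A: "qalg A" and fg: "f \<in> A" "g \<in> A" "1 = f * x + g * y"
    and xA: "x \<in> A" "y \<in> A" and h: "y \<in> hom x d"
    and u: "\<forall>m\<ge>n. x ^ m * u \<in> A" "\<forall>m\<ge>n'. y ^ m * u \<in> A"
  shows "u \<in> A"
proof -
  have xy: "x ^ a * y ^ b = sc (int a * (int b * d)) (y ^ b * x ^ a)" for a b
    using hom_powi_swap[OF hom_power[OF h, of b], of "int a"] by simp
  \<comment> \<open>The number k bounds how far a + b lies below n + n'. For k = 0 either a \<ge> n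
    or b \<ge> n' holds.\<close>
  have "\<forall>a b. a + b + k \<ge> n + n' \<longrightarrow> x ^ a * (y ^ b * u) \<in> A" for k
  proof (induction k)
    case 0
    show ?case
    proof (intro allI impI)
      fix a b assume "n + n' \<le> a + b + 0"
      then consider "a \<ge> n" | "b \<ge> n'" by linarith
      then show "x ^ a * (y ^ b * u) \<in> A"
      proof cases
        case 1
        have "x ^ a * (y ^ b * u) = sc (int a * (int b * d)) (y ^ b * (x ^ a * u))"
        proof -
          have "x ^ a * (y ^ b * u) = (x ^ a * y ^ b) * u" by (simp only: mult.assoc)
          then show ?thesis unfolding xy by (simp add: mult.assoc)
        qed
        moreover have "x ^ a * u \<in> A" using 1 u(1) by blast
        ultimately show ?thesis
          using qclosedD(3)[OF qalgD(1)[OF A] qalgD(3)[OF A qalgD(4)[OF A xA(2)]]] by simp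
      next
        case 2
        then have "y ^ b * u \<in> A" using u(2) by blast
        then show ?thesis by (rule qalgD(3)[OF A qalgD(4)[OF A xA(1)]])
      qed
    qed
  next
    case (Suc k)
    show ?case
    proof (intro allI impI)
      fix a b assume ab: "n + n' \<le> a + b + Suc k"
      define w where "w = x ^ a * (y ^ b * u)"
      have "x * w = x ^ Suc a * (y ^ b * u)" by (simp add: w_def mult.assoc)
      also have "\<dots> \<in> A" using Suc[rule_format, of "Suc a" b] ab by (simp del: power_Suc)
      finally have 1: "x * w \<in> A" .
      have *: "y * x ^ a = sc (- (int a * d)) (x ^ a * y)" using xy[of a 1] by simp
      have "y * w = sc (- (int a * d)) (x ^ a * (y ^ Suc b * u))"
      proof -
        have "y * w = (y * x ^ a) * (y ^ b * u)" by (simp only: w_def mult.assoc)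
        then show ?thesis unfolding * by (simp add: mult.assoc)
      qed
      also have "\<dots> \<in> A"
        using Suc[rule_format, of a "Suc b"] ab by (intro qclosedD(3)[OF qalgD(1)[OF A]]) (simp del: power_Suc)
      finally have 2: "y * w \<in> A" .
      have "w = (f * x + g * y) * w" by (simp flip: fg(3))
      also have "\<dots> = f * (x * w) + g * (y * w)" by (simp add: distrib_right mult.assoc)
      also have "\<dots> \<in> A" by (rule qclosedD(5)[OF qalgD(1)[OF A] qalgD(3)[OF A fg(1) 1] qalgD(3)[OF A fg(2) 2]])
      finally show "x ^ a * (y ^ b * u) \<in> A" by (simp add: w_def)
    qed
  qed
  from this[of "n + n'", rule_format, of 0 0] show ?thesis by simp
qed

text \<open>When the principal part vanishes, mutating the indices of \<open>K\<close> in any order yields a seed whose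
  lattice coordinates in \<open>K\<close> have the opposite sign: all degrees with respect to the (mutation
  invariant) monomials of the columns of the exchange matrix are preserved.\<close>

lemma isolated_mutations:
  assumes S: "qseed S" and z: "\<And>j k. j \<in> ex S \<Longrightarrow> k \<in> ex S \<Longrightarrow> exmat S $$ (j, k) = 0"
    and d: "\<And>k. k \<in> ex S \<Longrightarrow> d k > 0" "\<And>k \<alpha>. k \<in> ex S \<Longrightarrow> \<alpha> \<in> V \<Longrightarrow> lam S \<alpha> (bcol S k) = \<alpha> $ k * d k"
    and "finite K" "K \<subseteq> ex S"
  shows "\<exists>R. mut_equiv S R \<and> ex R = ex S \<and>
    (\<forall>k\<in>ex S. bcol R k = (if k \<in> K then - bcol S k else bcol S k)) \<and>
    (\<forall>k\<in>ex S. tmap R (bcol S k) = tmap S (bcol S k)) \<and>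
    (\<forall>k\<in>ex S. \<forall>\<alpha>\<in>V. lam R \<alpha> (bcol R k) = \<alpha> $ k * d k)"
  using assms(5,6)
proof (induction K rule: finite_induct)
  case empty
  show ?case using d(2) mutation_equivalent_refl[of S] by (intro exI[of _ S]) auto
next
  case (insert i K)
  then obtain R where R: "mut_equiv S R" "ex R = ex S"
    and b: "\<And>k. k \<in> ex S \<Longrightarrow> bcol R k = (if k \<in> K then - bcol S k else bcol S k)"
    and t: "\<And>k. k \<in> ex S \<Longrightarrow> tmap R (bcol S k) = tmap S (bcol S k)"
    and l: "\<And>k \<alpha>. k \<in> ex S \<Longrightarrow> \<alpha> \<in> V \<Longrightarrow> lam R \<alpha> (bcol R k) = \<alpha> $ k * d k" by blast
  have i: "i \<in> ex S" using insert.prems by auto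
  note q = quantum_seedD[OF S]
  have qR: "qseed R" by (rule mutation_equivalent_seed[OF R(1) S])
  note r = quantum_seedD[OF qR]
  obtain R' where R': "seed_mutation v N i R R'" using ex_seed_mutation[OF qR] i R(2) by blast
  then obtain d' where s: "qseed R'" "ex R' = ex R" "exmat R' = mutate_mat i (exmat R)"
    and m: "mrel i (bcol R i) d' R R'" unfolding seed_mutation_iff by blast
  have iN: "i < N" by (rule q(11)[OF i])
  have zS: "bcol S k $ j = 0" if "j \<in> ex S" "k \<in> ex S" for j k
    using that z q(2,11) by (simp add: bcol_index)
  have zR: "bcol R k $ j = 0" if "j \<in> ex S" "k \<in> ex S" for j k
    using that zS b[of k] q(11)[of j] carrier_matD[OF q(2)] by simp
  have b': "bcol R' k = (if k \<in> insert i K then - bcol S k else bcol S k)" if k: "k \<in> ex S" for k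
  proof (cases "k = i")
    case True
    have "bcol R' i = - bcol R i" using bcol_mutate_same[OF qR _ s(3)] i R(2) by simp
    with True b[OF i] insert.hyps show ?thesis by simp
  next
    case False
    have "exmat R $$ (i, k) = 0" using zR[OF i k] bcol_index[OF r(2) q(11)[OF k] iN] by simp
    then have "bcol R' k = bcol R k"
      using r(2) iN q(11)[OF k] False by (intro eq_vecI) (auto simp: bcol_def s(3) mutate_mat_index)
    with b[OF k] False show ?thesis by simp
  qed
  have t': "tmap R' (bcol S k) = tmap S (bcol S k)" if "k \<in> ex S" for k
    using mrelD(3)[OF m q(12) zS[OF i that]] t[OF that] by simp
  have l': "lam R' \<alpha> (bcol R' k) = \<alpha> $ k * d k" if k: "k \<in> ex S" and \<alpha>: "\<alpha> \<in> V" for k \<alpha>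
  proof -
    \<comment> \<open>Compatibility of R' provides only some constant; evaluation at the k-th unit
      vector identifies it with d k.\<close>
    obtain c where c: "\<And>\<alpha>. \<alpha> \<in> V \<Longrightarrow> lam R' \<alpha> (bcol R' k) = \<alpha> $ k * c"
      using quantum_seedD(7)[OF s(1)] k s(2) R(2) unfolding compatible_def by metis
    have kN: "k < N" by (rule q(11)[OF k])
    have "c = d k"
    proof (cases "k = i")
      case True
      have di: "d' = d i" using mrel_mdataD(6)[OF m, of "e i"] l[OF i, of "e i"] iN by simp
      have "lam R' (e i) (bcol R i) = - d'" using mdataD(6)[OF mrel_mdata_back[OF m], of "e i"] iN by simp
      moreover have "bcol R' i = - bcol R i" using bcol_mutate_same[OF qR _ s(3)] i R(2) by simp
      ultimately have "lam R' (e i) (bcol R' i) = d'"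
        using r(12) quantum_seedD(6)[OF s(1)] by (simp add: lam_simps)
      with c[of "e i"] True iN di show ?thesis by simp
    next
      case False
      have "bcol R' k = bcol R k" using b[OF k] b'[OF k] False by simp
      moreover have "lam R' (e k) (bcol R k) = lam R (e k) (bcol R k)"
        using mrel_lam_drop[OF m, of "e k" "bcol R k"] zR[OF i k] False kN iN r(12) by simp
      ultimately show ?thesis using c[of "e k"] l[OF k, of "e k"] kN by simp
    qed
    with c[OF \<alpha>] show ?thesis by simp
  qed
  have "mut_equiv S R'"
    using mutation_equivalent_trans[OF R(1) mutation_equivalent_mutation[OF R']] .
  then show ?case
    by (intro exI[of _ R'] conjI ballI b' t' l') (simp_all add: s(2) R(2))
qed

lemma isolated_upper_subset:
  assumes S: "qseed S" and z: "\<And>j k. j \<in> ex S \<Longrightarrow> k \<in> ex S \<Longrightarrow> exmat S $$ (j, k) = 0"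
  shows "upper_alg S \<subseteq> cluster_alg S"
proof
  fix u assume u: "u \<in> upper_alg S"
  note q = quantum_seedD[OF S] and F = quantum_seedD(6)[OF S]
  obtain d where d: "\<And>k. k \<in> ex S \<Longrightarrow> d k > 0" "\<And>k \<alpha>. k \<in> ex S \<Longrightarrow> \<alpha> \<in> V \<Longrightarrow> lam S \<alpha> (bcol S k) = \<alpha> $ k * d k"
    using q(7) unfolding compatible_def by metis
  define y where "y k = tmap S (bcol S k)" for k
  have y0: "y k \<noteq> 0" for k using tmap_nonzero[OF F q(12)] by (simp add: y_def)
  define \<sigma> where "\<sigma> K \<alpha> = (\<lambda>k. if k \<in> ex S then (if k \<in> K then - (\<alpha> $ k) else \<alpha> $ k) else 0)" for K and \<alpha> :: "int vec"
  \<comment> \<open>Decomposition of \<open>u\<close> in the torus obtained by mutating at \<open>K\<close>, indexed by degrees that do not depend on \<open>K\<close>.\<close>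
  define Dec where "Dec K D g R \<longleftrightarrow> mut_equiv S R \<and> ex R = ex S \<and> finite D \<and>
      (\<forall>b. g b \<in> mspan R (\<lambda>\<alpha>. \<sigma> K \<alpha> = b)) \<and> (\<forall>b. b \<notin> D \<longrightarrow> g b = 0) \<and> u = sum g D \<and>
      (\<forall>k\<in>ex S. \<forall>b. g b \<in> hom (y k) (- 2 * d k * b k))" for K D g R
  have dec: "\<exists>D g R. Dec K D g R" if K: "K \<subseteq> ex S" for K
  proof -
    obtain R where R: "mut_equiv S R" "ex R = ex S"
      "\<And>k. k \<in> ex S \<Longrightarrow> bcol R k = (if k \<in> K then - bcol S k else bcol S k)"
      "\<And>k. k \<in> ex S \<Longrightarrow> tmap R (bcol S k) = tmap S (bcol S k)"
      "\<And>k \<alpha>. k \<in> ex S \<Longrightarrow> \<alpha> \<in> V \<Longrightarrow> lam R \<alpha> (bcol R k) = \<alpha> $ k * d k"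
      using isolated_mutations[OF S z d finite_subset[OF K q(3)] K] by blast
    have FR: "frame R" using quantum_seedD(6)[OF mutation_equivalent_seed[OF R(1) S]] .
    have "u \<in> torus R" using u R(1) by (auto simp: quantum_upper_cluster_algebra_def)
    from torus_decomp[OF this, of "\<sigma> K"] obtain D g where g: "finite D" "\<And>b. g b \<in> mspan R (\<lambda>\<alpha>. \<sigma> K \<alpha> = b)"
      "\<And>b. b \<notin> D \<Longrightarrow> g b = 0" "u = sum g D" by blast
    have "g b \<in> hom (y k) (- 2 * d k * b k)" if k: "k \<in> ex S" for k b
    proof -
      have "2 * lam R (bcol S k) \<alpha> = - 2 * d k * b k" if \<alpha>: "\<alpha> \<in> V" "\<sigma> K \<alpha> = b" for \<alpha>
      proof -
        have "lam R (bcol S k) \<alpha> = - lam R \<alpha> (bcol S k)" by (rule lam_skew[OF FR q(12) \<alpha>(1)])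
        moreover have "b k = (if k \<in> K then - (\<alpha> $ k) else \<alpha> $ k)"
          using \<alpha>(2) k by (auto simp: \<sigma>_def)
        ultimately show ?thesis
          using R(3)[OF k] R(5)[OF k \<alpha>(1)] q(12) by (auto simp: lam_minus_right[OF FR] \<alpha>(1) ac_simps)
      qed
      then have "mspan R (\<lambda>\<alpha>. \<sigma> K \<alpha> = b) \<subseteq> hom (tmap R (bcol S k)) (- 2 * d k * b k)"
        by (rule mspan_hom[OF FR q(12)])
      from subsetD[OF this g(2)] show ?thesis
        by (simp add: y_def R(4)[OF k])
    qed
    with R(1,2) g have "Dec K D g R" by (simp add: Dec_def)
    then show ?thesis by blast
  qed
  obtain D g R where "Dec {} D g R" using dec[of "{}"] by blast
  then have g: "mut_equiv S R" "finite D" "\<And>b. g b \<in> mspan R (\<lambda>\<alpha>. \<sigma> {} \<alpha> = b)"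
      "\<And>b. b \<notin> D \<Longrightarrow> g b = 0" "u = sum g D" "\<And>k b. k \<in> ex S \<Longrightarrow> g b \<in> hom (y k) (- 2 * d k * b k)"
    unfolding Dec_def by blast+
  have "g b \<in> cluster_alg S" if "b \<in> D" for b
  proof (cases "\<exists>\<alpha>. \<sigma> {} \<alpha> = b")
    case False
    then have "mspan R (\<lambda>\<alpha>. \<sigma> {} \<alpha> = b) \<subseteq> {0}" by (intro mspan_least) (auto simp: qclosed_def)
    with g(3)[of b] show ?thesis using qclosedD(1)[OF qalgD(1)[OF qalg_cluster]] by auto
  next
    case True
    have b0: "b k = 0" if "k \<notin> ex S" for k using True that by (auto simp: \<sigma>_def)
    \<comment> \<open>Mutating exactly where the degree is negative turns all mutable exponents of
      this component into absolute values.\<close>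
    define K where "K = {k\<in>ex S. b k < 0}"
    have "K \<subseteq> ex S" by (auto simp: K_def)
    from dec[OF this] obtain D' h R' where "Dec K D' h R'" by blast
    then have h: "mut_equiv S R'" "ex R' = ex S" "finite D'"
      "\<And>b. h b \<in> mspan R' (\<lambda>\<alpha>. \<sigma> K \<alpha> = b)"
      "\<And>b. b \<notin> D' \<Longrightarrow> h b = 0" "u = sum h D'" "\<And>k b. k \<in> ex S \<Longrightarrow> h b \<in> hom (y k) (- 2 * d k * b k)"
      unfolding Dec_def by blast+
    \<comment> \<open>Degrees separate labels only at mutable indices, so labels must vanish
      elsewhere for the comparison. The others are attained by no exponent, and their components are
      zero.\<close>
    define E where "E = {c \<in> D \<union> D'. \<forall>k. k \<notin> ex S \<longrightarrow> c k = 0}"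
    have E: "finite E" using g(2) h(3) by (simp add: E_def)
    have vanish: "c \<in> E \<or> (g c = 0 \<and> h c = 0)" if "c \<in> D \<union> D'" for c
    proof (cases "\<forall>k. k \<notin> ex S \<longrightarrow> c k = 0")
      case False
      then have "mspan R (\<lambda>\<alpha>. \<sigma> {} \<alpha> = c) \<subseteq> {0}" "mspan R' (\<lambda>\<alpha>. \<sigma> K \<alpha> = c) \<subseteq> {0}"
        by (intro mspan_least; auto simp: qclosed_def \<sigma>_def)+
      with g(3)[of c] h(4)[of c] show ?thesis by auto
    qed (use that in \<open>auto simp: E_def\<close>)
    have fin: "finite (D \<union> D')" using g(2) h(3) by simp
    have sub: "E \<subseteq> D \<union> D'" by (auto simp: E_def)
    have "sum g D = sum g (D \<union> D')" using g(4) by (intro sum.mono_neutral_left[OF fin]) auto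
    also have "\<dots> = sum g E" using vanish by (intro sum.mono_neutral_right[OF fin sub] ballI) blast
    finally have ug: "u = sum g E" using g(5) by simp
    have "sum h D' = sum h (D \<union> D')" using h(5) by (intro sum.mono_neutral_left[OF fin]) auto
    also have "\<dots> = sum h E" using vanish by (intro sum.mono_neutral_right[OF fin sub] ballI) blast
    finally have uh: "u = sum h E" using h(6) by simp
    have "(\<Sum>c\<in>E. g c - h c) = 0" using ug uh by (simp add: sum_subtractf)
    then have "g c - h c = 0" if "c \<in> E" for c
    proof (rule hom_independent[where J = "ex S" and y = y and \<chi> = "\<lambda>k b. - 2 * d k * b k", rotated 4])
      fix a c assume ac: "a \<in> E" "c \<in> E" "a \<noteq> c"
      then obtain k where k: "a k \<noteq> c k" by (auto simp: fun_eq_iff)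
      with ac have "k \<in> ex S" by (auto simp: E_def)
      with k d(1)[of k] show "\<exists>j\<in>ex S. - 2 * d j * a j \<noteq> - 2 * d j * c j" by (intro bexI[of _ k]) auto
    qed (use E y0 g(6) h(7) that in \<open>auto intro: qclosedD(2)[OF qclosed_hom]\<close>)
    moreover have "b \<in> E" using that b0 by (simp add: E_def)
    ultimately have "g b = h b" by simp
    moreover have "mspan R' (\<lambda>\<alpha>. \<sigma> K \<alpha> = b) \<subseteq> cluster_alg S"
    proof (rule mspan_least)
      fix \<alpha> assume \<alpha>: "\<alpha> \<in> V" "\<sigma> K \<alpha> = b"
      show "tmap R' \<alpha> \<in> cluster_alg S"
      proof (rule cluster_generator[OF h(1) \<alpha>(1)])
        fix k assume "k \<in> ex R'"
        then have k: "k \<in> ex S" using h(2) by simp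
        then have "b k = (if k \<in> K then - (\<alpha> $ k) else \<alpha> $ k)" using \<alpha>(2) by (auto simp: \<sigma>_def)
        then show "\<alpha> $ k \<ge> 0" using k by (auto simp: K_def split: if_splits)
      qed
    qed (rule qalgD(1)[OF qalg_cluster])
    ultimately show ?thesis using h(4)[of b] by auto
  qed
  then show "u \<in> cluster_alg S"
    unfolding g(5) by (intro qclosed_sum qalgD(1)[OF qalg_cluster])
qed

lemma upper_subset_cluster:
  assumes P: "\<And>T. T \<in> P \<Longrightarrow> \<not> isolated T \<Longrightarrow>
           \<exists>A \<in> T. \<exists>i < dim_row A. \<exists>j < dim_row A.
             A $$ (i, j) \<noteq> 0 \<and> (is_source A i \<or> is_sink A i) \<and>
             exchange_type (freezing A i) \<in> P \<and> exchange_type (freezing A j) \<in> P"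
    and "qseed S" "exchange_type (principal_part S) \<in> P"
  shows "upper_alg S \<subseteq> cluster_alg S"
  using assms(2,3)
proof (induction "card (ex S)" arbitrary: S rule: less_induct)
  case less
  note S = less.prems(1)
  show ?case
  proof (cases "isolated (exchange_type (principal_part S))")
    case True
    then obtain n where "exchange_type (principal_part S) = exchange_type (0\<^sub>m n n)"
      unfolding isolated_def by blast
    then have "principal_part S = 0\<^sub>m n n"
      using exchange_type_zero[of "principal_part S" n] exchange_type_refl[of "principal_part S"] by simp
    then have z: "principal_part S $$ (a, b) = 0" if "a < card (ex S)" "b < card (ex S)" for a b
      using that quantum_seedD(14)[OF S] by auto
    show ?thesis
    proof (rule isolated_upper_subset[OF S])
      fix j k assume "j \<in> ex S" "k \<in> ex S"
      then obtain a b where "a < card (ex S)" "b < card (ex S)" "j = pick (ex S) a" "k = pick (ex S) b"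
        using pick_surj[OF quantum_seedD(3)[OF S]] by metis
      then show "exmat S $$ (j, k) = 0"
        using z[of a b] principal_part_index[OF quantum_seedD(2,1)[OF S], of a b] by simp
    qed
  next
    case False
    from P[OF less.prems(2) False] obtain A a b where A: "A \<in> exchange_type (principal_part S)"
      and ab: "a < dim_row A" "b < dim_row A" "A $$ (a, b) \<noteq> 0" "is_source A a \<or> is_sink A a"
      and fr: "exchange_type (freezing A a) \<in> P" "exchange_type (freezing A b) \<in> P" by blast
    obtain R where R: "mut_equiv S R" "principal_part R = A"
      using realize_exchange_type[OF S A] by blast
    have qR: "qseed R" by (rule mutation_equivalent_seed[OF R(1) S])
    note r = quantum_seedD[OF qR]
    have dimA: "dim_row A = card (ex R)" using r(14) R(2) by auto
    \<comment> \<open>Exchange steps preserve the size of the matrix; so freezing R, and not only S,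
      has fewer mutable indices than S, and the induction hypothesis applies.\<close>
    have cards: "card (ex R) = card (ex S)"
    proof -
      have "exchange_step\<^sup>*\<^sup>* (principal_part S) A" using A by (simp add: exchange_type_iff)
      then have "dim_row A = dim_row (principal_part S)"
      proof (induction rule: rtranclp_induct)
        case (step A A')
        then show ?case using carrier_matD(1)[OF exchange_step_carrier(2)] by metis
      qed simp
      then show ?thesis using dimA quantum_seedD(14)[OF S] by auto
    qed
    define i where "i = pick (ex R) a"
    define j where "j = pick (ex R) b"
    have a: "a < card (ex R)" and b: "b < card (ex R)" using ab dimA by auto
    have i: "i \<in> ex R" and j: "j \<in> ex R" using pick_in_set_le a b by (auto simp: i_def j_def)
    have Aij: "exmat R $$ (pick (ex R) x, i) = A $$ (x, a)" if "x < card (ex R)" for x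
      using principal_part_index[OF r(2,1) that a] R(2) by (simp add: i_def)
    \<comment> \<open>The hypothesis speaks of the entry in row a, whereas the exchange relation at
      i reads column a.\<close>
    have "A $$ (a, b) = - A $$ (b, a)"
      using r(13) skew_symmetric_iff[OF r(14)] a b R(2) by blast
    then have nz: "exmat R $$ (j, i) \<noteq> 0" using Aij[OF b] ab(3) by (simp add: j_def)
    have ss: "(\<forall>k\<in>ex R. exmat R $$ (k, i) \<le> 0) \<or> (\<forall>k\<in>ex R. exmat R $$ (k, i) \<ge> 0)"
    proof -
      have *: "\<exists>x<dim_row A. exmat R $$ (k, i) = A $$ (x, a)" if "k \<in> ex R" for k
        using pick_surj[OF r(3) that] Aij unfolding dimA by blast
      show ?thesis
        using ab(4) unfolding is_source_def is_sink_def by (auto dest!: *)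
    qed
    have main: "\<exists>n. \<forall>m\<ge>n. tmap R (e (pick (ex R) c)) ^ m * u \<in> cluster_alg R"
      if c: "c < card (ex R)" "exchange_type (freezing A c) \<in> P" and u: "u \<in> upper_alg R" for c u
    proof -
      let ?k = "pick (ex R) c"
      have k: "?k \<in> ex R" by (rule pick_in_set_le[OF c(1)])
      have "card (ex (freeze ?k R)) < card (ex S)"
        using k r(3) cards psubset_card_mono[of "ex R" "ex R - {?k}"] by auto
      moreover have "qseed (freeze ?k R)" by (rule quantum_seed_freeze[OF qR])
      moreover have "exchange_type (principal_part (freeze ?k R)) \<in> P"
        using c(2) by (simp add: principal_part_freeze[OF qR c(1)] R(2))
      ultimately have "upper_alg (freeze ?k R) \<subseteq> cluster_alg (freeze ?k R)"
        by (rule less.hyps)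
      with u upper_subset_freeze[OF qR k] have "u \<in> cluster_alg (freeze ?k R)" by blast
      from freeze_algebra_subset[OF qR k this] show ?thesis .
    qed
    show ?thesis
      unfolding algebra_cong[OF R(1)]
    proof
      fix u assume u: "u \<in> upper_alg R"
      obtain n n' where n: "\<forall>m\<ge>n. tmap R (e i) ^ m * u \<in> cluster_alg R"
        "\<forall>m\<ge>n'. tmap R (e j) ^ m * u \<in> cluster_alg R"
        using main[OF a fr(1) u] main[OF b fr(2) u] unfolding i_def j_def by blast
      obtain f g where fg: "f \<in> cluster_alg R" "g \<in> cluster_alg R"
          "1 = f * tmap R (e i) + g * tmap R (e j)"
        using comaximal[OF qR i j nz ss] by blast
      show "u \<in> cluster_alg R"
        by (rule comaximal_descent[OF qalg_cluster fg _ _ _ n])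
           (use unit_in_cluster[OF qR] r(11)[OF i] r(11)[OF j] tmap_hom[OF r(6), of "e j" "e i"] in auto)
    qed
  qed
qed

end

theorem lemma8p13:
  fixes P :: "int mat set set"
    and v :: "'f::division_ring"
    and N :: nat
    and S :: "'f seed"
  assumes "P \<subseteq> exchange_types"
    and "\<And>T. T \<in> P \<Longrightarrow> \<not> isolated T \<Longrightarrow>
           \<exists>A \<in> T. \<exists>i < dim_row A. \<exists>j < dim_row A.
             A $$ (i, j) \<noteq> 0 \<and> (is_source A i \<or> is_sink A i) \<and>
             exchange_type (freezing A i) \<in> P \<and> exchange_type (freezing A j) \<in> P"
    and "central_unit v"
    and "quantum_seed v N S"
    and "exchange_type (principal_part S) \<in> P"
  shows "quantum_cluster_algebra v N S = quantum_upper_cluster_algebra v N S"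
proof -
  interpret Zq_algebra v by unfold_locales (rule assms(3))
  interpret quantum_base v N
    by unfold_locales (rule quantum_seed_not_root_of_unity[OF assms(4)])
  show ?thesis
    using cluster_algebra_subset_upper[OF assms(4)] upper_subset_cluster[OF assms(2,4,5)] by blast
qed

end
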